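(* Let $\mathcal{E}$ be a locally cartesian closed category with all finite limits. Then the operation $(p,q)\mapsto\begin{bmatrix} q \\ p \end{bmatrix}$ is a right-coclosure for the monoidal category $(\mathbf{Poly}_{\mathcal{E}},y,\triangleleft)$; that is, for each polynomial $q$ the functor $p\mapsto\begin{bmatrix} q \\ p \end{bmatrix}$ is left adjoint to $-\triangleleft q$, naturally in $q$.
   Context: For $f\colon B\to A$ in $\mathcal{E}$, $\Delta_f\colon\mathcal{E}/A\to\mathcal{E}/B$ denotes pullback along $f$; $f$ is exponentiable if $\Delta_f$ has a right adjoint $\Pi_f$. $\mathcal{E}$ is locally cartesian closed if every morphism is exponentiable. A polynomial in $\mathcal{E}$ is an exponentiable morphism $p\colon P_*\to P$. A morphism of polynomials $\phi\colon p\to q$ is a pair $\phi_1\colon P\to Q$, $\phi^\sharp\colon P\times_Q Q_*\to P_*$ with $p\circ\phi^\sharp$ the projection to $P$, up to isomorphism of the choice of pullback. Composition is $(\psi\circ\phi)_1=\psi_1\circ\phi_1$, $(\psi\circ\phi)^\sharp=\phi^\sharp\circ(P\times_Q\psi^\sharp)$. This gives the category $\mathbf{Poly}_{\mathcal{E}}$. It is monoidal under $(y,\triangleleft)$, where $y=\mathrm{id}_1$ and $p\triangleleft q$ is the composite of projections $(\Pi_p(Q\times P_* )\times_P P_* )\times_Q Q_*\to\Pi_p(Q\times P_* )\times_P P_*\to\Pi_p(Q\times P_* )$, with $\Pi_p(Q\times P_* )\times_P P_*\to Q$ the counit of $\Delta_p\dashv\Pi_p$ followed by projection. In generalized elements,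 positions are pairs $(x\colon X\to P,\ f\colon X\times_PP_*\to Q)$ and a direction at $(x,f)$ is a pair $(y,z)$ with $y$ in $P_*$ over $x$, $z$ in $Q_*$ over $f(y)$. On morphisms, $\phi\triangleleft\psi$ sends $(x,f)$ to $(\phi_1x,\psi_1\circ f\circ\phi^\sharp(x,-))$ and a direction $(y',z')$ there to $(\phi^\sharp(x,y'),\psi^\sharp(f(\phi^\sharp(x,y')),z'))$. For polynomials $p,q$, $\begin{bmatrix} q \\ p \end{bmatrix}$ is the composite $\Pi_{\mathrm{id}_P\times q}(p\times\mathrm{id}_{Q_*})\to P\times Q\to P$, where $p\times\mathrm{id}_{Q_*}\colon P_*\times Q_*\to P\times Q_*$ is regarded as an object over $P\times Q_*$, $\mathrm{id}_P\times q\colon P\times Q_*\to P\times Q$, and the last map is the projection. It is covariantly functorial in $p$ and contravariantly functorial in $q$. *)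

theory Defs
  imports Main
begin

section \<open>Categories, functors, adjunctions\<close>

text \<open>A category is given by carriers of objects and arrows inside arbitrary types;
  \<open>Comp C g f\<close>, written \<open>g \<cdot> f\<close>, is composition in the order of
  functions, and is only meaningful when \<open>Cod f = Dom g\<close>.\<close>

record ('o, 'a) category =
  Obj :: "'o set"
  Arr :: "'a set"
  Dom :: "'a \<Rightarrow> 'o"
  Cod :: "'a \<Rightarrow> 'o"
  Id :: "'o \<Rightarrow> 'a"
  Comp :: "'a \<Rightarrow> 'a \<Rightarrow> 'a"  (infixr "\<cdot>\<index>" 75)

definition hom :: "('o, 'a) category \<Rightarrow> 'o \<Rightarrow> 'o \<Rightarrow> 'a set" where
  "hom C a b = {f \<in> Arr C. Dom C f = a \<and> Cod C f = b}"

locale is_category =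
  fixes C :: "('o, 'a) category" (structure)
  assumes Dom_in: "f \<in> Arr C \<Longrightarrow> Dom C f \<in> Obj C"
    and Cod_in: "f \<in> Arr C \<Longrightarrow> Cod C f \<in> Obj C"
    and Id_in: "a \<in> Obj C \<Longrightarrow> Id C a \<in> hom C a a"
    and Comp_in: "f \<in> hom C a b \<Longrightarrow> g \<in> hom C b c \<Longrightarrow> g \<cdot> f \<in> hom C a c"
    and Comp_Id: "f \<in> hom C a b \<Longrightarrow> f \<cdot> Id C a = f"
    and Id_Comp: "f \<in> hom C a b \<Longrightarrow> Id C b \<cdot> f = f"
    and Comp_assoc: "f \<in> hom C a b \<Longrightarrow> g \<in> hom C b c \<Longrightarrow> h \<in> hom C c d \<Longrightarrow>
      (h \<cdot> g) \<cdot> f = h \<cdot> (g \<cdot> f)"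

definition op_cat :: "('o, 'a) category \<Rightarrow> ('o, 'a) category" where
  "op_cat C = \<lparr>Obj = Obj C, Arr = Arr C, Dom = Cod C, Cod = Dom C, Id = Id C,
     Comp = (\<lambda>g f. f \<cdot>\<^bsub>C\<^esub> g)\<rparr>"

definition prod_cat ::
  "('o1, 'a1) category \<Rightarrow> ('o2, 'a2) category \<Rightarrow> ('o1 \<times> 'o2, 'a1 \<times> 'a2) category" where
  "prod_cat C D = \<lparr>Obj = Obj C \<times> Obj D, Arr = Arr C \<times> Arr D,
     Dom = map_prod (Dom C) (Dom D), Cod = map_prod (Cod C) (Cod D),
     Id = map_prod (Id C) (Id D),
     Comp = (\<lambda>(g, g') (f, f'). (g \<cdot>\<^bsub>C\<^esub> f, g' \<cdot>\<^bsub>D\<^esub> f'))\<rparr>"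

record ('o1, 'a1, 'o2, 'a2) cfunctor =
  on_obj :: "'o1 \<Rightarrow> 'o2"
  on_arr :: "'a1 \<Rightarrow> 'a2"

locale is_functor = C: is_category C + D: is_category D
  for C :: "('o1, 'a1) category" and D :: "('o2, 'a2) category" +
  fixes F :: "('o1, 'a1, 'o2, 'a2) cfunctor"
  assumes on_obj_in: "a \<in> Obj C \<Longrightarrow> on_obj F a \<in> Obj D"
    and on_arr_in: "f \<in> hom C a b \<Longrightarrow> on_arr F f \<in> hom D (on_obj F a) (on_obj F b)"
    and on_arr_Id: "a \<in> Obj C \<Longrightarrow> on_arr F (Id C a) = Id D (on_obj F a)"
    and on_arr_Comp: "f \<in> hom C a b \<Longrightarrow> g \<in> hom C b c \<Longrightarrow>
      on_arr F (g \<cdot>\<^bsub>C\<^esub> f) = on_arr F g \<cdot>\<^bsub>D\<^esub> on_arr F f"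

text \<open>\<open>F : C \<rightarrow> D\<close> is left adjoint to \<open>G : D \<rightarrow> C\<close>, via the
  bijections \<open>\<theta> c d : D(F c, d) \<rightarrow> C(c, G d)\<close>, natural in \<open>c\<close> and \<open>d\<close>.\<close>

locale adjunction = F: is_functor C D F + G: is_functor D C G
  for C :: "('o1, 'a1) category" and D :: "('o2, 'a2) category"
    and F :: "('o1, 'a1, 'o2, 'a2) cfunctor" and G :: "('o2, 'a2, 'o1, 'a1) cfunctor" +
  fixes \<theta> :: "'o1 \<Rightarrow> 'o2 \<Rightarrow> 'a2 \<Rightarrow> 'a1"
  assumes transpose_bij: "c \<in> Obj C \<Longrightarrow> d \<in> Obj D \<Longrightarrow>
      bij_betw (\<theta> c d) (hom D (on_obj F c) d) (hom C c (on_obj G d))"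
    and transpose_natural: "h \<in> hom C c' c \<Longrightarrow> k \<in> hom D d d' \<Longrightarrow> u \<in> hom D (on_obj F c) d \<Longrightarrow>
      \<theta> c' d' (k \<cdot>\<^bsub>D\<^esub> u \<cdot>\<^bsub>D\<^esub> on_arr F h) = on_arr G k \<cdot>\<^bsub>C\<^esub> \<theta> c d u \<cdot>\<^bsub>C\<^esub> h"

definition counit ::
  "('o1, 'a1) category \<Rightarrow> ('o2, 'a2) category \<Rightarrow> ('o1, 'a1, 'o2, 'a2) cfunctor \<Rightarrow>
   ('o2, 'a2, 'o1, 'a1) cfunctor \<Rightarrow> ('o1 \<Rightarrow> 'o2 \<Rightarrow> 'a2 \<Rightarrow> 'a1) \<Rightarrow> 'o2 \<Rightarrow> 'a2" where
  "counit C D F G \<theta> d =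
     inv_into (hom D (on_obj F (on_obj G d)) d) (\<theta> (on_obj G d) d) (Id C (on_obj G d))"


section \<open>Finite limits\<close>

definition is_cone ::
  "('j, 'k) category \<Rightarrow> ('o, 'a) category \<Rightarrow> ('j, 'k, 'o, 'a) cfunctor \<Rightarrow> 'o \<Rightarrow> ('j \<Rightarrow> 'a) \<Rightarrow> bool" where
  "is_cone J C D L \<pi> \<longleftrightarrow> L \<in> Obj C \<and> (\<forall>j\<in>Obj J. \<pi> j \<in> hom C L (on_obj D j)) \<and>
     (\<forall>f\<in>Arr J. on_arr D f \<cdot>\<^bsub>C\<^esub> \<pi> (Dom J f) = \<pi> (Cod J f))"

definition is_limit ::
  "('j, 'k) category \<Rightarrow> ('o, 'a) category \<Rightarrow> ('j, 'k, 'o, 'a) cfunctor \<Rightarrow> 'o \<Rightarrow> ('j \<Rightarrow> 'a) \<Rightarrow> bool" where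
  "is_limit J C D L \<pi> \<longleftrightarrow> is_cone J C D L \<pi> \<and>
     (\<forall>M \<mu>. is_cone J C D M \<mu> \<longrightarrow> (\<exists>!u. u \<in> hom C M L \<and> (\<forall>j\<in>Obj J. \<pi> j \<cdot>\<^bsub>C\<^esub> u = \<mu> j)))"

text \<open>Every finite category is isomorphic to one whose objects and arrows are natural
  numbers, so these shapes suffice.\<close>

definition has_finite_limits :: "('o, 'a) category \<Rightarrow> bool" where
  "has_finite_limits C \<longleftrightarrow>
     (\<forall>(J :: (nat, nat) category) D. finite (Obj J) \<longrightarrow> finite (Arr J) \<longrightarrow> is_functor J C D \<longrightarrow>
        (\<exists>L \<pi>. is_limit J C D L \<pi>))"

definition is_terminal :: "('o, 'a) category \<Rightarrow> 'o \<Rightarrow> bool" where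
  "is_terminal C t \<longleftrightarrow> t \<in> Obj C \<and> (\<forall>a\<in>Obj C. \<exists>!u. u \<in> hom C a t)"

definition is_product :: "('o, 'a) category \<Rightarrow> 'o \<Rightarrow> 'o \<Rightarrow> 'a \<times> 'a \<Rightarrow> bool" where
  "is_product C a b = (\<lambda>(p1, p2). p1 \<in> Arr C \<and> p2 \<in> Arr C \<and> Dom C p1 = Dom C p2 \<and>
     Cod C p1 = a \<and> Cod C p2 = b \<and>
     (\<forall>x. \<forall>u\<in>hom C x a. \<forall>v\<in>hom C x b.
        \<exists>!w. w \<in> hom C x (Dom C p1) \<and> p1 \<cdot>\<^bsub>C\<^esub> w = u \<and> p2 \<cdot>\<^bsub>C\<^esub> w = v))"

definition is_pullback :: "('o, 'a) category \<Rightarrow> 'a \<Rightarrow> 'a \<Rightarrow> 'a \<times> 'a \<Rightarrow> bool" where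
  "is_pullback C f g = (\<lambda>(p1, p2). p1 \<in> Arr C \<and> p2 \<in> Arr C \<and> Dom C p1 = Dom C p2 \<and>
     Cod C p1 = Dom C f \<and> Cod C p2 = Dom C g \<and> f \<cdot>\<^bsub>C\<^esub> p1 = g \<cdot>\<^bsub>C\<^esub> p2 \<and>
     (\<forall>x. \<forall>u\<in>hom C x (Dom C f). \<forall>v\<in>hom C x (Dom C g). f \<cdot>\<^bsub>C\<^esub> u = g \<cdot>\<^bsub>C\<^esub> v \<longrightarrow>
        (\<exists>!w. w \<in> hom C x (Dom C p1) \<and> p1 \<cdot>\<^bsub>C\<^esub> w = u \<and> p2 \<cdot>\<^bsub>C\<^esub> w = v)))"


section \<open>Right coclosures\<close>

text \<open>The underlying data of a monoidal category. The coherence isomorphisms are omitted, as a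
  right coclosure does not refer to them.\<close>

record ('o, 'a) monoidal_data =
  carrier_cat :: "('o, 'a) category"
  tensor :: "('o \<times> 'o, 'a \<times> 'a, 'o, 'a) cfunctor"
  unit_obj :: 'o

definition fix_fst ::
  "('o1, 'a1) category \<Rightarrow> ('o1 \<times> 'o2, 'a1 \<times> 'a2, 'o3, 'a3) cfunctor \<Rightarrow> 'o1 \<Rightarrow>
   ('o2, 'a2, 'o3, 'a3) cfunctor" where
  "fix_fst C H a = \<lparr>on_obj = (\<lambda>b. on_obj H (a, b)), on_arr = (\<lambda>g. on_arr H (Id C a, g))\<rparr>"

definition fix_snd ::
  "('o2, 'a2) category \<Rightarrow> ('o1 \<times> 'o2, 'a1 \<times> 'a2, 'o3, 'a3) cfunctor \<Rightarrow> 'o2 \<Rightarrow>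
   ('o1, 'a1, 'o3, 'a3) cfunctor" where
  "fix_snd D H b = \<lparr>on_obj = (\<lambda>a. on_obj H (a, b)), on_arr = (\<lambda>f. on_arr H (f, Id D b))\<rparr>"

text \<open>The functor \<open>H : C\<^sup>o\<^sup>p \<times> C \<rightarrow> C\<close> is a right coclosure if
  \<open>H(q, -)\<close> is left adjoint to \<open>- \<otimes> q\<close> for every \<open>q\<close>, naturally in \<open>q\<close>.\<close>

definition right_coclosure ::
  "('o, 'a) monoidal_data \<Rightarrow> ('o \<times> 'o, 'a \<times> 'a, 'o, 'a) cfunctor \<Rightarrow> bool" where
  "right_coclosure M H \<longleftrightarrow>
     (let C = carrier_cat M; T = tensor M in
      unit_obj M \<in> Obj C \<and>
      is_functor (prod_cat C C) C T \<and>
      is_functor (prod_cat (op_cat C) C) C H \<and>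
      (\<exists>\<Theta>. (\<forall>q\<in>Obj C. adjunction C C (fix_fst C H q) (fix_snd C T q) (\<Theta> q)) \<and>
        (\<forall>q q' p r. \<forall>\<psi>\<in>hom C q q'. p \<in> Obj C \<longrightarrow> r \<in> Obj C \<longrightarrow>
          (\<forall>u\<in>hom C (on_obj H (q, p)) r.
            \<Theta> q' p r (u \<cdot>\<^bsub>C\<^esub> on_arr H (\<psi>, Id C p)) = on_arr T (Id C r, \<psi>) \<cdot>\<^bsub>C\<^esub> \<Theta> q p r u))))"


section \<open>Slices, pullback functors and their right adjoints\<close>

text \<open>An arrow of the slice \<open>E/A\<close> is a triple \<open>(f, h, g)\<close> with \<open>g \<cdot> h = f\<close>,
  regarded as an arrow from \<open>f\<close> to \<open>g\<close>; its middle component is the arrow of \<open>E\<close>.\<close>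

type_synonym 'a slice_arr = "'a \<times> 'a \<times> 'a"

definition underlying :: "'a slice_arr \<Rightarrow> 'a" where
  "underlying = (\<lambda>(f, h, g). h)"

context
  fixes E :: "('o, 'a) category" (structure)
begin

definition slice :: "'o \<Rightarrow> ('a, 'a slice_arr) category" where
  "slice A = \<lparr>Obj = {f \<in> Arr E. Cod E f = A},
     Arr = {(f, h, g). f \<in> Arr E \<and> g \<in> Arr E \<and> Cod E f = A \<and> Cod E g = A \<and>
              h \<in> hom E (Dom E f) (Dom E g) \<and> g \<cdot> h = f},
     Dom = (\<lambda>(f, h, g). f), Cod = (\<lambda>(f, h, g). g), Id = (\<lambda>f. (f, Id E (Dom E f), f)),
     Comp = (\<lambda>(g', k, l) (f, h, g). (f, k \<cdot> h, l))\<rparr>"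

text \<open>Chosen finite limits: the terminal object, binary products, and pullbacks. For
  \<open>f : X \<rightarrow> Z\<close> and \<open>g : Y \<rightarrow> Z\<close>, \<open>pb1 f g\<close> and \<open>pb2 f g\<close> are the projections of
  \<open>X \<times>\<^sub>Z Y\<close> to \<open>X\<close> and \<open>Y\<close>.\<close>

definition one :: 'o where
  "one = (SOME t. is_terminal E t)"

definition pr1 :: "'o \<Rightarrow> 'o \<Rightarrow> 'a" where
  "pr1 a b = fst (SOME pr. is_product E a b pr)"

definition pr2 :: "'o \<Rightarrow> 'o \<Rightarrow> 'a" where
  "pr2 a b = snd (SOME pr. is_product E a b pr)"

definition prod_pair :: "'o \<Rightarrow> 'o \<Rightarrow> 'a \<Rightarrow> 'a \<Rightarrow> 'a" where
  "prod_pair a b u v =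
     (THE w. w \<in> hom E (Dom E u) (Dom E (pr1 a b)) \<and> pr1 a b \<cdot> w = u \<and> pr2 a b \<cdot> w = v)"

definition prod_arr :: "'a \<Rightarrow> 'a \<Rightarrow> 'a" where
  "prod_arr f g = prod_pair (Cod E f) (Cod E g)
     (f \<cdot> pr1 (Dom E f) (Dom E g)) (g \<cdot> pr2 (Dom E f) (Dom E g))"

definition pb1 :: "'a \<Rightarrow> 'a \<Rightarrow> 'a" where
  "pb1 f g = fst (SOME pr. is_pullback E f g pr)"

definition pb2 :: "'a \<Rightarrow> 'a \<Rightarrow> 'a" where
  "pb2 f g = snd (SOME pr. is_pullback E f g pr)"

definition pb_pair :: "'a \<Rightarrow> 'a \<Rightarrow> 'a \<Rightarrow> 'a \<Rightarrow> 'a" where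
  "pb_pair f g u v =
     (THE w. w \<in> hom E (Dom E u) (Dom E (pb1 f g)) \<and> pb1 f g \<cdot> w = u \<and> pb2 f g \<cdot> w = v)"

definition Delta :: "'a \<Rightarrow> ('a, 'a slice_arr, 'a, 'a slice_arr) cfunctor" where
  "Delta f = \<lparr>on_obj = (\<lambda>x. pb2 x f),
     on_arr = (\<lambda>(x, h, x'). (pb2 x f, pb_pair x' f (h \<cdot> pb1 x f) (pb2 x f), pb2 x' f))\<rparr>"

definition exponentiable :: "'a \<Rightarrow> bool" where
  "exponentiable f \<longleftrightarrow> f \<in> Arr E \<and>
     (\<exists>G \<theta>. adjunction (slice (Cod E f)) (slice (Dom E f)) (Delta f) G \<theta>)"

definition locally_cartesian_closed :: bool where
  "locally_cartesian_closed \<longleftrightarrow> (\<forall>f\<in>Arr E. exponentiable f)"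

definition PiAdj ::
  "'a \<Rightarrow> ('a, 'a slice_arr, 'a, 'a slice_arr) cfunctor \<times> ('a \<Rightarrow> 'a \<Rightarrow> 'a slice_arr \<Rightarrow> 'a slice_arr)" where
  "PiAdj f = (SOME (G, \<theta>). adjunction (slice (Cod E f)) (slice (Dom E f)) (Delta f) G \<theta>)"

definition PiOb :: "'a \<Rightarrow> 'a \<Rightarrow> 'a" where
  "PiOb f b = on_obj (fst (PiAdj f)) b"

definition PiCounit :: "'a \<Rightarrow> 'a \<Rightarrow> 'a" where
  "PiCounit f b = underlying
     (counit (slice (Cod E f)) (slice (Dom E f)) (Delta f) (fst (PiAdj f)) (snd (PiAdj f)) b)"

text \<open>For \<open>f : B \<rightarrow> A\<close>, \<open>x : X \<rightarrow> A\<close> and \<open>b : Y \<rightarrow> B\<close>, the arrow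
  \<open>X \<rightarrow> \<Pi>\<^sub>f Y\<close> over \<open>A\<close> corresponding to \<open>h : X \<times>\<^sub>A B \<rightarrow> Y\<close> over \<open>B\<close>.\<close>

definition PiTranspose :: "'a \<Rightarrow> 'a \<Rightarrow> 'a \<Rightarrow> 'a \<Rightarrow> 'a" where
  "PiTranspose f x b h = underlying (snd (PiAdj f) x b (pb2 x f, h, b))"

end


section \<open>Polynomials\<close>

text \<open>A polynomial \<open>p : P\<^sub>* \<rightarrow> P\<close> is an arrow of \<open>E\<close>, with \<open>Cod E p = P\<close> and
  \<open>Dom E p = P\<^sub>*\<close>. A morphism \<open>\<phi> : p \<rightarrow> q\<close> records source and target along with
  \<open>\<phi>\<^sub>1 : P \<rightarrow> Q\<close> and \<open>\<phi>\<^sup>\<sharp> : P \<times>\<^sub>Q Q\<^sub>* \<rightarrow> P\<^sub>*\<close>, the latter on the chosen pullback.\<close>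

record 'a poly_arr =
  src :: 'a
  tgt :: 'a
  pos :: 'a
  sharp :: 'a

context
  fixes E :: "('o, 'a) category" (structure)
begin

text \<open>\<open>\<phi>\<^sup>\<sharp>(x, y)\<close> in generalized elements, for \<open>x : X \<rightarrow> P\<close> and \<open>y : X \<rightarrow> Q\<^sub>*\<close>
  with \<open>\<phi>\<^sub>1 \<cdot> x = q \<cdot> y\<close>.\<close>

definition sharp_at :: "'a poly_arr \<Rightarrow> 'a \<Rightarrow> 'a \<Rightarrow> 'a" where
  "sharp_at \<phi> x y = sharp \<phi> \<cdot> pb_pair E (pos \<phi>) (tgt \<phi>) x y"

text \<open>\<open>\<phi>\<^sup>\<sharp>(x, -) : X \<times>\<^sub>Q Q\<^sub>* \<rightarrow> X \<times>\<^sub>P P\<^sub>*\<close>, for \<open>x : X \<rightarrow> P\<close>; also written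
  \<open>X \<times>\<^sub>P \<phi>\<^sup>\<sharp>\<close>.\<close>

definition sharp_over :: "'a poly_arr \<Rightarrow> 'a \<Rightarrow> 'a" where
  "sharp_over \<phi> x = (let x' = pos \<phi> \<cdot> x in
     pb_pair E x (src \<phi>) (pb1 E x' (tgt \<phi>))
       (sharp_at \<phi> (x \<cdot> pb1 E x' (tgt \<phi>)) (pb2 E x' (tgt \<phi>))))"

definition Poly :: "('a, 'a poly_arr) category" where
  "Poly = \<lparr>Obj = {p. exponentiable E p},
     Arr = {\<phi>. exponentiable E (src \<phi>) \<and> exponentiable E (tgt \<phi>) \<and>
              pos \<phi> \<in> hom E (Cod E (src \<phi>)) (Cod E (tgt \<phi>)) \<and>
              sharp \<phi> \<in> hom E (Dom E (pb1 E (pos \<phi>) (tgt \<phi>))) (Dom E (src \<phi>)) \<and>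
              src \<phi> \<cdot> sharp \<phi> = pb1 E (pos \<phi>) (tgt \<phi>)},
     Dom = src, Cod = tgt,
     Id = (\<lambda>p. \<lparr>src = p, tgt = p, pos = Id E (Cod E p), sharp = pb2 E (Id E (Cod E p)) p\<rparr>),
     Comp = (\<lambda>\<psi> \<phi>. \<lparr>src = src \<phi>, tgt = tgt \<psi>, pos = pos \<psi> \<cdot> pos \<phi>,
               sharp = sharp \<phi> \<cdot> sharp_over \<psi> (pos \<phi>)\<rparr>)\<rparr>"


section \<open>The composition product\<close>

text \<open>\<open>tri_pos p q\<close> is the structure map to \<open>P\<close> of the object of positions
  \<open>\<Pi>\<^sub>p(Q \<times> P\<^sub>*)\<close>, and \<open>tri_ev p q\<close> the map from its pullback along \<open>p\<close> to \<open>Q\<close>.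
  \<open>tri_pos_elem p q x f\<close> is the generalized element \<open>(x, f)\<close>, for \<open>x : X \<rightarrow> P\<close> and
  \<open>f : X \<times>\<^sub>P P\<^sub>* \<rightarrow> Q\<close>.\<close>

definition tri_pos :: "'a \<Rightarrow> 'a \<Rightarrow> 'a" where
  "tri_pos p q = PiOb E p (pr2 E (Cod E q) (Dom E p))"

definition tri_ev :: "'a \<Rightarrow> 'a \<Rightarrow> 'a" where
  "tri_ev p q = pr1 E (Cod E q) (Dom E p) \<cdot> PiCounit E p (pr2 E (Cod E q) (Dom E p))"

definition tri_pos_elem :: "'a \<Rightarrow> 'a \<Rightarrow> 'a \<Rightarrow> 'a \<Rightarrow> 'a" where
  "tri_pos_elem p q x f =
     PiTranspose E p x (pr2 E (Cod E q) (Dom E p)) (prod_pair E (Cod E q) (Dom E p) f (pb2 E x p))"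

definition tri :: "'a \<Rightarrow> 'a \<Rightarrow> 'a" where
  "tri p q = pb1 E (tri_pos p q) p \<cdot> pb1 E (tri_ev p q) q"

text \<open>The action on morphisms \<open>\<phi> : p \<rightarrow> p'\<close> and \<open>\<psi> : q \<rightarrow> q'\<close>, on the universal
  generalized elements: \<open>t\<close> is a position of \<open>p \<triangleleft> q\<close> and \<open>(y', z')\<close> a direction of
  \<open>p' \<triangleleft> q'\<close> at its image; \<open>u\<close> is \<open>(t, \<phi>\<^sup>\<sharp>(x, y'))\<close>, where \<open>x\<close> is the position
  of \<open>p\<close> below \<open>t\<close>.\<close>

definition tri_arr :: "'a poly_arr \<Rightarrow> 'a poly_arr \<Rightarrow> 'a poly_arr" where
  "tri_arr \<phi> \<psi> = (let
     p = src \<phi>; p' = tgt \<phi>; q = src \<psi>; q' = tgt \<psi>;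
     \<pi> = tri_pos p q; ev = tri_ev p q;
     \<pi>' = tri_pos p' q'; ev' = tri_ev p' q';
     m = tri_pos_elem p' q' (pos \<phi> \<cdot> \<pi>) (pos \<psi> \<cdot> ev \<cdot> sharp_over \<phi> \<pi>);
     t = pb1 E m (tri p' q'); d = pb2 E m (tri p' q');
     y' = pb2 E \<pi>' p' \<cdot> pb1 E ev' q' \<cdot> d;
     z' = pb2 E ev' q' \<cdot> d;
     u = pb_pair E \<pi> p t (sharp_at \<phi> (\<pi> \<cdot> t) y')
   in \<lparr>src = tri p q, tgt = tri p' q', pos = m,
       sharp = pb_pair E ev q u (sharp_at \<psi> (ev \<cdot> u) z')\<rparr>)"

definition Poly_tri :: "('a, 'a poly_arr) monoidal_data" where
  "Poly_tri = \<lparr>carrier_cat = Poly,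
     tensor = \<lparr>on_obj = (\<lambda>(p, q). tri p q), on_arr = (\<lambda>(\<phi>, \<psi>). tri_arr \<phi> \<psi>)\<rparr>,
     unit_obj = Id E (one E)\<rparr>"


section \<open>The coclosure\<close>

text \<open>\<open>coc_dir q p\<close> is the map \<open>K = \<Pi>\<^bsub>id \<times> q\<^esub>(p \<times> id) \<rightarrow> P \<times> Q\<close>.\<close>

definition coc_dir :: "'a \<Rightarrow> 'a \<Rightarrow> 'a" where
  "coc_dir q p = PiOb E (prod_arr E (Id E (Cod E p)) q) (prod_arr E p (Id E (Dom E q)))"

definition coc :: "'a \<Rightarrow> 'a \<Rightarrow> 'a" where
  "coc q p = pr1 E (Cod E p) (Cod E q) \<cdot> coc_dir q p"

text \<open>In generalized elements, a direction of \<open>coc q p\<close> at \<open>i\<close> is a pair \<open>(j, g)\<close> of a position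
  \<open>j\<close> of \<open>q\<close> and a map \<open>g\<close> from the directions of \<open>q\<close> at \<open>j\<close> to those of \<open>p\<close> at \<open>i\<close>.
  \<open>coc_j q p : K \<rightarrow> Q\<close> is the component \<open>j\<close>, and \<open>coc_ev q p k z\<close> is \<open>g(z)\<close>, for
  \<open>k : X \<rightarrow> K\<close> and \<open>z : X \<rightarrow> Q\<^sub>*\<close> over the same map to \<open>Q\<close>. Conversely, \<open>coc_elem q p i j g\<close>
  is the arrow \<open>X \<rightarrow> K\<close> given by \<open>i : X \<rightarrow> P\<close>, \<open>j : X \<rightarrow> Q\<close>, and
  \<open>g : X \<times>\<^sub>Q Q\<^sub>* \<rightarrow> P\<^sub>*\<close> over \<open>P\<close>.\<close>

definition coc_j :: "'a \<Rightarrow> 'a \<Rightarrow> 'a" where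
  "coc_j q p = pr2 E (Cod E p) (Cod E q) \<cdot> coc_dir q p"

definition coc_ev :: "'a \<Rightarrow> 'a \<Rightarrow> 'a \<Rightarrow> 'a \<Rightarrow> 'a" where
  "coc_ev q p k z =
     pr1 E (Dom E p) (Dom E q) \<cdot>
     PiCounit E (prod_arr E (Id E (Cod E p)) q) (prod_arr E p (Id E (Dom E q))) \<cdot>
     pb_pair E (coc_dir q p) (prod_arr E (Id E (Cod E p)) q) k
       (prod_pair E (Cod E p) (Dom E q) (coc q p \<cdot> k) z)"

definition coc_elem :: "'a \<Rightarrow> 'a \<Rightarrow> 'a \<Rightarrow> 'a \<Rightarrow> 'a \<Rightarrow> 'a" where
  "coc_elem q p i j g = (let
     f = prod_arr E (Id E (Cod E p)) q;
     x = prod_pair E (Cod E p) (Cod E q) i j;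
     z = pr2 E (Cod E p) (Dom E q) \<cdot> pb2 E x f
   in PiTranspose E f x (prod_arr E p (Id E (Dom E q)))
        (prod_pair E (Dom E p) (Dom E q) (g \<cdot> pb_pair E j q (pb1 E x f) z) z))"

text \<open>The morphism \<open>coc q' p \<rightarrow> coc q p'\<close> induced by \<open>\<psi> : q \<rightarrow> q'\<close> and \<open>\<phi> : p \<rightarrow> p'\<close>
  is \<open>\<phi>\<^sub>1\<close> on positions, and sends a direction \<open>(j, g)\<close> at \<open>\<phi>\<^sub>1 i\<close> to
  \<open>(\<psi>\<^sub>1 j, \<phi>\<^sup>\<sharp>(i, -) \<circ> g \<circ> \<psi>\<^sup>\<sharp>(j, -))\<close>.\<close>

definition coc_arr :: "'a poly_arr \<Rightarrow> 'a poly_arr \<Rightarrow> 'a poly_arr" where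
  "coc_arr \<psi> \<phi> = (let
     q = src \<psi>; q' = tgt \<psi>; p = src \<phi>; p' = tgt \<phi>;
     i = pb1 E (pos \<phi>) (coc q p'); k = pb2 E (pos \<phi>) (coc q p');
     j = coc_j q p' \<cdot> k;
     s = pb1 E (pos \<psi> \<cdot> j) q'; z' = pb2 E (pos \<psi> \<cdot> j) q'
   in \<lparr>src = coc q' p, tgt = coc q p', pos = pos \<phi>,
       sharp = coc_elem q' p i (pos \<psi> \<cdot> j)
         (sharp_at \<phi> (i \<cdot> s) (coc_ev q p' (k \<cdot> s) (sharp_at \<psi> (j \<cdot> s) z')))\<rparr>)"

definition coc_functor :: "('a \<times> 'a, 'a poly_arr \<times> 'a poly_arr, 'a, 'a poly_arr) cfunctor" where
  "coc_functor = \<lparr>on_obj = (\<lambda>(q, p). coc q p), on_arr = (\<lambda>(\<psi>, \<phi>). coc_arr \<psi> \<phi>)\<rparr>"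

end

end

theory Submission
  imports Defs
begin

text \<open>Everything is computed in generalized elements. A polynomial morphism \<open>\<phi>\<close> is determined by
  \<open>\<phi>\<^sub>1\<close> and the natural operation \<open>(x, y) \<mapsto> \<phi>\<^sup>\<sharp>(x, y)\<close>; a position \<open>t\<close> of \<open>p \<triangleleft> q\<close> by the position
  of \<open>p\<close> below it and the operation \<open>y \<mapsto> tri_at p q t y\<close>; a direction \<open>k\<close> of the coclosure by its
  position of \<open>p\<close>, its position \<open>coc_j k\<close> of \<open>q\<close>, and the operation \<open>z \<mapsto> coc_ev k z\<close>. In these terms
  a morphism \<open>u\<close> from the coclosure of \<open>q\<close> and \<open>p\<close> to \<open>r\<close> and a morphism \<open>p \<rightarrow> r \<triangleleft> q\<close> carry the same
  data: both consist of a position \<open>u\<^sub>1 i\<close> of \<open>r\<close> for each position \<open>i\<close> of \<open>p\<close>, and for each direction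
  \<open>y\<close> at \<open>u\<^sub>1 i\<close> of a position \<open>j\<close> of \<open>q\<close> with a map from the directions at \<open>j\<close> to those at \<open>i\<close>.\<close>

text \<open>Terminal object, products, pullbacks and dependent products come from Hilbert choice, so
  objects built along different routes agree at best up to isomorphism. The proof therefore never
  compares such objects: each is used only through a rule that builds elements, a rule that
  evaluates them, and an extensionality rule. An element of a dependent product is a map that must
  make sense after every change of stage. So extensionality tests after an arbitrary precomposition
  \<open>s\<close>, and every operation needs a rule that moves \<open>\<cdot> s\<close> inside it.
  With composites nested to the right and squares oriented towards positions, these rules are a
  rewriting calculus in which evaluations are strict equations. Local cartesian closure serves
  twice: it provides the dependent product along \<open>id \<times> q\<close>, and it makes every
  arrow a polynomial. Naturality in all three variables is proved once and then specialised to the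
  two naturality conditions of a coclosure.\<close>

context is_category
begin

lemma comp_arr [simp]:
  assumes "f \<in> Arr C" "g \<in> Arr C" "Dom C g = Cod C f"
  shows "g \<cdot> f \<in> Arr C" "Dom C (g \<cdot> f) = Dom C f" "Cod C (g \<cdot> f) = Cod C g"
  using Comp_in[of f "Dom C f" "Cod C f" g "Cod C g"] assms by (auto simp: hom_def)

lemma comp_assoc [simp]:
  assumes "f \<in> Arr C" "g \<in> Arr C" "h \<in> Arr C" "Dom C g = Cod C f" "Dom C h = Cod C g"
  shows "(h \<cdot> g) \<cdot> f = h \<cdot> g \<cdot> f"
  using Comp_assoc[of f "Dom C f" "Cod C f" g "Cod C g" h "Cod C h"] assms by (auto simp: hom_def)

text \<open>Since composites are normalised to the right, an equation for \<open>f \<cdot> g\<close>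
  no longer matches inside \<open>f \<cdot> g \<cdot> h\<close>; this produces the version that
  does.\<close>

lemma comp_reassoc:
  assumes "f \<cdot> g = k" "h \<in> Arr C" "g \<in> Arr C" "f \<in> Arr C" "Dom C g = Cod C h" "Dom C f = Cod C g"
  shows "f \<cdot> g \<cdot> h = k \<cdot> h"
  using assms by (metis comp_assoc)

lemma id_arr [simp]:
  assumes "a \<in> Obj C"
  shows "Id C a \<in> Arr C" "Dom C (Id C a) = a" "Cod C (Id C a) = a"
  using Id_in[OF assms] by (auto simp: hom_def)

lemma comp_id [simp]: "f \<in> Arr C \<Longrightarrow> Dom C f = a \<Longrightarrow> f \<cdot> Id C a = f"
  and id_comp [simp]: "f \<in> Arr C \<Longrightarrow> Cod C f = a \<Longrightarrow> Id C a \<cdot> f = f"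
  using Comp_Id[of f] Id_Comp[of f] by (auto simp: hom_def)

lemma obj_dom_cod [simp]: "f \<in> Arr C \<Longrightarrow> Dom C f \<in> Obj C" "f \<in> Arr C \<Longrightarrow> Cod C f \<in> Obj C"
  by (auto intro: Dom_in Cod_in)

end

section \<open>Product and opposite categories, and functors with one argument fixed\<close>

lemma is_categoryI:
  assumes "\<And>f. f \<in> Arr C \<Longrightarrow> Dom C f \<in> Obj C \<and> Cod C f \<in> Obj C"
    and "\<And>a. a \<in> Obj C \<Longrightarrow> Id C a \<in> hom C a a"
    and "\<And>f g. f \<in> Arr C \<Longrightarrow> g \<in> Arr C \<Longrightarrow> Cod C f = Dom C g \<Longrightarrow>
      Comp C g f \<in> hom C (Dom C f) (Cod C g)"
    and "\<And>f. f \<in> Arr C \<Longrightarrow> Comp C f (Id C (Dom C f)) = f \<and> Comp C (Id C (Cod C f)) f = f"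
    and "\<And>f g h. f \<in> Arr C \<Longrightarrow> g \<in> Arr C \<Longrightarrow> h \<in> Arr C \<Longrightarrow> Cod C f = Dom C g \<Longrightarrow>
      Cod C g = Dom C h \<Longrightarrow> Comp C (Comp C h g) f = Comp C h (Comp C g f)"
  shows "is_category C"
  using assms by unfold_locales (auto simp: hom_def)

lemma prod_category:
  assumes "is_category C" "is_category D"
  shows "is_category (prod_cat C D)"
proof -
  interpret C: is_category C by fact
  interpret D: is_category D by fact
  show ?thesis
    by (rule is_categoryI) (auto simp: prod_cat_def hom_def)
qed

lemma op_category:
  assumes "is_category C"
  shows "is_category (op_cat C)"
proof -
  interpret is_category C by fact
  show ?thesis
    by (rule is_categoryI) (auto simp: op_cat_def hom_def)
qed

lemma prod_cat_simps [simp]: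
  "Obj (prod_cat C D) = Obj C \<times> Obj D"
  "(f, g) \<in> hom (prod_cat C D) (a, b) (a', b') \<longleftrightarrow> f \<in> hom C a a' \<and> g \<in> hom D b b'"
  "Id (prod_cat C D) (a, b) = (Id C a, Id D b)"
  "Comp (prod_cat C D) (f', g') (f, g) = (Comp C f' f, Comp D g' g)"
  by (auto simp: prod_cat_def hom_def)

lemma op_cat_simps [simp]:
  "Obj (op_cat C) = Obj C" "hom (op_cat C) a b = hom C b a" "Id (op_cat C) = Id C"
  "Comp (op_cat C) g f = Comp C f g"
  by (auto simp: op_cat_def hom_def)

lemma fix_fst_functor:
  assumes "is_functor (prod_cat C D) A H" "is_category C" "is_category D" "a \<in> Obj C"
  shows "is_functor D A (fix_fst C H a)"
proof -
  interpret H: is_functor "prod_cat C D" A H by fact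
  interpret C: is_category C by fact
  interpret D: is_category D by fact
  have Id: "Id C a \<in> hom C a a"
    using assms(4) by (rule C.Id_in)
  \<comment> \<open>Fixing an argument respects composition because
    \<open>Id C a \<cdot> Id C a = Id C a\<close>; the instance of \<open>on_arr_Comp\<close> pins
    the first components to this identity.\<close>
  show ?thesis
    by unfold_locales
      (use assms(4) Id H.on_obj_in H.on_arr_in H.on_arr_Id
        H.on_arr_Comp[of "(Id C a, _)" "(a, _)" "(a, _)" "(Id C a, _)" "(a, _)"]
        in \<open>auto simp: fix_fst_def\<close>)
qed

lemma fix_snd_functor:
  assumes "is_functor (prod_cat C D) A H" "is_category C" "is_category D" "b \<in> Obj D"
  shows "is_functor C A (fix_snd D H b)"
proof -
  interpret H: is_functor "prod_cat C D" A H by fact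
  interpret C: is_category C by fact
  interpret D: is_category D by fact
  have Id: "Id D b \<in> hom D b b"
    using assms(4) by (rule D.Id_in)
  show ?thesis
    by unfold_locales
      (use assms(4) Id H.on_obj_in H.on_arr_in H.on_arr_Id
        H.on_arr_Comp[of "(_, Id D b)" "(_, b)" "(_, b)" "(_, Id D b)" "(_, b)"]
        in \<open>auto simp: fix_snd_def\<close>)
qed

section \<open>Finite limits\<close>

context is_category
begin

text \<open>The shapes of the three limits are subcategories of the cospan \<open>0 \<rightarrow> 2 \<leftarrow> 1\<close>: an arrow
  \<open>n \<le> 2\<close> is the identity on \<open>n\<close>, and \<open>3 : 0 \<rightarrow> 2\<close>, \<open>4 : 1 \<rightarrow> 2\<close>.\<close>

definition cospan_shape :: "nat set \<Rightarrow> nat set \<Rightarrow> (nat, nat) category" where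
  "cospan_shape A B = \<lparr>Obj = A, Arr = B, Dom = (\<lambda>k. if k = 3 then 0 else if k = 4 then 1 else k),
     Cod = (\<lambda>k. if 3 \<le> k then 2 else k), Id = (\<lambda>k. k), Comp = (\<lambda>g f. max f g)\<rparr>"

text \<open>Taking the maximum is a correct composition: of two composable arrows at least one is an
  identity, and identities carry smaller numbers than the legs 3 and 4.\<close>

lemma cospan_shape_category:
  assumes "(A, B) \<in> {({}, {}), ({0, 1}, {0, 1}), ({0, 1, 2}, {0, 1, 2, 3, 4})}"
  shows "is_category (cospan_shape A B)"
  using assms by (intro is_categoryI) (auto simp: cospan_shape_def hom_def split: if_splits)

definition cospan_diagram :: "'o \<Rightarrow> 'o \<Rightarrow> 'o \<Rightarrow> 'a \<Rightarrow> 'a \<Rightarrow> (nat, nat, 'o, 'a) cfunctor"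
  where "cospan_diagram a b c f g =
    (let ob = \<lambda>k. if k = 0 then a else if k = 1 then b else c in
      \<lparr>on_obj = ob, on_arr = (\<lambda>k. if k = 3 then f else if k = 4 then g else Id C (ob k))\<rparr>)"

text \<open>The typing hypotheses are conditional on the shape, so that one lemma covers the empty,
  the discrete and the full cospan, whose limits are terminal objects, products and
  pullbacks.\<close>

lemma cospan_diagram_functor:
  assumes "(A, B) \<in> {({}, {}), ({0, 1}, {0, 1}), ({0, 1, 2}, {0, 1, 2, 3, 4})}"
    and "0 \<in> A \<Longrightarrow> a \<in> Obj C \<and> b \<in> Obj C"
    and "2 \<in> A \<Longrightarrow> f \<in> hom C a c \<and> g \<in> hom C b c"
  shows "is_functor (cospan_shape A B) C (cospan_diagram a b c f g)"
proof -
  interpret J: is_category "cospan_shape A B"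
    using assms(1) by (rule cospan_shape_category)
  have ab: "a \<in> Obj C \<and> b \<in> Obj C" if "k \<in> B" for k
    using that assms by auto
  have fg: "f \<in> Arr C \<and> Dom C f = a \<and> Cod C f = c \<and> g \<in> Arr C \<and> Dom C g = b \<and> Cod C g = c \<and> c \<in> Obj C"
    if "k \<in> B" "2 \<le> k" for k
  proof -
    have "2 \<in> A"
      using that assms(1) by auto
    from assms(3)[OF this] show ?thesis
      using obj_dom_cod[of f] by (simp add: hom_def)
  qed
  show ?thesis
  proof
    show "on_obj (cospan_diagram a b c f g) k \<in> Obj C" if "k \<in> Obj (cospan_shape A B)" for k
      using that assms by (auto simp: cospan_shape_def cospan_diagram_def hom_def)
  next
    show "on_arr (cospan_diagram a b c f g) k \<in> hom C (on_obj (cospan_diagram a b c f g) i)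
        (on_obj (cospan_diagram a b c f g) j)" if k: "k \<in> hom (cospan_shape A B) i j" for i j k
    proof -
      have ij: "i = (if k = 3 then 0 else if k = 4 then 1 else k)" "j = (if 3 \<le> k then 2 else k)"
        and B: "k \<in> B"
        using k by (auto simp: cospan_shape_def hom_def)
      then have "k = 0 \<or> k = 1 \<or> k = 2 \<or> k = 3 \<or> k = 4"
        using assms(1) by auto
      then show ?thesis
        unfolding ij using ab[OF B] fg[OF B] by (elim disjE) (simp_all add: cospan_diagram_def hom_def)
    qed
  next
    show "on_arr (cospan_diagram a b c f g) (Id (cospan_shape A B) k) =
        Id C (on_obj (cospan_diagram a b c f g) k)" if "k \<in> Obj (cospan_shape A B)" for k
      using that assms by (auto simp: cospan_shape_def cospan_diagram_def hom_def)
  next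
    show "on_arr (cospan_diagram a b c f g) (Comp (cospan_shape A B) l k) =
        on_arr (cospan_diagram a b c f g) l \<cdot> on_arr (cospan_diagram a b c f g) k"
      if kl: "k \<in> hom (cospan_shape A B) i j" "l \<in> hom (cospan_shape A B) j m" for i j k l m
    proof -
      have *: "k \<in> B" "l \<in> B"
        "(if 3 \<le> k then 2 else k) = (if l = 3 then 0 else if l = 4 then 1 else l)"
        using kl by (auto simp: cospan_shape_def hom_def)
      then have "k = 0 \<or> k = 1 \<or> k = 2 \<or> k = 3 \<or> k = 4" "l = 0 \<or> l = 1 \<or> l = 2 \<or> l = 3 \<or> l = 4"
        using assms(1) by auto
      \<comment> \<open>The composable pairs: an identity with itself, a leg after the identity of
        its domain, or the identity on 2 after a leg.\<close>
      then have "k = l \<and> k \<le> 2 \<or> k = 0 \<and> l = 3 \<or> k = 1 \<and> l = 4 \<or> k \<in> {3, 4} \<and> l = 2"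
        using *(3) by (elim disjE) simp_all
      then have "k = l \<and> (k = 0 \<or> k = 1 \<or> k = 2) \<or> k = 0 \<and> l = 3 \<or> k = 1 \<and> l = 4 \<or>
          k = 3 \<and> l = 2 \<or> k = 4 \<and> l = 2"
        by auto
      then show ?thesis
        using ab[OF *(1)] ab[OF *(2)] fg[OF *(1)] fg[OF *(2)]
        by (elim disjE conjE) (simp_all add: cospan_shape_def cospan_diagram_def)
    qed
  qed
qed

lemma cospan_limit:
  assumes "has_finite_limits C"
    and "(A, B) \<in> {({}, {}), ({0, 1}, {0, 1}), ({0, 1, 2}, {0, 1, 2, 3, 4})}"
    and "0 \<in> A \<Longrightarrow> a \<in> Obj C \<and> b \<in> Obj C"
    and "2 \<in> A \<Longrightarrow> f \<in> hom C a c \<and> g \<in> hom C b c"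
  shows "\<exists>L \<pi>. is_limit (cospan_shape A B) C (cospan_diagram a b c f g) L \<pi>"
proof -
  have "finite (Obj (cospan_shape A B))" "finite (Arr (cospan_shape A B))"
    using assms(2) by (auto simp: cospan_shape_def)
  then show ?thesis
    using assms(1) cospan_diagram_functor[OF assms(2-4)] unfolding has_finite_limits_def by blast
qed

text \<open>The component at 2 is forced by the leg 3, so a cone amounts to a commuting square on
  \<open>f\<close> and \<open>g\<close>.\<close>

lemma cospan_cone_iff:
  assumes "f \<in> hom C a c" "g \<in> hom C b c"
  shows "is_cone (cospan_shape {0, 1, 2} {0, 1, 2, 3, 4}) C (cospan_diagram a b c f g) L \<pi> \<longleftrightarrow>
    \<pi> 0 \<in> hom C L a \<and> \<pi> 1 \<in> hom C L b \<and> \<pi> 2 = f \<cdot> \<pi> 0 \<and> g \<cdot> \<pi> 1 = f \<cdot> \<pi> 0"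
  using assms by (auto simp: is_cone_def cospan_shape_def cospan_diagram_def hom_def)

lemma pair_cone_iff:
  assumes "a \<in> Obj C" "b \<in> Obj C"
  shows "is_cone (cospan_shape {0, 1} {0, 1}) C (cospan_diagram a b c f g) L \<pi> \<longleftrightarrow>
    \<pi> 0 \<in> hom C L a \<and> \<pi> 1 \<in> hom C L b"
  using assms by (auto simp: is_cone_def cospan_shape_def cospan_diagram_def hom_def)

lemma ex_terminal:
  assumes "has_finite_limits C"
  shows "\<exists>t. is_terminal C t"
proof -
  obtain L \<pi> where "is_limit (cospan_shape {} {}) C (cospan_diagram undefined undefined undefined
      undefined undefined) L \<pi>"
    using cospan_limit[OF assms, of "{}" "{}"] by blast
  then have "is_terminal C L"
    by (simp add: is_limit_def is_cone_def is_terminal_def cospan_shape_def)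
  then show ?thesis ..
qed

lemma ex_product:
  assumes "has_finite_limits C" and ab: "a \<in> Obj C" "b \<in> Obj C"
  shows "\<exists>pr. is_product C a b pr"
proof -
  obtain L \<pi> where L: "is_limit (cospan_shape {0, 1} {0, 1}) C
      (cospan_diagram a b undefined undefined undefined) L \<pi>"
    using cospan_limit[OF assms(1), of "{0, 1}" "{0, 1}" a b] ab by fastforce
  have "\<exists>!w. w \<in> hom C x L \<and> \<pi> 0 \<cdot> w = u \<and> \<pi> 1 \<cdot> w = v"
    if uv: "u \<in> hom C x a" "v \<in> hom C x b" for x u v
  proof -
    \<comment> \<open>\<open>One_nat_def\<close> is switched off so that the index 1 is not turned
      into \<open>Suc 0\<close>, which the characterisation of cones would fail to match.\<close>
    have "is_cone (cospan_shape {0, 1} {0, 1}) C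
      (cospan_diagram a b undefined undefined undefined) x (\<lambda>k. if k = 0 then u else v)"
      using uv by (simp add: pair_cone_iff ab del: One_nat_def)
    from L[unfolded is_limit_def, THEN conjunct2, rule_format, OF this]
    show ?thesis by (simp add: cospan_shape_def del: One_nat_def)
  qed
  then have "is_product C a b (\<pi> 0, \<pi> 1)"
    using L by (auto simp: is_limit_def pair_cone_iff ab is_product_def hom_def simp del: One_nat_def)
  then show ?thesis ..
qed

lemma ex_pullback:
  assumes "has_finite_limits C" and fg: "f \<in> hom C a c" "g \<in> hom C b c"
  shows "\<exists>pr. is_pullback C f g pr"
proof -
  let ?J = "cospan_shape {0, 1, 2} {0, 1, 2, 3, 4}" and ?D = "cospan_diagram a b c f g"
  have ab: "a \<in> Obj C" "b \<in> Obj C"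
    using fg by (auto simp: hom_def)
  obtain L \<pi> where L: "is_limit ?J C ?D L \<pi>"
    using cospan_limit[OF assms(1), of "{0, 1, 2}" "{0, 1, 2, 3, 4}" a b f c g] ab fg
    by fastforce
  then have \<pi>: "\<pi> 0 \<in> hom C L a" "\<pi> 1 \<in> hom C L b" "\<pi> 2 = f \<cdot> \<pi> 0" "g \<cdot> \<pi> 1 = f \<cdot> \<pi> 0"
    by (auto simp: is_limit_def cospan_cone_iff fg simp del: One_nat_def)
  have "\<exists>!w. w \<in> hom C x L \<and> \<pi> 0 \<cdot> w = u \<and> \<pi> 1 \<cdot> w = v"
    if uv: "u \<in> hom C x a" "v \<in> hom C x b" "f \<cdot> u = g \<cdot> v" for x u v
  proof -
    have "is_cone ?J C ?D x (\<lambda>k. if k = 0 then u else if k = 1 then v else f \<cdot> u)"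
      using uv by (simp add: cospan_cone_iff fg del: One_nat_def)
    from L[unfolded is_limit_def, THEN conjunct2, rule_format, OF this]
    have *: "\<exists>!w. w \<in> hom C x L \<and> \<pi> 0 \<cdot> w = u \<and> \<pi> 1 \<cdot> w = v \<and> \<pi> 2 \<cdot> w = f \<cdot> u"
      by (simp add: cospan_shape_def del: One_nat_def)
    \<comment> \<open>The limit property also tests the component at 2. That test follows from the
      one at 0, so the unique existence statement is the same without it.\<close>
    have "\<pi> 2 \<cdot> w = f \<cdot> u" if "w \<in> hom C x L" "\<pi> 0 \<cdot> w = u" for w
      using that \<pi>(1,3) fg(1) by (auto simp: hom_def)
    then have "w \<in> hom C x L \<and> \<pi> 0 \<cdot> w = u \<and> \<pi> 1 \<cdot> w = v \<longleftrightarrow>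
      w \<in> hom C x L \<and> \<pi> 0 \<cdot> w = u \<and> \<pi> 1 \<cdot> w = v \<and> \<pi> 2 \<cdot> w = f \<cdot> u" for w
      by blast
    then show ?thesis
      using * by presburger
  qed
  then have "is_pullback C f g (\<pi> 0, \<pi> 1)"
    using \<pi> fg by (auto simp: is_pullback_def hom_def)
  then show ?thesis ..
qed

end

section \<open>Chosen products and pullbacks, with pairing and extensionality\<close>

locale finite_limit_category = is_category E for E :: "('o, 'a) category" (structure) +
  assumes finite_limits: "has_finite_limits E"
begin

lemma one_obj: "one E \<in> Obj E"
  using someI_ex[OF ex_terminal[OF finite_limits]] by (simp add: one_def is_terminal_def)

lemma product_chosen:
  assumes "a \<in> Obj E" "b \<in> Obj E"
  shows "is_product E a b (pr1 E a b, pr2 E a b)"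
  using someI_ex[OF ex_product[OF finite_limits assms]] by (simp add: pr1_def pr2_def)

lemma pr_arr [simp]:
  assumes "a \<in> Obj E" "b \<in> Obj E"
  shows "pr1 E a b \<in> Arr E" "pr2 E a b \<in> Arr E" "Dom E (pr2 E a b) = Dom E (pr1 E a b)"
    "Cod E (pr1 E a b) = a" "Cod E (pr2 E a b) = b"
  using product_chosen[OF assms] by (auto simp: is_product_def)

lemma prod_pair_ex1:
  assumes "u \<in> Arr E" "v \<in> Arr E" "Dom E v = Dom E u" "Cod E u = a" "Cod E v = b"
  shows "\<exists>!w. w \<in> hom E (Dom E u) (Dom E (pr1 E a b)) \<and> pr1 E a b \<cdot> w = u \<and> pr2 E a b \<cdot> w = v"
proof -
  have "a \<in> Obj E" "b \<in> Obj E"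
    using assms by auto
  then have "\<forall>x. \<forall>u\<in>hom E x a. \<forall>v\<in>hom E x b.
      \<exists>!w. w \<in> hom E x (Dom E (pr1 E a b)) \<and> pr1 E a b \<cdot> w = u \<and> pr2 E a b \<cdot> w = v"
    using product_chosen[of a b] by (simp add: is_product_def)
  moreover have "u \<in> hom E (Dom E u) a" "v \<in> hom E (Dom E u) b"
    using assms by (auto simp: hom_def)
  ultimately show ?thesis
    by blast
qed

lemma prod_pair_arr [simp]:
  assumes "u \<in> Arr E" "v \<in> Arr E" "Dom E v = Dom E u" "Cod E u = a" "Cod E v = b"
  shows "prod_pair E a b u v \<in> Arr E" "Dom E (prod_pair E a b u v) = Dom E u"
    "Cod E (prod_pair E a b u v) = Dom E (pr1 E a b)"
    "pr1 E a b \<cdot> prod_pair E a b u v = u" "pr2 E a b \<cdot> prod_pair E a b u v = v"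
  using theI'[OF prod_pair_ex1[OF assms]] by (auto simp: hom_def prod_pair_def)

lemma prod_ext:
  assumes "w \<in> Arr E" "w' \<in> Arr E" "a \<in> Obj E" "b \<in> Obj E"
    and "Cod E w = Dom E (pr1 E a b)" "Cod E w' = Dom E (pr1 E a b)" "Dom E w' = Dom E w"
    and "pr1 E a b \<cdot> w = pr1 E a b \<cdot> w'" "pr2 E a b \<cdot> w = pr2 E a b \<cdot> w'"
  shows "w = w'"
  using prod_pair_ex1[of "pr1 E a b \<cdot> w" "pr2 E a b \<cdot> w" a b] assms
  by (auto simp: hom_def)

lemma prod_pair_comp [simp]:
  assumes "u \<in> Arr E" "v \<in> Arr E" "Dom E v = Dom E u" "Cod E u = a" "Cod E v = b"
    and "h \<in> Arr E" "Dom E u = Cod E h"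
  shows "prod_pair E a b u v \<cdot> h = prod_pair E a b (u \<cdot> h) (v \<cdot> h)"
proof -
  have ab: "a \<in> Obj E" "b \<in> Obj E"
    using assms by auto
  have "pr1 E a b \<cdot> prod_pair E a b u v \<cdot> h = u \<cdot> h" "pr2 E a b \<cdot> prod_pair E a b u v \<cdot> h = v \<cdot> h"
    using assms ab by (auto intro!: comp_reassoc)
  with assms ab show ?thesis
    by (auto intro: prod_ext[of _ _ a b])
qed

lemma prod_arr_arr [simp]:
  assumes "f \<in> Arr E" "g \<in> Arr E"
  shows "prod_arr E f g \<in> Arr E" "Dom E (prod_arr E f g) = Dom E (pr1 E (Dom E f) (Dom E g))"
    "Cod E (prod_arr E f g) = Dom E (pr1 E (Cod E f) (Cod E g))"
  using assms by (auto simp: prod_arr_def)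

lemma pullback_chosen:
  assumes "f \<in> Arr E" "g \<in> Arr E" "Cod E f = Cod E g"
  shows "is_pullback E f g (pb1 E f g, pb2 E f g)"
  using someI_ex[OF ex_pullback[OF finite_limits, of f "Dom E f" "Cod E f" g "Dom E g"]] assms
  by (simp add: pb1_def pb2_def hom_def)

lemma pb_arr [simp]:
  assumes "f \<in> Arr E" "g \<in> Arr E" "Cod E f = Cod E g"
  shows "pb1 E f g \<in> Arr E" "pb2 E f g \<in> Arr E" "Dom E (pb2 E f g) = Dom E (pb1 E f g)"
    "Cod E (pb1 E f g) = Dom E f" "Cod E (pb2 E f g) = Dom E g"
  using pullback_chosen[OF assms] by (auto simp: is_pullback_def)

text \<open>Rewriting goes towards the first projection, on the side of positions. The second form
  is the same square inside a right-nested composite.\<close>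

lemma pb_square [simp]:
  assumes "f \<in> Arr E" "g \<in> Arr E" "Cod E f = Cod E g"
  shows "g \<cdot> pb2 E f g = f \<cdot> pb1 E f g"
    "h \<in> Arr E \<Longrightarrow> Cod E h = Dom E (pb1 E f g) \<Longrightarrow> g \<cdot> pb2 E f g \<cdot> h = f \<cdot> pb1 E f g \<cdot> h"
proof -
  show *: "g \<cdot> pb2 E f g = f \<cdot> pb1 E f g"
    using pullback_chosen[OF assms] by (auto simp: is_pullback_def)
  show "h \<in> Arr E \<Longrightarrow> Cod E h = Dom E (pb1 E f g) \<Longrightarrow> g \<cdot> pb2 E f g \<cdot> h = f \<cdot> pb1 E f g \<cdot> h"
    using assms by (simp add: comp_reassoc[OF *])
qed

text \<open>A generalized element of \<open>X \<times>\<^sub>Z Y\<close>. The equation is oriented for rewriting with structure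
  maps \<open>g : Y \<rightarrow> Z\<close>, which send a direction \<open>v\<close> to the position below it.\<close>

definition pb_elem :: "'a \<Rightarrow> 'a \<Rightarrow> 'a \<Rightarrow> 'a \<Rightarrow> bool" where
  "pb_elem f g u v \<longleftrightarrow> f \<in> Arr E \<and> g \<in> Arr E \<and> Cod E f = Cod E g \<and> u \<in> Arr E \<and> v \<in> Arr E \<and>
     Dom E v = Dom E u \<and> Cod E u = Dom E f \<and> Cod E v = Dom E g \<and> g \<cdot> v = f \<cdot> u"

lemma pb_pair_ex1:
  assumes "pb_elem f g u v"
  shows "\<exists>!w. w \<in> hom E (Dom E u) (Dom E (pb1 E f g)) \<and> pb1 E f g \<cdot> w = u \<and> pb2 E f g \<cdot> w = v"
proof -
  have "\<forall>x. \<forall>u\<in>hom E x (Dom E f). \<forall>v\<in>hom E x (Dom E g). f \<cdot> u = g \<cdot> v \<longrightarrow>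
      (\<exists>!w. w \<in> hom E x (Dom E (pb1 E f g)) \<and> pb1 E f g \<cdot> w = u \<and> pb2 E f g \<cdot> w = v)"
    using pullback_chosen[of f g] assms by (simp add: is_pullback_def pb_elem_def)
  moreover have "u \<in> hom E (Dom E u) (Dom E f)" "v \<in> hom E (Dom E u) (Dom E g)" "f \<cdot> u = g \<cdot> v"
    using assms by (auto simp: hom_def pb_elem_def)
  ultimately show ?thesis
    by blast
qed

lemma pb_pair [simp]:
  assumes "pb_elem f g u v"
  shows "pb_pair E f g u v \<in> Arr E" "Dom E (pb_pair E f g u v) = Dom E u"
    "Cod E (pb_pair E f g u v) = Dom E (pb1 E f g)"
    "pb1 E f g \<cdot> pb_pair E f g u v = u" "pb2 E f g \<cdot> pb_pair E f g u v = v"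
  using theI'[OF pb_pair_ex1[OF assms]] by (auto simp: hom_def pb_pair_def)

lemma pb_ext:
  assumes "f \<in> Arr E" "g \<in> Arr E" "Cod E f = Cod E g" "w \<in> Arr E" "w' \<in> Arr E"
    and "Cod E w = Dom E (pb1 E f g)" "Cod E w' = Dom E (pb1 E f g)" "Dom E w' = Dom E w"
    and "pb1 E f g \<cdot> w = pb1 E f g \<cdot> w'" "pb2 E f g \<cdot> w = pb2 E f g \<cdot> w'"
  shows "w = w'"
proof -
  have "pb_elem f g (pb1 E f g \<cdot> w) (pb2 E f g \<cdot> w)"
    using assms by (auto simp: pb_elem_def)
  from pb_pair_ex1[OF this] show ?thesis
    using assms by (auto simp: hom_def)
qed

lemma pb_elem_comp:
  assumes "pb_elem f g u v" "h \<in> Arr E" "Dom E u = Cod E h"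
  shows "pb_elem f g (u \<cdot> h) (v \<cdot> h)"
  using assms comp_reassoc[of g v "f \<cdot> u" h] by (simp add: pb_elem_def)

lemma pb_pair_comp [simp]:
  assumes "pb_elem f g u v" "h \<in> Arr E" "Dom E u = Cod E h"
  shows "pb_pair E f g u v \<cdot> h = pb_pair E f g (u \<cdot> h) (v \<cdot> h)"
proof -
  have fg: "f \<in> Arr E" "g \<in> Arr E" "Cod E f = Cod E g"
    using assms by (auto simp: pb_elem_def)
  have "pb1 E f g \<cdot> pb_pair E f g u v \<cdot> h = u \<cdot> h" "pb2 E f g \<cdot> pb_pair E f g u v \<cdot> h = v \<cdot> h"
    using assms fg by (auto intro!: comp_reassoc)
  moreover have "u \<in> Arr E"
    using assms by (simp add: pb_elem_def)
  ultimately show ?thesis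
    using assms fg pb_elem_comp[OF assms] by (auto intro: pb_ext[of f g])
qed

lemma pb_pair_eta [simp]:
  assumes "f \<in> Arr E" "g \<in> Arr E" "Cod E f = Cod E g" "w \<in> Arr E" "Cod E w = Dom E (pb1 E f g)"
  shows "pb_pair E f g (pb1 E f g \<cdot> w) (pb2 E f g \<cdot> w) = w"
  by (rule pb_ext[of f g]) (use assms in \<open>auto simp: pb_elem_def\<close>)

text \<open>This is why an operation evaluated at the universal element of a pullback returns the
  arrow that represents it.\<close>

lemma pb_pair_id:
  assumes "f \<in> Arr E" "g \<in> Arr E" "Cod E f = Cod E g"
  shows "pb_pair E f g (pb1 E f g) (pb2 E f g) = Id E (Dom E (pb1 E f g))"
  by (rule pb_ext[of f g]) (use assms in \<open>auto simp: pb_elem_def\<close>)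

text \<open>From here on the side condition of the pairing rules splits into typing facts and one
  commuting square, which rewriting can discharge.\<close>

declare pb_elem_def [simp]

lemma pr_prod_arr [simp]:
  assumes "f \<in> Arr E" "g \<in> Arr E" "Cod E f = a" "Cod E g = b"
    and "w \<in> Arr E" "Cod E w = Dom E (pr1 E (Dom E f) (Dom E g))"
  shows "pr1 E a b \<cdot> prod_arr E f g \<cdot> w = f \<cdot> pr1 E (Dom E f) (Dom E g) \<cdot> w"
    "pr2 E a b \<cdot> prod_arr E f g \<cdot> w = g \<cdot> pr2 E (Dom E f) (Dom E g) \<cdot> w"
proof -
  have ab: "a \<in> Obj E" "b \<in> Obj E"
    using assms by auto
  have "prod_arr E f g \<cdot> w =
      prod_pair E a b (f \<cdot> pr1 E (Dom E f) (Dom E g) \<cdot> w) (g \<cdot> pr2 E (Dom E f) (Dom E g) \<cdot> w)"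
    using assms by (simp add: prod_arr_def)
  then show "pr1 E a b \<cdot> prod_arr E f g \<cdot> w = f \<cdot> pr1 E (Dom E f) (Dom E g) \<cdot> w"
    "pr2 E a b \<cdot> prod_arr E f g \<cdot> w = g \<cdot> pr2 E (Dom E f) (Dom E g) \<cdot> w"
    using assms ab by simp_all
qed

lemma prod_pair_eta [simp]:
  assumes "w \<in> Arr E" "a \<in> Obj E" "b \<in> Obj E" "Cod E w = Dom E (pr1 E a b)"
  shows "prod_pair E a b (pr1 E a b \<cdot> w) (pr2 E a b \<cdot> w) = w"
  by (rule prod_ext[of _ _ a b]) (use assms in auto)

end

section \<open>Dependent products\<close>

lemma mem_slice [simp]:
  "f \<in> Obj (slice E A) \<longleftrightarrow> f \<in> Arr E \<and> Cod E f = A"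
  "\<alpha> \<in> hom (slice E A) f g \<longleftrightarrow> (\<exists>h. \<alpha> = (f, h, g) \<and> f \<in> Arr E \<and> g \<in> Arr E \<and>
     Cod E f = A \<and> Cod E g = A \<and> h \<in> Arr E \<and> Dom E h = Dom E f \<and> Cod E h = Dom E g \<and>
     Comp E g h = f)"
  by (auto simp: slice_def hom_def)

lemma slice_simps [simp]:
  "Comp (slice E A) (g', k, l) (f, h, g) = (f, Comp E k h, l)"
  "Id (slice E A) f = (f, Id E (Dom E f), f)"
  by (auto simp: slice_def)

locale lcc_category = finite_limit_category E for E :: "('o, 'a) category" (structure) +
  assumes lcc: "locally_cartesian_closed E"
begin

text \<open>Exponentiability disappears as a separate obligation: to know that \<open>tri\<close>
  and \<open>coc\<close> give objects of \<open>Poly\<close> it suffices that they are arrows of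
  \<open>E\<close>.\<close>

lemma exponentiable_iff [simp]: "exponentiable E f \<longleftrightarrow> f \<in> Arr E"
  using lcc by (auto simp: locally_cartesian_closed_def exponentiable_def)

lemma Pi_adjunction:
  assumes "f \<in> Arr E"
  shows "adjunction (slice E (Cod E f)) (slice E (Dom E f)) (Delta E f)
    (fst (PiAdj E f)) (snd (PiAdj E f))"
proof -
  have "\<exists>G\<theta>. case G\<theta> of (G, \<theta>) \<Rightarrow>
      adjunction (slice E (Cod E f)) (slice E (Dom E f)) (Delta E f) G \<theta>"
    using assms lcc by (auto simp: locally_cartesian_closed_def exponentiable_def)
  then have "case PiAdj E f of (G, \<theta>) \<Rightarrow>
      adjunction (slice E (Cod E f)) (slice E (Dom E f)) (Delta E f) G \<theta>"
    unfolding PiAdj_def by (rule someI_ex)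
  then show ?thesis
    by (simp add: case_prod_beta)
qed

text \<open>Everything rests on the fact that \<theta> sends \<open>ev t\<close>, the counit after
  the pullback of \<open>t\<close>, back to \<open>t\<close>. Applying \<theta> to
  \<open>ev t = ev t'\<close> gives uniqueness. For a given \<open>h\<close> with transpose
  \<open>t\<close>, the arrows \<open>ev t\<close> and \<open>h\<close> have the same image under
  \<theta>, so injectivity gives the evaluation rule.\<close>

lemma Pi_universal:
  assumes f: "f \<in> Arr E" and b: "b \<in> Arr E" "Cod E b = Dom E f"
  shows PiOb_arr: "PiOb E f b \<in> Arr E" "Cod E (PiOb E f b) = Cod E f"
    and PiCounit_arr: "PiCounit E f b \<in> Arr E" "Dom E (PiCounit E f b) = Dom E (pb1 E (PiOb E f b) f)"
      "Cod E (PiCounit E f b) = Dom E b" "b \<cdot> PiCounit E f b = pb2 E (PiOb E f b) f"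
    and Pi_unique: "\<lbrakk>t \<in> Arr E; t' \<in> Arr E; Cod E t = Dom E (PiOb E f b);
      Cod E t' = Dom E (PiOb E f b); PiOb E f b \<cdot> t = x; PiOb E f b \<cdot> t' = x;
      PiCounit E f b \<cdot> pb_pair E (PiOb E f b) f (t \<cdot> pb1 E x f) (pb2 E x f) =
      PiCounit E f b \<cdot> pb_pair E (PiOb E f b) f (t' \<cdot> pb1 E x f) (pb2 E x f)\<rbrakk> \<Longrightarrow> t = t'"
    and PiTranspose_props: "\<lbrakk>x \<in> Arr E; Cod E x = Cod E f; h \<in> Arr E; Dom E h = Dom E (pb1 E x f);
      Cod E h = Dom E b; b \<cdot> h = pb2 E x f\<rbrakk> \<Longrightarrow>
      PiTranspose E f x b h \<in> Arr E \<and> Dom E (PiTranspose E f x b h) = Dom E x \<and>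
      Cod E (PiTranspose E f x b h) = Dom E (PiOb E f b) \<and> PiOb E f b \<cdot> PiTranspose E f x b h = x \<and>
      PiCounit E f b \<cdot> pb_pair E (PiOb E f b) f (PiTranspose E f x b h \<cdot> pb1 E x f) (pb2 E x f) = h"
proof -
  define G \<theta> \<pi> where "G = fst (PiAdj E f)" and "\<theta> = snd (PiAdj E f)" and \<pi>: "\<pi> = PiOb E f b"
  interpret adj: adjunction "slice E (Cod E f)" "slice E (Dom E f)" "Delta E f" G \<theta>
    using Pi_adjunction[OF f] by (simp add: G_def \<theta>_def)
  have \<pi>_G: "on_obj G b = \<pi>"
    by (simp add: \<pi> PiOb_def G_def)
  show 1: "PiOb E f b \<in> Arr E" "Cod E (PiOb E f b) = Cod E f"
    using adj.G.on_obj_in[of b] b by (simp_all add: PiOb_def G_def)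
  have \<pi>_obj: "\<pi> \<in> Arr E" "Cod E \<pi> = Cod E f"
    using 1 by (simp_all add: \<pi>)
  have \<Delta>: "on_obj (Delta E f) x = pb2 E x f" for x
    by (simp add: Delta_def)
  let ?c = "counit (slice E (Cod E f)) (slice E (Dom E f)) (Delta E f) G \<theta> b"
  have bij: "bij_betw (\<theta> x b) (hom (slice E (Dom E f)) (pb2 E x f) b) (hom (slice E (Cod E f)) x \<pi>)"
    if "x \<in> Arr E" "Cod E x = Cod E f" for x
    using adj.transpose_bij[of x b] that b by (simp add: \<Delta> \<pi>_G)
  \<comment> \<open>Surjectivity of \<theta> puts the identity in its image, so the
    \<open>inv_into\<close> in \<open>counit\<close> is a genuine preimage.\<close>
  have "Id (slice E (Cod E f)) \<pi> \<in> \<theta> \<pi> b ` hom (slice E (Dom E f)) (pb2 E \<pi> f) b"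
    using adj.F.C.Id_in[of \<pi>] \<pi>_obj bij[OF \<pi>_obj] by (simp add: bij_betw_def)
  then have c: "?c \<in> hom (slice E (Dom E f)) (pb2 E \<pi> f) b" "\<theta> \<pi> b ?c = Id (slice E (Cod E f)) \<pi>"
    unfolding counit_def \<Delta> \<pi>_G by (rule inv_into_into, rule f_inv_into_f)
  define \<epsilon> where "\<epsilon> = PiCounit E f b"
  have "\<epsilon> = underlying ?c"
    by (simp add: \<epsilon>_def PiCounit_def G_def \<theta>_def)
  then have c_eq: "?c = (pb2 E \<pi> f, \<epsilon>, b)" and \<epsilon>: "\<epsilon> \<in> Arr E" "Dom E \<epsilon> = Dom E (pb1 E \<pi> f)"
      "Cod E \<epsilon> = Dom E b" "b \<cdot> \<epsilon> = pb2 E \<pi> f"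
    using c(1) f \<pi>_obj by (auto simp: underlying_def)
  then show "PiCounit E f b \<in> Arr E" "Dom E (PiCounit E f b) = Dom E (pb1 E (PiOb E f b) f)"
      "Cod E (PiCounit E f b) = Dom E b" "b \<cdot> PiCounit E f b = pb2 E (PiOb E f b) f"
    by (simp_all add: \<epsilon>_def \<pi>)
  \<comment> \<open>In the slice over the domain of \<open>f\<close> this is the composite of the
    counit with \<open>Delta\<close> applied to \<open>t\<close>.\<close>
  define ev where "ev t = \<epsilon> \<cdot> pb_pair E \<pi> f (t \<cdot> pb1 E (\<pi> \<cdot> t) f) (pb2 E (\<pi> \<cdot> t) f)" for t
  have ev_hom: "(pb2 E (\<pi> \<cdot> t) f, ev t, b) \<in> hom (slice E (Dom E f)) (pb2 E (\<pi> \<cdot> t) f) b"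
    and \<theta>_ev: "\<theta> (\<pi> \<cdot> t) b (pb2 E (\<pi> \<cdot> t) f, ev t, b) = (\<pi> \<cdot> t, t, \<pi>)"
    if t: "t \<in> Arr E" "Cod E t = Dom E \<pi>" for t
  proof -
    have "b \<cdot> \<epsilon> \<cdot> w = pb2 E \<pi> f \<cdot> w" if "w \<in> Arr E" "Cod E w = Dom E (pb1 E \<pi> f)" for w
      using \<epsilon> b that by (intro comp_reassoc) auto
    then show ev: "(pb2 E (\<pi> \<cdot> t) f, ev t, b) \<in> hom (slice E (Dom E f)) (pb2 E (\<pi> \<cdot> t) f) b"
      using t \<pi>_obj f b \<epsilon> by (simp add: ev_def)
    have t_hom: "(\<pi> \<cdot> t, t, \<pi>) \<in> hom (slice E (Cod E f)) (\<pi> \<cdot> t) \<pi>"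
      using t \<pi>_obj by simp
    have id_hom: "Id (slice E (Dom E f)) b \<in> hom (slice E (Dom E f)) b b"
      using adj.F.D.Id_in[of b] b by simp
    \<comment> \<open>Naturality of the transpose along \<open>t\<close>, with the counit as the
      transposed arrow and the identity on \<open>b\<close>: since the counit transposes to an
      identity, only \<open>t\<close> is left on the right.\<close>
    have "\<theta> (\<pi> \<cdot> t) b (pb2 E (\<pi> \<cdot> t) f, Id E (Dom E b) \<cdot> ev t, b) =
        Comp (slice E (Cod E f)) (Id (slice E (Cod E f)) \<pi>)
          (Comp (slice E (Cod E f)) (Id (slice E (Cod E f)) \<pi>) (\<pi> \<cdot> t, t, \<pi>))"
      using adj.transpose_natural[OF t_hom id_hom, of ?c] c adj.G.on_arr_Id[of b] b
      unfolding \<Delta> \<pi>_G c_eq by (simp add: Delta_def ev_def)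
    then show "\<theta> (\<pi> \<cdot> t) b (pb2 E (\<pi> \<cdot> t) f, ev t, b) = (\<pi> \<cdot> t, t, \<pi>)"
      using t \<pi>_obj ev by simp
  qed
  show "t = t'" if "t \<in> Arr E" "t' \<in> Arr E" "Cod E t = Dom E (PiOb E f b)"
      "Cod E t' = Dom E (PiOb E f b)" "PiOb E f b \<cdot> t = x" "PiOb E f b \<cdot> t' = x"
      "PiCounit E f b \<cdot> pb_pair E (PiOb E f b) f (t \<cdot> pb1 E x f) (pb2 E x f) =
      PiCounit E f b \<cdot> pb_pair E (PiOb E f b) f (t' \<cdot> pb1 E x f) (pb2 E x f)"
  proof -
    have "ev t = ev t'"
      using that unfolding ev_def \<epsilon>_def \<pi> by simp
    then show ?thesis
      using \<theta>_ev[of t] \<theta>_ev[of t'] that unfolding \<pi> by simp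
  qed
  show "PiTranspose E f x b h \<in> Arr E \<and> Dom E (PiTranspose E f x b h) = Dom E x \<and>
      Cod E (PiTranspose E f x b h) = Dom E (PiOb E f b) \<and> PiOb E f b \<cdot> PiTranspose E f x b h = x \<and>
      PiCounit E f b \<cdot> pb_pair E (PiOb E f b) f (PiTranspose E f x b h \<cdot> pb1 E x f) (pb2 E x f) = h"
    if x: "x \<in> Arr E" "Cod E x = Cod E f" and h: "h \<in> Arr E" "Dom E h = Dom E (pb1 E x f)"
      "Cod E h = Dom E b" "b \<cdot> h = pb2 E x f"
  proof -
    have h_hom: "(pb2 E x f, h, b) \<in> hom (slice E (Dom E f)) (pb2 E x f) b"
      using x h f b by simp
    define t where "t = PiTranspose E f x b h"
    have "\<theta> x b (pb2 E x f, h, b) \<in> hom (slice E (Cod E f)) x \<pi>"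
      using bij[OF x] h_hom by (auto simp: bij_betw_def simp del: mem_slice)
    moreover have "t = underlying (\<theta> x b (pb2 E x f, h, b))"
      by (simp add: t_def PiTranspose_def \<theta>_def)
    ultimately have t: "\<theta> x b (pb2 E x f, h, b) = (x, t, \<pi>)" "t \<in> Arr E" "Dom E t = Dom E x"
        "Cod E t = Dom E \<pi>" "\<pi> \<cdot> t = x"
      by (auto simp: underlying_def)
    have "inj_on (\<theta> x b) (hom (slice E (Dom E f)) (pb2 E x f) b)"
      using bij[OF x] by (simp add: bij_betw_def del: mem_slice)
    moreover have "\<theta> x b (pb2 E x f, ev t, b) = \<theta> x b (pb2 E x f, h, b)"
      using \<theta>_ev[OF t(2,4)] t(1,5) by simp
    moreover have "(pb2 E x f, ev t, b) \<in> hom (slice E (Dom E f)) (pb2 E x f) b"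
      using ev_hom[OF t(2,4)] unfolding t(5) .
    ultimately have "(pb2 E x f, ev t, b) = (pb2 E x f, h, b)"
      using h_hom by (rule inj_onD)
    then show ?thesis
      using t by (simp add: ev_def \<epsilon>_def \<pi> t_def)
  qed
qed

declare PiOb_arr [simp] PiCounit_arr [simp]

lemma PiCounit_reassoc [simp]:
  assumes "f \<in> Arr E" "b \<in> Arr E" "Cod E b = Dom E f" "w \<in> Arr E"
    "Cod E w = Dom E (pb1 E (PiOb E f b) f)"
  shows "b \<cdot> PiCounit E f b \<cdot> w = pb2 E (PiOb E f b) f \<cdot> w"
  using assms by (intro comp_reassoc) auto

lemma PiTranspose_arr [simp]:
  assumes "f \<in> Arr E" "b \<in> Arr E" "Cod E b = Dom E f" "x \<in> Arr E" "Cod E x = Cod E f"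
    "h \<in> Arr E" "Dom E h = Dom E (pb1 E x f)" "Cod E h = Dom E b" "b \<cdot> h = pb2 E x f"
  shows "PiTranspose E f x b h \<in> Arr E" "Dom E (PiTranspose E f x b h) = Dom E x"
    "Cod E (PiTranspose E f x b h) = Dom E (PiOb E f b)" "PiOb E f b \<cdot> PiTranspose E f x b h = x"
    "s \<in> Arr E \<Longrightarrow> Cod E s = Dom E x \<Longrightarrow> PiOb E f b \<cdot> PiTranspose E f x b h \<cdot> s = x \<cdot> s"
  using PiTranspose_props[OF assms] PiOb_arr[OF assms(1-3)] by (auto intro!: comp_reassoc)

text \<open>The evaluation rule at an arbitrary stage: the universal case is precomposed with the
  pair \<open>(s, y)\<close>.\<close>

lemma PiCounit_PiTranspose [simp]:
  assumes "f \<in> Arr E" "b \<in> Arr E" "Cod E b = Dom E f" "x \<in> Arr E" "Cod E x = Cod E f"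
    "h \<in> Arr E" "Dom E h = Dom E (pb1 E x f)" "Cod E h = Dom E b" "b \<cdot> h = pb2 E x f"
    and "s \<in> Arr E" "y \<in> Arr E" "Cod E s = Dom E x" "Dom E y = Dom E s" "Cod E y = Dom E f"
    "f \<cdot> y = x \<cdot> s"
  shows "PiCounit E f b \<cdot> pb_pair E (PiOb E f b) f (PiTranspose E f x b h \<cdot> s) y =
    h \<cdot> pb_pair E x f s y"
proof -
  let ?e = "PiCounit E f b \<cdot> pb_pair E (PiOb E f b) f (PiTranspose E f x b h \<cdot> pb1 E x f) (pb2 E x f)"
  have "?e = h"
    using PiTranspose_props[OF assms(1-9)] by blast
  moreover have "?e \<cdot> pb_pair E x f s y =
      PiCounit E f b \<cdot> pb_pair E (PiOb E f b) f (PiTranspose E f x b h \<cdot> s) y"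
    using assms by simp
  ultimately show ?thesis
    by simp
qed

text \<open>The universal pair of projections would suffice as a test. Leaving \<open>s\<close> and
  \<open>y\<close> arbitrary keeps chosen pullbacks out of the resulting goal, where only the
  element rules are then needed. The equation for \<open>f \<cdot> y\<close> is offered through both
  \<open>t\<close> and \<open>t'\<close>, since each side of the goal needs its own form.\<close>

lemma Pi_ext:
  assumes "f \<in> Arr E" "b \<in> Arr E" "Cod E b = Dom E f"
    and t: "t \<in> Arr E" "t' \<in> Arr E" "Cod E t = Dom E (PiOb E f b)" "Cod E t' = Dom E (PiOb E f b)"
    "Dom E t' = Dom E t" "PiOb E f b \<cdot> t' = PiOb E f b \<cdot> t"
    and ev: "\<And>s y. s \<in> Arr E \<Longrightarrow> y \<in> Arr E \<Longrightarrow> Cod E s = Dom E t \<Longrightarrow> Dom E y = Dom E s \<Longrightarrow>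
      Cod E y = Dom E f \<Longrightarrow> f \<cdot> y = PiOb E f b \<cdot> t \<cdot> s \<Longrightarrow> f \<cdot> y = PiOb E f b \<cdot> t' \<cdot> s \<Longrightarrow>
      PiCounit E f b \<cdot> pb_pair E (PiOb E f b) f (t \<cdot> s) y =
      PiCounit E f b \<cdot> pb_pair E (PiOb E f b) f (t' \<cdot> s) y"
  shows "t = t'"
proof -
  have "PiOb E f b \<cdot> t' \<cdot> s = PiOb E f b \<cdot> t \<cdot> s" if "s \<in> Arr E" "Cod E s = Dom E t" for s
    using comp_reassoc[OF t(6), of s] assms(1-3) t that by simp
  then show ?thesis
    using assms(1-3) t
    by (intro Pi_unique[of f b t t' "PiOb E f b \<cdot> t"] ev) simp_all
qed

section \<open>Polynomials\<close>

lemma Poly_simps [simp]: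
  "Obj (Poly E) = Arr E" "Dom (Poly E) = src" "Cod (Poly E) = tgt"
  by (auto simp: Poly_def)

lemma Comp_Poly_eq:
  "Comp (Poly E) \<psi> \<phi> = \<lparr>src = src \<phi>, tgt = tgt \<psi>, pos = pos \<psi> \<cdot> pos \<phi>,
    sharp = sharp \<phi> \<cdot> sharp_over E \<psi> (pos \<phi>)\<rparr>"
  and Id_Poly_eq:
  "Id (Poly E) p = \<lparr>src = p, tgt = p, pos = Id E (Cod E p), sharp = pb2 E (Id E (Cod E p)) p\<rparr>"
  by (simp_all add: Poly_def)

lemma Poly_arr_iff:
  "\<phi> \<in> Arr (Poly E) \<longleftrightarrow> src \<phi> \<in> Arr E \<and> tgt \<phi> \<in> Arr E \<and> pos \<phi> \<in> Arr E \<and>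
    Dom E (pos \<phi>) = Cod E (src \<phi>) \<and> Cod E (pos \<phi>) = Cod E (tgt \<phi>) \<and> sharp \<phi> \<in> Arr E \<and>
    Dom E (sharp \<phi>) = Dom E (pb1 E (pos \<phi>) (tgt \<phi>)) \<and> Cod E (sharp \<phi>) = Dom E (src \<phi>) \<and>
    src \<phi> \<cdot> sharp \<phi> = pb1 E (pos \<phi>) (tgt \<phi>)"
  by (auto simp: Poly_def hom_def)

lemma Poly_arr:
  assumes "\<phi> \<in> Arr (Poly E)"
  shows "src \<phi> \<in> Arr E" "tgt \<phi> \<in> Arr E" "pos \<phi> \<in> Arr E" "Dom E (pos \<phi>) = Cod E (src \<phi>)"
    "Cod E (pos \<phi>) = Cod E (tgt \<phi>)"
  using assms by (simp_all add: Poly_arr_iff)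

text \<open>Unlike \<open>Poly_arr\<close>, these facts stay out of the simplifier:
  \<open>sharp\<close> is meant to be handled through \<open>sharp_at\<close>, and they are cited
  where that passage is made.\<close>

lemma sharp_arr:
  assumes "\<phi> \<in> Arr (Poly E)"
  shows "sharp \<phi> \<in> Arr E" "Dom E (sharp \<phi>) = Dom E (pb1 E (pos \<phi>) (tgt \<phi>))"
    "Cod E (sharp \<phi>) = Dom E (src \<phi>)" "src \<phi> \<cdot> sharp \<phi> = pb1 E (pos \<phi>) (tgt \<phi>)"
  using assms by (simp_all add: Poly_arr_iff)

declare Poly_arr [simp]

lemma mem_hom_Poly [simp]: "\<phi> \<in> hom (Poly E) p q \<longleftrightarrow> \<phi> \<in> Arr (Poly E) \<and> src \<phi> = p \<and> tgt \<phi> = q"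
  by (simp add: hom_def)

text \<open>The fifth rule is naturality in the stage. The sixth covers the terms that naturality
  produces, for which the required square at \<open>(x \<cdot> s, y \<cdot> s)\<close> comes from
  the one at \<open>(x, y)\<close> only by reassociation.\<close>

lemma sharp_at [simp]:
  assumes "\<phi> \<in> Arr (Poly E)" "x \<in> Arr E" "y \<in> Arr E" "Cod E x = Cod E (src \<phi>)"
    "Cod E y = Dom E (tgt \<phi>)" "Dom E y = Dom E x" "tgt \<phi> \<cdot> y = pos \<phi> \<cdot> x"
  shows "sharp_at E \<phi> x y \<in> Arr E" "Dom E (sharp_at E \<phi> x y) = Dom E x"
    "Cod E (sharp_at E \<phi> x y) = Dom E (src \<phi>)" "src \<phi> \<cdot> sharp_at E \<phi> x y = x"
    "s \<in> Arr E \<Longrightarrow> Cod E s = Dom E x \<Longrightarrow> sharp_at E \<phi> x y \<cdot> s = sharp_at E \<phi> (x \<cdot> s) (y \<cdot> s)"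
    "s \<in> Arr E \<Longrightarrow> Cod E s = Dom E x \<Longrightarrow> src \<phi> \<cdot> sharp_at E \<phi> (x \<cdot> s) (y \<cdot> s) = x \<cdot> s"
proof -
  note \<phi> = sharp_arr[OF assms(1)]
  have src_sharp: "src \<phi> \<cdot> sharp \<phi> \<cdot> w = pb1 E (pos \<phi>) (tgt \<phi>) \<cdot> w"
    if "w \<in> Arr E" "Cod E w = Dom E (pb1 E (pos \<phi>) (tgt \<phi>))" for w
    using that \<phi> assms(1) by (intro comp_reassoc) auto
  show "sharp_at E \<phi> x y \<in> Arr E" "Dom E (sharp_at E \<phi> x y) = Dom E x"
    "Cod E (sharp_at E \<phi> x y) = Dom E (src \<phi>)" "src \<phi> \<cdot> sharp_at E \<phi> x y = x"
    using assms \<phi> by (simp_all add: sharp_at_def src_sharp)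
  show *: "sharp_at E \<phi> x y \<cdot> s = sharp_at E \<phi> (x \<cdot> s) (y \<cdot> s)"
    if "s \<in> Arr E" "Cod E s = Dom E x" for s
    using that assms \<phi> by (simp add: sharp_at_def)
  show "src \<phi> \<cdot> sharp_at E \<phi> (x \<cdot> s) (y \<cdot> s) = x \<cdot> s" if "s \<in> Arr E" "Cod E s = Dom E x" for s
    using that assms(1) \<open>sharp_at E \<phi> x y \<in> Arr E\<close> \<open>Dom E (sharp_at E \<phi> x y) = Dom E x\<close>
      \<open>Cod E (sharp_at E \<phi> x y) = Dom E (src \<phi>)\<close>
    by (simp add: *[symmetric] comp_reassoc[OF \<open>src \<phi> \<cdot> sharp_at E \<phi> x y = x\<close>])
qed

text \<open>A variant for goals in which \<open>src \<phi>\<close> has already been replaced by the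
  name of the source.\<close>

lemma src_sharp_at [simp]:
  assumes "\<phi> \<in> Arr (Poly E)" "x \<in> Arr E" "y \<in> Arr E" "Cod E x = Cod E (src \<phi>)"
    "Cod E y = Dom E (tgt \<phi>)" "Dom E y = Dom E x" "tgt \<phi> \<cdot> y = pos \<phi> \<cdot> x" "src \<phi> = p"
  shows "p \<cdot> sharp_at E \<phi> x y = x"
  using sharp_at(4)[OF assms(1-7)] assms(8) by simp

text \<open>At the two projections of the pullback, \<open>sharp_at\<close> gives back
  \<open>sharp\<close>, because pairing the projections is the identity. Agreement on all elements
  thus forces equality of the records.\<close>

lemma Poly_eqI:
  assumes "\<phi> \<in> Arr (Poly E)" "\<psi> \<in> Arr (Poly E)" "src \<phi> = src \<psi>" "tgt \<phi> = tgt \<psi>" "pos \<phi> = pos \<psi>"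
    and "\<And>x y. x \<in> Arr E \<Longrightarrow> y \<in> Arr E \<Longrightarrow> Dom E y = Dom E x \<Longrightarrow> Cod E x = Cod E (src \<phi>) \<Longrightarrow>
      Cod E y = Dom E (tgt \<phi>) \<Longrightarrow> tgt \<phi> \<cdot> y = pos \<phi> \<cdot> x \<Longrightarrow> sharp_at E \<phi> x y = sharp_at E \<psi> x y"
  shows "\<phi> = \<psi>"
proof -
  let ?x = "pb1 E (pos \<phi>) (tgt \<phi>)" and ?y = "pb2 E (pos \<phi>) (tgt \<phi>)"
  have "sharp_at E \<phi> ?x ?y = sharp \<phi>" "sharp_at E \<psi> ?x ?y = sharp \<psi>"
    using assms(1-5) by (simp_all add: sharp_at_def pb_pair_id sharp_arr)
  moreover have "sharp_at E \<phi> ?x ?y = sharp_at E \<psi> ?x ?y"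
    using assms(1-5) by (intro assms(6)) simp_all
  ultimately show ?thesis
    using assms(3-5) by simp
qed

lemma sharp_over [simp]:
  assumes "\<phi> \<in> Arr (Poly E)" "x \<in> Arr E" "Cod E x = Cod E (src \<phi>)"
  shows "sharp_over E \<phi> x \<in> Arr E"
    "Dom E (sharp_over E \<phi> x) = Dom E (pb1 E (pos \<phi> \<cdot> x) (tgt \<phi>))"
    "Cod E (sharp_over E \<phi> x) = Dom E (pb1 E x (src \<phi>))"
    "\<lbrakk>s \<in> Arr E; y \<in> Arr E; Dom E y = Dom E s; Cod E s = Dom E x; Cod E y = Dom E (tgt \<phi>);
      tgt \<phi> \<cdot> y = pos \<phi> \<cdot> x \<cdot> s\<rbrakk> \<Longrightarrow>
      sharp_over E \<phi> x \<cdot> pb_pair E (pos \<phi> \<cdot> x) (tgt \<phi>) s y =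
      pb_pair E x (src \<phi>) s (sharp_at E \<phi> (x \<cdot> s) y)"
    "pb1 E x (src \<phi>) \<cdot> sharp_over E \<phi> x = pb1 E (pos \<phi> \<cdot> x) (tgt \<phi>)"
  using assms by (simp_all add: sharp_over_def Let_def)

text \<open>\<open>sharp_over\<close> turns the pair \<open>(x, z)\<close> into \<open>x\<close>
  with the pulled-back direction, so the composite direction map is nested application of
  \<open>sharp_at\<close>. In this form the unit laws and associativity of \<open>Poly\<close> hold
  by rewriting.\<close>

lemma Comp_Poly [simp]:
  assumes "\<phi> \<in> Arr (Poly E)" "\<psi> \<in> Arr (Poly E)" "src \<psi> = tgt \<phi>"
  shows "Comp (Poly E) \<psi> \<phi> \<in> Arr (Poly E)"
    "src (Comp (Poly E) \<psi> \<phi>) = src \<phi>" "tgt (Comp (Poly E) \<psi> \<phi>) = tgt \<psi>"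
    "pos (Comp (Poly E) \<psi> \<phi>) = pos \<psi> \<cdot> pos \<phi>"
    "\<lbrakk>x \<in> Arr E; z \<in> Arr E; Dom E z = Dom E x; Cod E x = Cod E (src \<phi>); Cod E z = Dom E (tgt \<psi>);
      tgt \<psi> \<cdot> z = pos \<psi> \<cdot> pos \<phi> \<cdot> x\<rbrakk> \<Longrightarrow>
      sharp_at E (Comp (Poly E) \<psi> \<phi>) x z = sharp_at E \<phi> x (sharp_at E \<psi> (pos \<phi> \<cdot> x) z)"
proof -
  note \<phi> = sharp_arr[OF assms(1)]
  have src_sharp: "src \<phi> \<cdot> sharp \<phi> \<cdot> w = pb1 E (pos \<phi>) (tgt \<phi>) \<cdot> w"
    if "w \<in> Arr E" "Cod E w = Dom E (pb1 E (pos \<phi>) (tgt \<phi>))" for w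
    using that \<phi> assms(1) by (intro comp_reassoc) auto
  show "src (Comp (Poly E) \<psi> \<phi>) = src \<phi>" "tgt (Comp (Poly E) \<psi> \<phi>) = tgt \<psi>"
    "pos (Comp (Poly E) \<psi> \<phi>) = pos \<psi> \<cdot> pos \<phi>"
    by (simp_all add: Comp_Poly_eq)
  show "Comp (Poly E) \<psi> \<phi> \<in> Arr (Poly E)"
    using assms \<phi> sharp_over(1-3,5)[OF assms(2), of "pos \<phi>"]
    unfolding Poly_arr_iff[of "Comp _ _ _"] by (simp add: Comp_Poly_eq src_sharp)
  show "sharp_at E (Comp (Poly E) \<psi> \<phi>) x z = sharp_at E \<phi> x (sharp_at E \<psi> (pos \<phi> \<cdot> x) z)"
    if "x \<in> Arr E" "z \<in> Arr E" "Dom E z = Dom E x" "Cod E x = Cod E (src \<phi>)" "Cod E z = Dom E (tgt \<psi>)"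
      "tgt \<psi> \<cdot> z = pos \<psi> \<cdot> pos \<phi> \<cdot> x"
  proof -
    have "sharp_over E \<psi> (pos \<phi>) \<cdot> pb_pair E (pos \<psi> \<cdot> pos \<phi>) (tgt \<psi>) x z =
      pb_pair E (pos \<phi>) (tgt \<phi>) x (sharp_at E \<psi> (pos \<phi> \<cdot> x) z)"
      using that assms sharp_over(4)[OF assms(2), of "pos \<phi>" x z] by simp
    then show ?thesis
      using that assms \<phi> by (simp add: sharp_at_def[of E "Comp _ _ _"] sharp_at_def[of E \<phi>]) (simp add: Comp_Poly_eq)
  qed
qed

lemma Id_Poly [simp]:
  assumes "p \<in> Arr E"
  shows "Id (Poly E) p \<in> Arr (Poly E)" "src (Id (Poly E) p) = p" "tgt (Id (Poly E) p) = p"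
    "pos (Id (Poly E) p) = Id E (Cod E p)"
    "\<lbrakk>x \<in> Arr E; y \<in> Arr E; Dom E y = Dom E x; Cod E x = Cod E p; Cod E y = Dom E p; p \<cdot> y = x\<rbrakk> \<Longrightarrow>
      sharp_at E (Id (Poly E) p) x y = y"
proof -
  show "src (Id (Poly E) p) = p" "tgt (Id (Poly E) p) = p"
    "pos (Id (Poly E) p) = Id E (Cod E p)"
    by (simp_all add: Id_Poly_eq)
  show "Id (Poly E) p \<in> Arr (Poly E)"
    using assms unfolding Poly_arr_iff by (simp add: Id_Poly_eq)
  show "\<lbrakk>x \<in> Arr E; y \<in> Arr E; Dom E y = Dom E x; Cod E x = Cod E p; Cod E y = Dom E p; p \<cdot> y = x\<rbrakk> \<Longrightarrow>
      sharp_at E (Id (Poly E) p) x y = y"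
    using assms by (simp add: sharp_at_def) (auto simp: Id_Poly_eq)
qed

lemma Poly_category: "is_category (Poly E)"
proof (rule is_categoryI, goal_cases)
  case (4 \<phi>)
  then show ?case
    by (auto intro!: Poly_eqI)
next
  case (5 \<phi> \<psi> \<chi>)
  then show ?case
    by (auto intro!: Poly_eqI)
qed auto

section \<open>The composition product\<close>

text \<open>\<open>tri_at p q t y\<close> is \<open>f(y)\<close> for the position \<open>t = (x, f)\<close> of \<open>p \<triangleleft> q\<close> and a direction
  \<open>y\<close> of \<open>p\<close> at \<open>x\<close>.\<close>

definition tri_at :: "'a \<Rightarrow> 'a \<Rightarrow> 'a \<Rightarrow> 'a \<Rightarrow> 'a" where
  "tri_at p q t y = tri_ev E p q \<cdot> pb_pair E (tri_pos E p q) p t y"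

lemma tri_pos_arr [simp]:
  assumes "p \<in> Arr E" "q \<in> Arr E"
  shows "tri_pos E p q \<in> Arr E" "Cod E (tri_pos E p q) = Cod E p"
  using assms by (simp_all add: tri_pos_def)

lemma tri_ev_arr [simp]:
  assumes "p \<in> Arr E" "q \<in> Arr E"
  shows "tri_ev E p q \<in> Arr E" "Dom E (tri_ev E p q) = Dom E (pb1 E (tri_pos E p q) p)"
    "Cod E (tri_ev E p q) = Cod E q"
  using assms by (simp_all add: tri_pos_def tri_ev_def)

lemma tri_at [simp]:
  assumes "p \<in> Arr E" "q \<in> Arr E" "t \<in> Arr E" "y \<in> Arr E" "Dom E y = Dom E t"
    "Cod E t = Dom E (tri_pos E p q)" "Cod E y = Dom E p" "p \<cdot> y = tri_pos E p q \<cdot> t"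
  shows "tri_at p q t y \<in> Arr E" "Dom E (tri_at p q t y) = Dom E t" "Cod E (tri_at p q t y) = Cod E q"
    "s \<in> Arr E \<Longrightarrow> Cod E s = Dom E t \<Longrightarrow> tri_at p q t y \<cdot> s = tri_at p q (t \<cdot> s) (y \<cdot> s)"
  using assms by (simp_all add: tri_at_def)

text \<open>The counit takes values in \<open>Q \<times> P\<^sub>*\<close>, and its second component
  is the direction \<open>y\<close> at which it is evaluated. Only the first component,
  \<open>tri_at\<close>, can therefore distinguish two positions over the same position of
  \<open>p\<close>.\<close>

lemma tri_pos_ext:
  assumes pq: "p \<in> Arr E" "q \<in> Arr E"
    and t: "t \<in> Arr E" "t' \<in> Arr E" "Cod E t = Dom E (tri_pos E p q)" "Cod E t' = Dom E (tri_pos E p q)"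
    "Dom E t' = Dom E t" "tri_pos E p q \<cdot> t' = tri_pos E p q \<cdot> t"
    and ev: "\<And>s y. s \<in> Arr E \<Longrightarrow> y \<in> Arr E \<Longrightarrow> Cod E s = Dom E t \<Longrightarrow> Dom E y = Dom E s \<Longrightarrow>
      Cod E y = Dom E p \<Longrightarrow> p \<cdot> y = tri_pos E p q \<cdot> t \<cdot> s \<Longrightarrow> p \<cdot> y = tri_pos E p q \<cdot> t' \<cdot> s \<Longrightarrow>
      tri_at p q (t \<cdot> s) y = tri_at p q (t' \<cdot> s) y"
  shows "t = t'"
proof (rule Pi_ext[of p "pr2 E (Cod E q) (Dom E p)"], goal_cases)
  case (10 s y)
  show ?case
    by (rule prod_ext[of _ _ "Cod E q" "Dom E p"])
      (use 10 pq t ev[of s y] in \<open>simp_all add: tri_pos_def tri_at_def tri_ev_def\<close>)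
qed (use pq t in \<open>simp_all add: tri_pos_def\<close>)

lemma tri_pos_elem [simp]:
  assumes "p \<in> Arr E" "q \<in> Arr E" "x \<in> Arr E" "Cod E x = Cod E p" "f \<in> Arr E"
    "Dom E f = Dom E (pb1 E x p)" "Cod E f = Cod E q"
  shows "tri_pos_elem E p q x f \<in> Arr E" "Dom E (tri_pos_elem E p q x f) = Dom E x"
    "Cod E (tri_pos_elem E p q x f) = Dom E (tri_pos E p q)"
    "tri_pos E p q \<cdot> tri_pos_elem E p q x f = x"
    "s \<in> Arr E \<Longrightarrow> Cod E s = Dom E x \<Longrightarrow> tri_pos E p q \<cdot> tri_pos_elem E p q x f \<cdot> s = x \<cdot> s"
    "\<lbrakk>s \<in> Arr E; y \<in> Arr E; Cod E s = Dom E x; Dom E y = Dom E s; Cod E y = Dom E p; p \<cdot> y = x \<cdot> s\<rbrakk> \<Longrightarrow>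
      tri_at p q (tri_pos_elem E p q x f \<cdot> s) y = f \<cdot> pb_pair E x p s y"
  using assms by (simp_all add: tri_pos_elem_def tri_pos_def tri_at_def tri_ev_def)

text \<open>Element notation for the iterated pullback on which \<open>tri\<close> is defined: the
  direction \<open>(y, z)\<close> at the position \<open>t\<close>, with its two components defined
  next.\<close>

definition tri_dir :: "'a \<Rightarrow> 'a \<Rightarrow> 'a \<Rightarrow> 'a \<Rightarrow> 'a \<Rightarrow> 'a" where
  "tri_dir p q t y z = pb_pair E (tri_ev E p q) q (pb_pair E (tri_pos E p q) p t y) z"

definition tri_dir1 :: "'a \<Rightarrow> 'a \<Rightarrow> 'a \<Rightarrow> 'a" where
  "tri_dir1 p q d = pb2 E (tri_pos E p q) p \<cdot> pb1 E (tri_ev E p q) q \<cdot> d"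

definition tri_dir2 :: "'a \<Rightarrow> 'a \<Rightarrow> 'a \<Rightarrow> 'a" where
  "tri_dir2 p q d = pb2 E (tri_ev E p q) q \<cdot> d"

lemma tri_in_Arr [simp]:
  assumes "p \<in> Arr E" "q \<in> Arr E"
  shows "tri E p q \<in> Arr E" "Cod E (tri E p q) = Dom E (tri_pos E p q)"
  using assms by (simp_all add: tri_def)

lemma tri_dir [simp]:
  assumes "p \<in> Arr E" "q \<in> Arr E" "t \<in> Arr E" "y \<in> Arr E" "z \<in> Arr E" "Dom E y = Dom E t"
    "Dom E z = Dom E t" "Cod E t = Dom E (tri_pos E p q)" "Cod E y = Dom E p" "Cod E z = Dom E q"
    "p \<cdot> y = tri_pos E p q \<cdot> t" "q \<cdot> z = tri_at p q t y"
  shows "tri_dir p q t y z \<in> Arr E" "Dom E (tri_dir p q t y z) = Dom E t"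
    "Cod E (tri_dir p q t y z) = Dom E (tri E p q)" "tri E p q \<cdot> tri_dir p q t y z = t"
    "tri_dir1 p q (tri_dir p q t y z) = y" "tri_dir2 p q (tri_dir p q t y z) = z"
    "s \<in> Arr E \<Longrightarrow> Cod E s = Dom E t \<Longrightarrow>
      tri_dir p q t y z \<cdot> s = tri_dir p q (t \<cdot> s) (y \<cdot> s) (z \<cdot> s)"
proof -
  have e: "q \<cdot> z \<cdot> s = tri_ev E p q \<cdot> pb_pair E (tri_pos E p q) p (t \<cdot> s) (y \<cdot> s)"
    "p \<cdot> y \<cdot> s = tri_pos E p q \<cdot> t \<cdot> s"
    if "s \<in> Arr E" "Cod E s = Dom E t" for s
    using assms that comp_reassoc[OF assms(12), of s] comp_reassoc[OF assms(11), of s]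
    by (simp_all add: tri_at_def)
  show "tri_dir p q t y z \<in> Arr E" "Dom E (tri_dir p q t y z) = Dom E t"
    "Cod E (tri_dir p q t y z) = Dom E (tri E p q)" "tri E p q \<cdot> tri_dir p q t y z = t"
    "tri_dir1 p q (tri_dir p q t y z) = y" "tri_dir2 p q (tri_dir p q t y z) = z"
    "s \<in> Arr E \<Longrightarrow> Cod E s = Dom E t \<Longrightarrow>
      tri_dir p q t y z \<cdot> s = tri_dir p q (t \<cdot> s) (y \<cdot> s) (z \<cdot> s)"
    using assms e by (simp_all add: tri_dir_def tri_def tri_at_def tri_dir1_def tri_dir2_def)
qed

text \<open>The position below \<open>d\<close> enters as a variable \<open>t\<close> with an
  equation, so that the rules apply to whatever form that position has been rewritten to.\<close>

lemma tri_dir12 [simp]: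
  assumes "p \<in> Arr E" "q \<in> Arr E" "d \<in> Arr E" "Cod E d = Dom E (tri E p q)" "tri E p q \<cdot> d = t"
  shows "tri_dir1 p q d \<in> Arr E" "Dom E (tri_dir1 p q d) = Dom E d" "Cod E (tri_dir1 p q d) = Dom E p"
    "tri_dir2 p q d \<in> Arr E" "Dom E (tri_dir2 p q d) = Dom E d" "Cod E (tri_dir2 p q d) = Dom E q"
    "p \<cdot> tri_dir1 p q d = tri_pos E p q \<cdot> t" "q \<cdot> tri_dir2 p q d = tri_at p q t (tri_dir1 p q d)"
    "tri_dir p q t (tri_dir1 p q d) (tri_dir2 p q d) = d"
    "s \<in> Arr E \<Longrightarrow> Cod E s = Dom E d \<Longrightarrow> tri_dir1 p q d \<cdot> s = tri_dir1 p q (d \<cdot> s)"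
    "s \<in> Arr E \<Longrightarrow> Cod E s = Dom E d \<Longrightarrow> tri_dir2 p q d \<cdot> s = tri_dir2 p q (d \<cdot> s)"
proof -
  have t: "t = pb1 E (tri_pos E p q) p \<cdot> pb1 E (tri_ev E p q) q \<cdot> d"
    using assms by (auto simp: tri_def)
  show "tri_dir1 p q d \<in> Arr E" "Dom E (tri_dir1 p q d) = Dom E d" "Cod E (tri_dir1 p q d) = Dom E p"
    "tri_dir2 p q d \<in> Arr E" "Dom E (tri_dir2 p q d) = Dom E d" "Cod E (tri_dir2 p q d) = Dom E q"
    "p \<cdot> tri_dir1 p q d = tri_pos E p q \<cdot> t" "q \<cdot> tri_dir2 p q d = tri_at p q t (tri_dir1 p q d)"
    "tri_dir p q t (tri_dir1 p q d) (tri_dir2 p q d) = d"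
    "s \<in> Arr E \<Longrightarrow> Cod E s = Dom E d \<Longrightarrow> tri_dir1 p q d \<cdot> s = tri_dir1 p q (d \<cdot> s)"
    "s \<in> Arr E \<Longrightarrow> Cod E s = Dom E d \<Longrightarrow> tri_dir2 p q d \<cdot> s = tri_dir2 p q (d \<cdot> s)"
    using assms(1-4) unfolding t
    by (simp_all add: tri_dir1_def tri_dir2_def tri_at_def tri_dir_def tri_def)
qed

section \<open>The coclosure\<close>

lemma coc_dir_arr [simp]:
  assumes "p \<in> Arr E" "q \<in> Arr E"
  shows "coc_dir E q p \<in> Arr E" "Cod E (coc_dir E q p) = Dom E (pr1 E (Cod E p) (Cod E q))"
  using assms by (simp_all add: coc_dir_def)

lemma coc_in_Arr [simp]:
  assumes "p \<in> Arr E" "q \<in> Arr E"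
  shows "coc E q p \<in> Arr E" "Cod E (coc E q p) = Cod E p"
    "coc_j E q p \<in> Arr E" "Dom E (coc_j E q p) = Dom E (coc E q p)" "Cod E (coc_j E q p) = Cod E q"
  using assms by (simp_all add: coc_def coc_j_def)

text \<open>The counit value \<open>w\<close> lies over the element of
  \<open>P \<times> Q\<^sub>*\<close> it is evaluated at, and \<open>B\<close> is the identity on
  the factor \<open>Q\<^sub>*\<close>. So the second component of \<open>w\<close> is
  \<open>z\<close> itself, and passing to the first component \<open>coc_ev\<close> loses
  nothing.\<close>

lemma coc_ev_pair:
  fixes p q k z
  defines "F \<equiv> prod_arr E (Id E (Cod E p)) q" and "B \<equiv> prod_arr E p (Id E (Dom E q))"
  defines "w \<equiv> PiCounit E F B \<cdot> pb_pair E (coc_dir E q p) F k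
      (prod_pair E (Cod E p) (Dom E q) (coc E q p \<cdot> k) z)"
  assumes pq: "p \<in> Arr E" "q \<in> Arr E" "k \<in> Arr E" "z \<in> Arr E" "Dom E z = Dom E k"
    "Cod E k = Dom E (coc E q p)" "Cod E z = Dom E q" "q \<cdot> z = coc_j E q p \<cdot> k"
  shows "F \<cdot> prod_pair E (Cod E p) (Dom E q) (coc E q p \<cdot> k) z = coc_dir E q p \<cdot> k"
    "w \<in> Arr E" "Dom E w = Dom E k" "Cod E w = Dom E (pr1 E (Dom E p) (Dom E q))"
    "coc_ev E q p k z = pr1 E (Dom E p) (Dom E q) \<cdot> w" "pr2 E (Dom E p) (Dom E q) \<cdot> w = z"
    "p \<cdot> pr1 E (Dom E p) (Dom E q) \<cdot> w = coc E q p \<cdot> k"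
proof -
  have F: "F \<in> Arr E" "Dom E F = Dom E (pr1 E (Cod E p) (Dom E q))"
    "Cod E F = Dom E (pr1 E (Cod E p) (Cod E q))"
    and B: "B \<in> Arr E" "Dom E B = Dom E (pr1 E (Dom E p) (Dom E q))" "Cod E B = Dom E F"
    using pq by (simp_all add: F_def B_def)
  have k: "Cod E k = Dom E (coc_dir E q p)" "Dom E (coc E q p) = Dom E (coc_dir E q p)"
    using pq by (simp_all add: coc_def)
  show e: "F \<cdot> prod_pair E (Cod E p) (Dom E q) (coc E q p \<cdot> k) z = coc_dir E q p \<cdot> k"
    unfolding F_def
    by (rule prod_ext[of _ _ "Cod E p" "Cod E q"])
      (use pq k in \<open>simp_all, simp_all add: coc_def coc_j_def\<close>)
  have dir: "coc_dir E q p = PiOb E F B"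
    by (simp add: coc_dir_def F_def B_def)
  show w: "w \<in> Arr E" "Dom E w = Dom E k" "Cod E w = Dom E (pr1 E (Dom E p) (Dom E q))"
    unfolding w_def using pq k F B e by (simp_all add: dir)
  have "B \<cdot> w = prod_pair E (Cod E p) (Dom E q) (coc E q p \<cdot> k) z"
    unfolding w_def using pq k F B e by (simp add: dir)
  then have "pr1 E (Cod E p) (Dom E q) \<cdot> B \<cdot> w = coc E q p \<cdot> k" "pr2 E (Cod E p) (Dom E q) \<cdot> B \<cdot> w = z"
    using pq by simp_all
  then show "pr2 E (Dom E p) (Dom E q) \<cdot> w = z" "p \<cdot> pr1 E (Dom E p) (Dom E q) \<cdot> w = coc E q p \<cdot> k"
    using pq w unfolding B_def by simp_all
  show "coc_ev E q p k z = pr1 E (Dom E p) (Dom E q) \<cdot> w"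
    by (simp add: coc_ev_def w_def F_def B_def)
qed

lemma coc_ev [simp]:
  assumes "p \<in> Arr E" "q \<in> Arr E" "k \<in> Arr E" "z \<in> Arr E" "Dom E z = Dom E k"
    "Cod E k = Dom E (coc E q p)" "Cod E z = Dom E q" "q \<cdot> z = coc_j E q p \<cdot> k"
  shows "coc_ev E q p k z \<in> Arr E" "Dom E (coc_ev E q p k z) = Dom E k"
    "Cod E (coc_ev E q p k z) = Dom E p" "p \<cdot> coc_ev E q p k z = coc E q p \<cdot> k"
    "s \<in> Arr E \<Longrightarrow> Cod E s = Dom E k \<Longrightarrow> coc_ev E q p k z \<cdot> s = coc_ev E q p (k \<cdot> s) (z \<cdot> s)"
proof -
  note * = coc_ev_pair[OF assms]
  show "coc_ev E q p k z \<in> Arr E" "Dom E (coc_ev E q p k z) = Dom E k"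
    "Cod E (coc_ev E q p k z) = Dom E p" "p \<cdot> coc_ev E q p k z = coc E q p \<cdot> k"
    unfolding *(5) using assms(1,2) *(2-4,7) by simp_all
  have k: "Cod E k = Dom E (coc_dir E q p)"
    using assms by (simp add: coc_def)
  show "s \<in> Arr E \<Longrightarrow> Cod E s = Dom E k \<Longrightarrow> coc_ev E q p k z \<cdot> s = coc_ev E q p (k \<cdot> s) (z \<cdot> s)"
    using *(1) assms k unfolding coc_ev_def coc_dir_def by simp
qed

text \<open>Agreement of both base components puts \<open>k\<close> and \<open>k'\<close> over the
  same arrow to \<open>P \<times> Q\<close>, so \<open>Pi_ext\<close> applies. A test element of
  \<open>P \<times> Q\<^sub>*\<close> consists of the common position of \<open>p\<close> and a
  direction \<open>z\<close>; the two counit values share the component \<open>z\<close>, which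
  leaves \<open>coc_ev\<close> to be compared.\<close>

lemma coc_ext:
  assumes pq: "p \<in> Arr E" "q \<in> Arr E"
    and k: "k \<in> Arr E" "k' \<in> Arr E" "Cod E k = Dom E (coc E q p)" "Cod E k' = Dom E (coc E q p)"
    "Dom E k' = Dom E k" "coc E q p \<cdot> k' = coc E q p \<cdot> k" "coc_j E q p \<cdot> k' = coc_j E q p \<cdot> k"
    and ev: "\<And>s z. s \<in> Arr E \<Longrightarrow> z \<in> Arr E \<Longrightarrow> Cod E s = Dom E k \<Longrightarrow> Dom E z = Dom E s \<Longrightarrow>
      Cod E z = Dom E q \<Longrightarrow> q \<cdot> z = coc_j E q p \<cdot> k \<cdot> s \<Longrightarrow> q \<cdot> z = coc_j E q p \<cdot> k' \<cdot> s \<Longrightarrow>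
      coc_ev E q p (k \<cdot> s) z = coc_ev E q p (k' \<cdot> s) z"
  shows "k = k'"
proof -
  let ?F = "prod_arr E (Id E (Cod E p)) q" and ?B = "prod_arr E p (Id E (Dom E q))"
  have F: "?F \<in> Arr E" "Dom E ?F = Dom E (pr1 E (Cod E p) (Dom E q))"
    "Cod E ?F = Dom E (pr1 E (Cod E p) (Cod E q))"
    and B: "?B \<in> Arr E" "Dom E ?B = Dom E (pr1 E (Dom E p) (Dom E q))" "Cod E ?B = Dom E ?F"
    using pq by simp_all
  have dom: "Dom E (coc E q p) = Dom E (coc_dir E q p)"
    using pq by (simp add: coc_def)
  have pr: "pr1 E (Cod E p) (Cod E q) \<cdot> coc_dir E q p \<cdot> w = coc E q p \<cdot> w"
    "pr2 E (Cod E p) (Cod E q) \<cdot> coc_dir E q p \<cdot> w = coc_j E q p \<cdot> w"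
    if "w \<in> Arr E" "Cod E w = Dom E (coc_dir E q p)" for w
    using that pq by (simp_all add: coc_def coc_j_def)
  have dir: "coc_dir E q p \<cdot> k' = coc_dir E q p \<cdot> k"
    by (rule prod_ext[of _ _ "Cod E p" "Cod E q"]) (use pq k dom pr in simp_all)
  show ?thesis
  proof (rule Pi_ext[OF F(1) B(1) B(3), folded coc_dir_def, OF k(1,2) _ _ k(5) dir])
    fix s y
    assume s: "s \<in> Arr E" "y \<in> Arr E" "Cod E s = Dom E k" "Dom E y = Dom E s" "Cod E y = Dom E ?F"
      "?F \<cdot> y = coc_dir E q p \<cdot> k \<cdot> s" "?F \<cdot> y = coc_dir E q p \<cdot> k' \<cdot> s"
    define z where "z = pr2 E (Cod E p) (Dom E q) \<cdot> y"
    have z: "z \<in> Arr E" "Dom E z = Dom E s" "Cod E z = Dom E q"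
      using s F pq by (simp_all add: z_def)
    have c: "coc E q p \<cdot> k \<cdot> s = pr1 E (Cod E p) (Dom E q) \<cdot> y" "coc_j E q p \<cdot> k \<cdot> s = q \<cdot> z"
      "coc E q p \<cdot> k' \<cdot> s = pr1 E (Cod E p) (Dom E q) \<cdot> y" "coc_j E q p \<cdot> k' \<cdot> s = q \<cdot> z"
      using pr[of "k \<cdot> s"] pr[of "k' \<cdot> s"] s k F pq dom unfolding s(6,7)[symmetric] z_def
      by simp_all
    \<comment> \<open>The same \<open>y\<close> is written once through \<open>k\<close> and once
      through \<open>k'\<close>, to fold the two instances of \<open>coc_ev_pair\<close> into the
      test element.\<close>
    have y: "y = prod_pair E (Cod E p) (Dom E q) (coc E q p \<cdot> k \<cdot> s) z"
      "y = prod_pair E (Cod E p) (Dom E q) (coc E q p \<cdot> k' \<cdot> s) z"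
      using s F pq by (simp_all add: c z_def)
    have "k \<cdot> s \<in> Arr E" "Dom E (k \<cdot> s) = Dom E s" "Cod E (k \<cdot> s) = Dom E (coc E q p)"
      "k' \<cdot> s \<in> Arr E" "Dom E (k' \<cdot> s) = Dom E s" "Cod E (k' \<cdot> s) = Dom E (coc E q p)"
      using k s by simp_all
    note ks = this
    note w = coc_ev_pair[OF pq ks(1) z(1) _ ks(3) z(3) c(2)[symmetric], folded y(1)]
      and w' = coc_ev_pair[OF pq ks(4) z(1) _ ks(6) z(3) c(4)[symmetric], folded y(2)]
    have ev': "coc_ev E q p (k \<cdot> s) z = coc_ev E q p (k' \<cdot> s) z"
      using s z c by (intro ev) simp_all
    show "PiCounit E ?F ?B \<cdot> pb_pair E (coc_dir E q p) ?F (k \<cdot> s) y =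
        PiCounit E ?F ?B \<cdot> pb_pair E (coc_dir E q p) ?F (k' \<cdot> s) y"
      by (rule prod_ext[of _ _ "Dom E p" "Dom E q"])
        (use w(2-6) w'(2-6) ev' pq ks z in simp_all)
  qed (use k dom in simp_all)
qed

text \<open>The pullback of \<open>(i, j)\<close> along \<open>id \<times> q\<close> carries the
  same elements as \<open>X \<times>\<^sub>Q Q\<^sub>*\<close>, because the
  \<open>P\<close>-component is already fixed by \<open>i\<close>. A map \<open>g\<close> on the
  latter therefore yields a map \<open>h\<close> on the former that can be transposed.\<close>

lemma coc_elem [simp]:
  assumes "p \<in> Arr E" "q \<in> Arr E" "i \<in> Arr E" "j \<in> Arr E" "Dom E j = Dom E i" "Cod E i = Cod E p"
    "Cod E j = Cod E q" "g \<in> Arr E" "Dom E g = Dom E (pb1 E j q)" "Cod E g = Dom E p"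
    "p \<cdot> g = i \<cdot> pb1 E j q"
  shows "coc_elem E q p i j g \<in> Arr E" "Dom E (coc_elem E q p i j g) = Dom E i"
    "Cod E (coc_elem E q p i j g) = Dom E (coc E q p)"
    "coc E q p \<cdot> coc_elem E q p i j g = i" "coc_j E q p \<cdot> coc_elem E q p i j g = j"
    "s \<in> Arr E \<Longrightarrow> Cod E s = Dom E i \<Longrightarrow> coc E q p \<cdot> coc_elem E q p i j g \<cdot> s = i \<cdot> s"
    "s \<in> Arr E \<Longrightarrow> Cod E s = Dom E i \<Longrightarrow> coc_j E q p \<cdot> coc_elem E q p i j g \<cdot> s = j \<cdot> s"
    "\<lbrakk>s \<in> Arr E; z \<in> Arr E; Dom E z = Dom E s; Cod E s = Dom E i; Cod E z = Dom E q; q \<cdot> z = j \<cdot> s\<rbrakk> \<Longrightarrow>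
      coc_ev E q p (coc_elem E q p i j g \<cdot> s) z = g \<cdot> pb_pair E j q s z"
proof -
  let ?F = "prod_arr E (Id E (Cod E p)) q" and ?B = "prod_arr E p (Id E (Dom E q))"
  have F: "?F \<in> Arr E" "Dom E ?F = Dom E (pr1 E (Cod E p) (Dom E q))"
    "Cod E ?F = Dom E (pr1 E (Cod E p) (Cod E q))"
    and B: "?B \<in> Arr E" "Dom E ?B = Dom E (pr1 E (Dom E p) (Dom E q))" "Cod E ?B = Dom E ?F"
    using assms by simp_all
  define x where "x = prod_pair E (Cod E p) (Cod E q) i j"
  define z0 where "z0 = pr2 E (Cod E p) (Dom E q) \<cdot> pb2 E x ?F"
  define h where "h = prod_pair E (Dom E p) (Dom E q) (g \<cdot> pb_pair E j q (pb1 E x ?F) z0) z0"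
  have x: "x \<in> Arr E" "Dom E x = Dom E i" "Cod E x = Cod E ?F"
    using assms by (simp_all add: x_def)
  have z0: "z0 \<in> Arr E" "Dom E z0 = Dom E (pb1 E x ?F)" "Cod E z0 = Dom E q"
    using assms x F by (simp_all add: z0_def)
  have sq: "?F \<cdot> pb2 E x ?F = prod_pair E (Cod E p) (Cod E q) (i \<cdot> pb1 E x ?F) (j \<cdot> pb1 E x ?F)"
    using assms x F by (simp add: x_def)
  have "pr1 E (Cod E p) (Cod E q) \<cdot> ?F \<cdot> pb2 E x ?F = i \<cdot> pb1 E x ?F"
    "pr2 E (Cod E p) (Cod E q) \<cdot> ?F \<cdot> pb2 E x ?F = j \<cdot> pb1 E x ?F"
    unfolding sq using assms x F by simp_all
  \<comment> \<open>The universal element of that pullback has \<open>P\<close>-component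
    \<open>i\<close>, and its direction \<open>z0\<close> lies over \<open>j\<close>. The latter is
    what makes the pairing inside \<open>h\<close> legitimate.\<close>
  then have i0: "pr1 E (Cod E p) (Dom E q) \<cdot> pb2 E x ?F = i \<cdot> pb1 E x ?F"
    and j0: "q \<cdot> z0 = j \<cdot> pb1 E x ?F"
    using assms x F unfolding z0_def by (simp_all del: pb_square)
  have pg: "p \<cdot> g \<cdot> w = i \<cdot> pb1 E j q \<cdot> w" if "w \<in> Arr E" "Cod E w = Dom E (pb1 E j q)" for w
    using assms comp_reassoc[OF assms(11), of w] that by simp
  have h: "h \<in> Arr E" "Dom E h = Dom E (pb1 E x ?F)" "Cod E h = Dom E ?B"
    using assms x F B z0 j0 by (simp_all add: h_def)
  \<comment> \<open>Transposing \<open>h\<close> requires it to lie over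
    \<open>P \<times> Q\<^sub>*\<close>. On the factor \<open>P\<close> this is the hypothesis that
    \<open>g\<close> lies over \<open>i\<close>; on the factor \<open>Q\<^sub>*\<close> both sides
    are \<open>z0\<close>.\<close>
  have Bh: "?B \<cdot> h = pb2 E x ?F"
  proof (rule prod_ext[of _ _ "Cod E p" "Dom E q"])
    show "pr1 E (Cod E p) (Dom E q) \<cdot> ?B \<cdot> h = pr1 E (Cod E p) (Dom E q) \<cdot> pb2 E x ?F"
      using assms x F B z0 h(1-3) j0 pg by (simp add: i0) (simp add: h_def pg)
    show "pr2 E (Cod E p) (Dom E q) \<cdot> ?B \<cdot> h = pr2 E (Cod E p) (Dom E q) \<cdot> pb2 E x ?F"
      using assms x F B z0 h(1-3) j0 pg by (simp add: z0_def[symmetric]) (simp add: h_def)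
  qed (use assms x F B h in simp_all)
  have elem: "coc_elem E q p i j g = PiTranspose E ?F x ?B h"
    by (simp add: coc_elem_def Let_def x_def z0_def h_def)
  have dom: "Dom E (coc E q p) = Dom E (coc_dir E q p)"
    using assms by (simp add: coc_def)
  show arr: "coc_elem E q p i j g \<in> Arr E" "Dom E (coc_elem E q p i j g) = Dom E i"
    "Cod E (coc_elem E q p i j g) = Dom E (coc E q p)"
    unfolding elem dom coc_dir_def using F B x h Bh by simp_all
  have dir: "coc_dir E q p \<cdot> coc_elem E q p i j g = x"
    unfolding elem coc_dir_def using F B x h Bh by simp
  show c: "coc E q p \<cdot> coc_elem E q p i j g = i" "coc_j E q p \<cdot> coc_elem E q p i j g = j"
    using arr dom dir assms by (simp_all add: coc_def coc_j_def x_def)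
  show cs: "coc E q p \<cdot> coc_elem E q p i j g \<cdot> s = i \<cdot> s" "coc_j E q p \<cdot> coc_elem E q p i j g \<cdot> s = j \<cdot> s"
    if "s \<in> Arr E" "Cod E s = Dom E i" for s
    using that arr assms comp_reassoc[OF c(1), of s] comp_reassoc[OF c(2), of s] by simp_all
  show "coc_ev E q p (coc_elem E q p i j g \<cdot> s) z = g \<cdot> pb_pair E j q s z"
    if s: "s \<in> Arr E" "z \<in> Arr E" "Dom E z = Dom E s" "Cod E s = Dom E i" "Cod E z = Dom E q"
      "q \<cdot> z = j \<cdot> s"
  proof -
    let ?y = "prod_pair E (Cod E p) (Dom E q) (i \<cdot> s) z"
    have y: "?y \<in> Arr E" "Dom E ?y = Dom E s" "Cod E ?y = Dom E ?F"
      using assms s F by simp_all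
    have Fy: "?F \<cdot> ?y = x \<cdot> s"
      using assms s coc_ev_pair(1)[of p q "coc_elem E q p i j g \<cdot> s" z] arr dir
        comp_reassoc[OF dir, of s] dom
      by (simp add: cs)
    have "PiCounit E ?F ?B \<cdot> pb_pair E (coc_dir E q p) ?F (coc_elem E q p i j g \<cdot> s) ?y =
        h \<cdot> pb_pair E x ?F s ?y"
      unfolding elem coc_dir_def
      by (rule PiCounit_PiTranspose) (use F B x h Bh s y Fy in simp_all)
    moreover have z0': "z0 \<cdot> pb_pair E x ?F s ?y = z"
      using assms x F s y Fy by (simp add: z0_def)
    moreover have "h \<cdot> pb_pair E x ?F s ?y =
        prod_pair E (Dom E p) (Dom E q) (g \<cdot> pb_pair E j q s z) z"
      using assms x F s y Fy z0 z0' j0 by (simp add: h_def)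
    ultimately show ?thesis
      using s assms by (simp add: coc_ev_def cs)
  qed
qed

section \<open>Element formulas for both operations on morphisms\<close>

lemma tri_arr_props:
  assumes "\<phi> \<in> Arr (Poly E)" "\<psi> \<in> Arr (Poly E)"
    and ends: "src \<phi> = p" "tgt \<phi> = p'" "src \<psi> = q" "tgt \<psi> = q'"
  shows tri_arr_arr: "tri_arr E \<phi> \<psi> \<in> Arr (Poly E)"
    and tri_arr_ends: "src (tri_arr E \<phi> \<psi>) = tri E p q" "tgt (tri_arr E \<phi> \<psi>) = tri E p' q'"
    and tri_arr_pos: "\<lbrakk>t \<in> Arr E; Cod E t = Dom E (tri_pos E p q)\<rbrakk> \<Longrightarrow>
      tri_pos E p' q' \<cdot> pos (tri_arr E \<phi> \<psi>) \<cdot> t = pos \<phi> \<cdot> tri_pos E p q \<cdot> t"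
    and tri_arr_pos': "tri_pos E p' q' \<cdot> pos (tri_arr E \<phi> \<psi>) = pos \<phi> \<cdot> tri_pos E p q"
    and tri_arr_at: "\<lbrakk>t \<in> Arr E; Cod E t = Dom E (tri_pos E p q); y \<in> Arr E; Dom E y = Dom E t;
      Cod E y = Dom E p'; p' \<cdot> y = pos \<phi> \<cdot> tri_pos E p q \<cdot> t\<rbrakk> \<Longrightarrow>
      tri_at p' q' (pos (tri_arr E \<phi> \<psi>) \<cdot> t) y =
      pos \<psi> \<cdot> tri_at p q t (sharp_at E \<phi> (tri_pos E p q \<cdot> t) y)"
    and tri_arr_sharp: "\<lbrakk>t \<in> Arr E; Cod E t = Dom E (tri_pos E p q); d \<in> Arr E; Dom E d = Dom E t;
      Cod E d = Dom E (tri E p' q'); tri E p' q' \<cdot> d = pos (tri_arr E \<phi> \<psi>) \<cdot> t;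
      y = sharp_at E \<phi> (tri_pos E p q \<cdot> t) (tri_dir1 p' q' d)\<rbrakk> \<Longrightarrow>
      sharp_at E (tri_arr E \<phi> \<psi>) t d =
      tri_dir p q t y (sharp_at E \<psi> (tri_at p q t y) (tri_dir2 p' q' d))"
proof -
  define \<pi> ev m where "\<pi> = tri_pos E p q" and "ev = tri_ev E p q"
    and "m = tri_pos_elem E p' q' (pos \<phi> \<cdot> \<pi>) (pos \<psi> \<cdot> ev \<cdot> sharp_over E \<phi> \<pi>)"
  \<comment> \<open>\<open>Y\<close> and \<open>S\<close> are the two formulas for directions at
    arbitrary elements. The record stores \<open>S\<close> at the universal pair; once
    \<open>S\<close> is known to be natural in the stage, that value determines all others.\<close>
  define Y where "Y t d = sharp_at E \<phi> (\<pi> \<cdot> t) (tri_dir1 p' q' d)" for t d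
  define S where "S t d = tri_dir p q t (Y t d)
    (sharp_at E \<psi> (tri_at p q t (Y t d)) (tri_dir2 p' q' d))" for t d
  have eq: "tri_arr E \<phi> \<psi> = \<lparr>src = tri E p q, tgt = tri E p' q', pos = m,
      sharp = S (pb1 E m (tri E p' q')) (pb2 E m (tri E p' q'))\<rparr>"
    by (simp add: tri_arr_def Let_def ends \<pi>_def ev_def m_def Y_def S_def tri_dir_def
        tri_dir1_def tri_dir2_def tri_at_def)
  have pq: "p \<in> Arr E" "p' \<in> Arr E" "q \<in> Arr E" "q' \<in> Arr E"
    using Poly_arr(1,2)[OF assms(1)] Poly_arr(1,2)[OF assms(2)] ends by simp_all
  have so: "sharp_over E \<phi> \<pi> \<in> Arr E" "Dom E (sharp_over E \<phi> \<pi>) = Dom E (pb1 E (pos \<phi> \<cdot> \<pi>) p')"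
    "Cod E (sharp_over E \<phi> \<pi>) = Dom E (pb1 E \<pi> p)"
    "\<lbrakk>s \<in> Arr E; y \<in> Arr E; Dom E y = Dom E s; Cod E s = Dom E \<pi>; Cod E y = Dom E p';
      p' \<cdot> y = pos \<phi> \<cdot> \<pi> \<cdot> s\<rbrakk> \<Longrightarrow>
      sharp_over E \<phi> \<pi> \<cdot> pb_pair E (pos \<phi> \<cdot> \<pi>) p' s y = pb_pair E \<pi> p s (sharp_at E \<phi> (\<pi> \<cdot> s) y)"
    for s y
    using sharp_over(1-3)[OF assms(1), of \<pi>] sharp_over(4)[OF assms(1), of \<pi> s y] pq ends
    by (simp_all add: \<pi>_def)
  have m: "m \<in> Arr E" "Dom E m = Dom E \<pi>" "Cod E m = Dom E (tri_pos E p' q')"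
    "s \<in> Arr E \<Longrightarrow> Cod E s = Dom E \<pi> \<Longrightarrow> tri_pos E p' q' \<cdot> m \<cdot> s = pos \<phi> \<cdot> \<pi> \<cdot> s"
    "\<lbrakk>s \<in> Arr E; y \<in> Arr E; Dom E y = Dom E s; Cod E s = Dom E \<pi>; Cod E y = Dom E p';
      p' \<cdot> y = pos \<phi> \<cdot> \<pi> \<cdot> s\<rbrakk> \<Longrightarrow>
      tri_at p' q' (m \<cdot> s) y = pos \<psi> \<cdot> tri_at p q s (sharp_at E \<phi> (\<pi> \<cdot> s) y)" for s y
    using assms pq so unfolding m_def \<pi>_def ev_def by (simp_all add: tri_at_def[of p q])
  have Y: "Y t d \<in> Arr E" "Dom E (Y t d) = Dom E t" "Cod E (Y t d) = Dom E p" "p \<cdot> Y t d = \<pi> \<cdot> t"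
    and S: "S t d \<in> Arr E" "Dom E (S t d) = Dom E t" "Cod E (S t d) = Dom E (tri E p q)"
      "tri E p q \<cdot> S t d = t"
    and S_nat: "s \<in> Arr E \<Longrightarrow> Cod E s = Dom E t \<Longrightarrow> S t d \<cdot> s = S (t \<cdot> s) (d \<cdot> s)"
    if td: "t \<in> Arr E" "d \<in> Arr E" "Dom E d = Dom E t" "Cod E t = Dom E \<pi>"
      "Cod E d = Dom E (tri E p' q')" "tri E p' q' \<cdot> d = m \<cdot> t" for t d s
  proof -
    have d: "p' \<cdot> tri_dir1 p' q' d = pos \<phi> \<cdot> \<pi> \<cdot> t"
      "q' \<cdot> tri_dir2 p' q' d = tri_at p' q' (m \<cdot> t) (tri_dir1 p' q' d)"
      using pq td m by simp_all
    show Y: "Y t d \<in> Arr E" "Dom E (Y t d) = Dom E t" "Cod E (Y t d) = Dom E p" "p \<cdot> Y t d = \<pi> \<cdot> t"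
      using assms pq td m d by (simp_all add: Y_def \<pi>_def)
    have z: "q' \<cdot> tri_dir2 p' q' d = pos \<psi> \<cdot> tri_at p q t (Y t d)"
      using assms pq td m d by (simp add: Y_def)
    have at: "tri_at p q t (Y t d) \<in> Arr E" "Dom E (tri_at p q t (Y t d)) = Dom E t"
      "Cod E (tri_at p q t (Y t d)) = Cod E q"
      using pq td Y by (simp_all add: \<pi>_def)
    show S: "S t d \<in> Arr E" "Dom E (S t d) = Dom E t" "Cod E (S t d) = Dom E (tri E p q)"
      "tri E p q \<cdot> S t d = t"
      using assms pq td m z Y at by (simp_all add: S_def \<pi>_def)
    show "S t d \<cdot> s = S (t \<cdot> s) (d \<cdot> s)" if s: "s \<in> Arr E" "Cod E s = Dom E t"
    proof -
      have "Y t d \<cdot> s = Y (t \<cdot> s) (d \<cdot> s)"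
        using assms pq td m d s by (simp add: Y_def \<pi>_def)
      then show ?thesis
        using assms pq td m z Y at s by (simp add: S_def \<pi>_def)
    qed
  qed
  have sq: "tri E p' q' \<cdot> pb2 E m (tri E p' q') = m \<cdot> pb1 E m (tri E p' q')"
    using pq m by simp
  show "tri_arr E \<phi> \<psi> \<in> Arr (Poly E)"
    unfolding eq Poly_arr_iff using pq m sq S[of "pb1 E m (tri E p' q')" "pb2 E m (tri E p' q')"]
    by (simp add: \<pi>_def)
  show "src (tri_arr E \<phi> \<psi>) = tri E p q" "tgt (tri_arr E \<phi> \<psi>) = tri E p' q'"
    by (simp_all add: eq)
  show "\<lbrakk>t \<in> Arr E; Cod E t = Dom E (tri_pos E p q)\<rbrakk> \<Longrightarrow>
      tri_pos E p' q' \<cdot> pos (tri_arr E \<phi> \<psi>) \<cdot> t = pos \<phi> \<cdot> tri_pos E p q \<cdot> t"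
    using m(4)[of t] by (simp add: eq \<pi>_def)
  \<comment> \<open>The rule without a stage is the rule at the identity stage.\<close>
  show "tri_pos E p' q' \<cdot> pos (tri_arr E \<phi> \<psi>) = pos \<phi> \<cdot> tri_pos E p q"
    using m(1-3) m(4)[of "Id E (Dom E m)"] pq assms by (simp add: eq \<pi>_def)
  show "\<lbrakk>t \<in> Arr E; Cod E t = Dom E (tri_pos E p q); y \<in> Arr E; Dom E y = Dom E t;
      Cod E y = Dom E p'; p' \<cdot> y = pos \<phi> \<cdot> tri_pos E p q \<cdot> t\<rbrakk> \<Longrightarrow>
      tri_at p' q' (pos (tri_arr E \<phi> \<psi>) \<cdot> t) y =
      pos \<psi> \<cdot> tri_at p q t (sharp_at E \<phi> (tri_pos E p q \<cdot> t) y)"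
    using m(5)[of t y] by (simp add: eq \<pi>_def)
  show "sharp_at E (tri_arr E \<phi> \<psi>) t d =
      tri_dir p q t y (sharp_at E \<psi> (tri_at p q t y) (tri_dir2 p' q' d))"
    if "t \<in> Arr E" "Cod E t = Dom E (tri_pos E p q)" "d \<in> Arr E" "Dom E d = Dom E t"
      "Cod E d = Dom E (tri E p' q')" "tri E p' q' \<cdot> d = pos (tri_arr E \<phi> \<psi>) \<cdot> t"
      "y = sharp_at E \<phi> (tri_pos E p q \<cdot> t) (tri_dir1 p' q' d)"
  proof -
    have "sharp_at E (tri_arr E \<phi> \<psi>) t d = S t d"
      using that pq m sq S_nat[of "pb1 E m (tri E p' q')" "pb2 E m (tri E p' q')" "pb_pair E m (tri E p' q') t d"]
      by (simp add: sharp_at_def eq \<pi>_def)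
    then show ?thesis
      using that by (simp add: S_def Y_def \<pi>_def)
  qed
qed

text \<open>\<open>tri_arr_sharp\<close> has a variable \<open>y\<close> with an equation, for calls
  with an abbreviation. As a rewrite rule it needs \<open>y\<close> replaced by its value, hence the
  \<open>refl\<close>.\<close>

lemmas tri_arr_simps [simp] = tri_arr_arr tri_arr_ends tri_arr_pos tri_arr_pos' tri_arr_at
  tri_arr_sharp[OF _ _ _ _ _ _ _ _ _ _ _ _ refl]

text \<open>The direction map is a single \<open>coc_elem\<close> at the universal pair
  \<open>(i0, k0)\<close>. Its rules for \<open>coc_j\<close> and \<open>coc_ev\<close>, pulled back
  along the pair \<open>(i, k)\<close>, are the two formulas.\<close>

lemma coc_arr_props:
  assumes "\<psi> \<in> Arr (Poly E)" "\<phi> \<in> Arr (Poly E)"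
    and ends: "src \<phi> = p" "tgt \<phi> = p'" "src \<psi> = q" "tgt \<psi> = q'"
  shows coc_arr_arr: "coc_arr E \<psi> \<phi> \<in> Arr (Poly E)"
    and coc_arr_ends: "src (coc_arr E \<psi> \<phi>) = coc E q' p" "tgt (coc_arr E \<psi> \<phi>) = coc E q p'"
      "pos (coc_arr E \<psi> \<phi>) = pos \<phi>"
    and coc_arr_j: "\<lbrakk>i \<in> Arr E; Cod E i = Cod E p; k \<in> Arr E; Dom E k = Dom E i;
      Cod E k = Dom E (coc E q p'); coc E q p' \<cdot> k = pos \<phi> \<cdot> i\<rbrakk> \<Longrightarrow>
      coc_j E q' p \<cdot> sharp_at E (coc_arr E \<psi> \<phi>) i k = pos \<psi> \<cdot> coc_j E q p' \<cdot> k"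
    and coc_arr_ev: "\<lbrakk>i \<in> Arr E; Cod E i = Cod E p; k \<in> Arr E; Dom E k = Dom E i;
      Cod E k = Dom E (coc E q p'); coc E q p' \<cdot> k = pos \<phi> \<cdot> i; z \<in> Arr E; Dom E z = Dom E i;
      Cod E z = Dom E q'; q' \<cdot> z = pos \<psi> \<cdot> coc_j E q p' \<cdot> k\<rbrakk> \<Longrightarrow>
      coc_ev E q' p (sharp_at E (coc_arr E \<psi> \<phi>) i k) z =
      sharp_at E \<phi> i (coc_ev E q p' k (sharp_at E \<psi> (coc_j E q p' \<cdot> k) z))"
proof -
  have pq: "p \<in> Arr E" "p' \<in> Arr E" "q \<in> Arr E" "q' \<in> Arr E"
    using Poly_arr(1,2)[OF assms(1)] Poly_arr(1,2)[OF assms(2)] ends by simp_all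
  define i0 k0 where "i0 = pb1 E (pos \<phi>) (coc E q p')" and "k0 = pb2 E (pos \<phi>) (coc E q p')"
  define j0 where "j0 = coc_j E q p' \<cdot> k0"
  define s0 z0 where "s0 = pb1 E (pos \<psi> \<cdot> j0) q'" and "z0 = pb2 E (pos \<psi> \<cdot> j0) q'"
  define g where "g = sharp_at E \<phi> (i0 \<cdot> s0) (coc_ev E q p' (k0 \<cdot> s0) (sharp_at E \<psi> (j0 \<cdot> s0) z0))"
  define S where "S = coc_elem E q' p i0 (pos \<psi> \<cdot> j0) g"
  have eq: "coc_arr E \<psi> \<phi> = \<lparr>src = coc E q' p, tgt = coc E q p', pos = pos \<phi>, sharp = S\<rparr>"
    by (simp add: coc_arr_def Let_def ends i0_def k0_def j0_def s0_def z0_def g_def S_def)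
  have ik: "i0 \<in> Arr E" "k0 \<in> Arr E" "Dom E k0 = Dom E i0" "Cod E i0 = Cod E p"
    "Cod E k0 = Dom E (coc E q p')" "coc E q p' \<cdot> k0 = pos \<phi> \<cdot> i0"
    and iks: "s \<in> Arr E \<Longrightarrow> Cod E s = Dom E i0 \<Longrightarrow> coc E q p' \<cdot> k0 \<cdot> s = pos \<phi> \<cdot> i0 \<cdot> s" for s
    using pq assms by (simp_all add: i0_def k0_def)
  have j: "j0 \<in> Arr E" "Dom E j0 = Dom E i0" "Cod E j0 = Cod E q"
    and js: "s \<in> Arr E \<Longrightarrow> Cod E s = Dom E i0 \<Longrightarrow> coc_j E q p' \<cdot> k0 \<cdot> s = j0 \<cdot> s" for s
    using pq ik by (simp_all add: j0_def)
  have sz: "s0 \<in> Arr E" "z0 \<in> Arr E" "Dom E z0 = Dom E s0" "Cod E s0 = Dom E i0"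
    "Cod E z0 = Dom E q'" "q' \<cdot> z0 = pos \<psi> \<cdot> j0 \<cdot> s0"
    using pq j ik assms by (simp_all add: s0_def z0_def)
  \<comment> \<open>The typing of \<open>g\<close> is settled with \<open>s0\<close> and
    \<open>z0\<close> folded; they are unfolded afterwards, so that pairing with
    \<open>(s, z)\<close> evaluates them.\<close>
  have g: "g \<in> Arr E" "Dom E g = Dom E s0" "Cod E g = Dom E p" "p \<cdot> g = i0 \<cdot> s0"
    and gs: "\<lbrakk>s \<in> Arr E; z \<in> Arr E; Dom E z = Dom E s; Cod E s = Dom E i0; Cod E z = Dom E q';
      q' \<cdot> z = pos \<psi> \<cdot> j0 \<cdot> s\<rbrakk> \<Longrightarrow> g \<cdot> pb_pair E (pos \<psi> \<cdot> j0) q' s z =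
      sharp_at E \<phi> (i0 \<cdot> s) (coc_ev E q p' (k0 \<cdot> s) (sharp_at E \<psi> (j0 \<cdot> s) z))" for s z
    using pq ik iks j js sz assms by (simp_all add: g_def) (simp_all add: s0_def z0_def)
  have S: "S \<in> Arr E" "Dom E S = Dom E i0" "Cod E S = Dom E (coc E q' p)" "coc E q' p \<cdot> S = i0"
    "s \<in> Arr E \<Longrightarrow> Cod E s = Dom E i0 \<Longrightarrow> coc_j E q' p \<cdot> S \<cdot> s = pos \<psi> \<cdot> j0 \<cdot> s"
    "\<lbrakk>s \<in> Arr E; z \<in> Arr E; Dom E z = Dom E s; Cod E s = Dom E i0; Cod E z = Dom E q';
      q' \<cdot> z = pos \<psi> \<cdot> j0 \<cdot> s\<rbrakk> \<Longrightarrow> coc_ev E q' p (S \<cdot> s) z =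
      sharp_at E \<phi> (i0 \<cdot> s) (coc_ev E q p' (k0 \<cdot> s) (sharp_at E \<psi> (j0 \<cdot> s) z))" for s z
    using pq ik j sz g gs assms unfolding S_def s0_def by simp_all
  show "coc_arr E \<psi> \<phi> \<in> Arr (Poly E)"
    unfolding eq Poly_arr_iff using pq S ik assms(1,2) ends by (simp add: i0_def)
  show "src (coc_arr E \<psi> \<phi>) = coc E q' p" "tgt (coc_arr E \<psi> \<phi>) = coc E q p'"
      "pos (coc_arr E \<psi> \<phi>) = pos \<phi>"
    by (simp_all add: eq)
  have at: "sharp_at E (coc_arr E \<psi> \<phi>) i k = S \<cdot> pb_pair E (pos \<phi>) (coc E q p') i k" for i k
    by (simp add: sharp_at_def eq)
  have w: "pb_pair E (pos \<phi>) (coc E q p') i k \<in> Arr E"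
    "Dom E (pb_pair E (pos \<phi>) (coc E q p') i k) = Dom E i"
    "Cod E (pb_pair E (pos \<phi>) (coc E q p') i k) = Dom E i0"
    "i0 \<cdot> pb_pair E (pos \<phi>) (coc E q p') i k = i"
    "k0 \<cdot> pb_pair E (pos \<phi>) (coc E q p') i k = k"
    "j0 \<cdot> pb_pair E (pos \<phi>) (coc E q p') i k = coc_j E q p' \<cdot> k"
    if "i \<in> Arr E" "Cod E i = Cod E p" "k \<in> Arr E" "Dom E k = Dom E i"
      "Cod E k = Dom E (coc E q p')" "coc E q p' \<cdot> k = pos \<phi> \<cdot> i" for i k
    using that pq assms unfolding i0_def k0_def j0_def by simp_all
  show "\<lbrakk>i \<in> Arr E; Cod E i = Cod E p; k \<in> Arr E; Dom E k = Dom E i;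
      Cod E k = Dom E (coc E q p'); coc E q p' \<cdot> k = pos \<phi> \<cdot> i\<rbrakk> \<Longrightarrow>
      coc_j E q' p \<cdot> sharp_at E (coc_arr E \<psi> \<phi>) i k = pos \<psi> \<cdot> coc_j E q p' \<cdot> k"
    using S(5) w by (simp add: at)
  show "\<lbrakk>i \<in> Arr E; Cod E i = Cod E p; k \<in> Arr E; Dom E k = Dom E i;
      Cod E k = Dom E (coc E q p'); coc E q p' \<cdot> k = pos \<phi> \<cdot> i; z \<in> Arr E; Dom E z = Dom E i;
      Cod E z = Dom E q'; q' \<cdot> z = pos \<psi> \<cdot> coc_j E q p' \<cdot> k\<rbrakk> \<Longrightarrow>
      coc_ev E q' p (sharp_at E (coc_arr E \<psi> \<phi>) i k) z =
      sharp_at E \<phi> i (coc_ev E q p' k (sharp_at E \<psi> (coc_j E q p' \<cdot> k) z))"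
    using S(6)[of "pb_pair E (pos \<phi>) (coc E q p') i k" z] w by (simp add: at)
qed

lemmas coc_arr_simps [simp] = coc_arr_props

section \<open>Functoriality of both operations\<close>

sublocale Poly: is_category "Poly E"
  by (rule Poly_category)

lemma tri_arr_Id:
  assumes "p \<in> Arr E" "q \<in> Arr E"
  shows "tri_arr E (Id (Poly E) p) (Id (Poly E) q) = Id (Poly E) (tri E p q)"
proof -
  let ?\<alpha> = "tri_arr E (Id (Poly E) p) (Id (Poly E) q)"
  have pos: "pos ?\<alpha> = Id E (Cod E (tri E p q))"
    by (rule tri_pos_ext[of p q]) (use assms in simp_all)
  show ?thesis
    by (rule Poly_eqI) (use assms pos in simp_all)
qed

text \<open>Positions agree by \<open>tri_pos_ext\<close>. For directions, both sides carry
  \<open>(y'', z'')\<close> back to the same pair, because \<open>sharp_at\<close> of a composite is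
  nested application in each component. The second component depends on the first through the
  position of \<open>q\<close>, so the intermediate elements are named and typed one at a
  time.\<close>

lemma tri_arr_Comp:
  assumes \<phi>: "\<phi> \<in> Arr (Poly E)" "\<phi>' \<in> Arr (Poly E)" "src \<phi>' = tgt \<phi>"
    and \<psi>: "\<psi> \<in> Arr (Poly E)" "\<psi>' \<in> Arr (Poly E)" "src \<psi>' = tgt \<psi>"
  shows "tri_arr E (Comp (Poly E) \<phi>' \<phi>) (Comp (Poly E) \<psi>' \<psi>) =
    Comp (Poly E) (tri_arr E \<phi>' \<psi>') (tri_arr E \<phi> \<psi>)"
proof -
  let ?\<alpha> = "tri_arr E \<phi> \<psi>" and ?\<beta> = "tri_arr E \<phi>' \<psi>'"
  let ?\<gamma> = "tri_arr E (Comp (Poly E) \<phi>' \<phi>) (Comp (Poly E) \<psi>' \<psi>)"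
  have pos: "pos ?\<gamma> = pos ?\<beta> \<cdot> pos ?\<alpha>"
    by (rule tri_pos_ext[of "tgt \<phi>'" "tgt \<psi>'"]) (use assms in simp_all)
  show ?thesis
  proof (rule Poly_eqI, goal_cases)
    case (6 t d)
    define p q p' q' p'' q'' where pq: "p = src \<phi>" "q = src \<psi>" "p' = tgt \<phi>" "q' = tgt \<psi>"
      "p'' = tgt \<phi>'" "q'' = tgt \<psi>'"
    note pq_arr = Poly_arr[OF \<phi>(1), folded pq] Poly_arr[OF \<phi>(2), unfolded \<phi>(3), folded pq]
      Poly_arr[OF \<psi>(1), folded pq] Poly_arr[OF \<psi>(2), unfolded \<psi>(3), folded pq]
    have t: "t \<in> Arr E" "d \<in> Arr E" "Dom E d = Dom E t" "Cod E t = Dom E (tri_pos E p q)"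
      "Cod E d = Dom E (tri E p'' q'')" "tri E p'' q'' \<cdot> d = pos ?\<beta> \<cdot> pos ?\<alpha> \<cdot> t"
      using 6 assms pos pq_arr by (simp_all add: pq)
    define x a where "x = tri_pos E p q \<cdot> t" and "a = pos ?\<alpha> \<cdot> t"
    have x: "x \<in> Arr E" "Dom E x = Dom E t" "Cod E x = Cod E p"
      using t pq_arr by (simp_all add: x_def)
    have a: "a \<in> Arr E" "Dom E a = Dom E t" "Cod E a = Dom E (tri_pos E p' q')"
      "tri_pos E p' q' \<cdot> a = pos \<phi> \<cdot> x" "tri E p'' q'' \<cdot> d = pos ?\<beta> \<cdot> a"
      using assms t pq_arr by (simp_all add: a_def x_def pq)
    define y'' z'' where "y'' = tri_dir1 p'' q'' d" and "z'' = tri_dir2 p'' q'' d"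
    define y' where "y' = sharp_at E \<phi>' (pos \<phi> \<cdot> x) y''"
    define y where "y = sharp_at E \<phi> x y'"
    have y'': "y'' \<in> Arr E" "Dom E y'' = Dom E t" "Cod E y'' = Dom E p''"
      "p'' \<cdot> y'' = pos \<phi>' \<cdot> pos \<phi> \<cdot> x"
      using assms t a pq_arr by (simp_all add: y''_def pq)
    have y': "y' \<in> Arr E" "Dom E y' = Dom E t" "Cod E y' = Dom E p'" "p' \<cdot> y' = pos \<phi> \<cdot> x"
      using assms y'' x by (simp_all add: y'_def pq)
    have y: "y \<in> Arr E" "Dom E y = Dom E t" "Cod E y = Dom E p" "p \<cdot> y = x"
      using assms y' x by (simp_all add: y_def pq)
    define b where "b = tri_at p q t y"
    have b: "b \<in> Arr E" "Dom E b = Dom E t" "Cod E b = Cod E q" "tri_at p' q' a y' = pos \<psi> \<cdot> b"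
      using assms t y y' pq_arr by (simp_all add: a_def b_def y_def x_def pq)
    have z'': "z'' \<in> Arr E" "Dom E z'' = Dom E t" "Cod E z'' = Dom E q''"
      "q'' \<cdot> z'' = pos \<psi>' \<cdot> pos \<psi> \<cdot> b"
      using assms t a y'' pq_arr b(4)
      by (simp_all add: y''_def z''_def pq y'_def)
    define z' where "z' = sharp_at E \<psi>' (pos \<psi> \<cdot> b) z''"
    have z': "z' \<in> Arr E" "Dom E z' = Dom E t" "Cod E z' = Dom E q'" "q' \<cdot> z' = pos \<psi> \<cdot> b"
      using assms z'' b by (simp_all add: z'_def pq)
    \<comment> \<open>The intermediate direction of \<open>p' \<triangleleft> q'\<close> at
      \<open>a\<close>, through which the composite on the right-hand side factors.\<close>
    define D where "D = tri_dir p' q' a y' z'"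
    have D: "D \<in> Arr E" "Dom E D = Dom E t" "Cod E D = Dom E (tri E p' q')" "tri E p' q' \<cdot> D = a"
      "tri_dir1 p' q' D = y'" "tri_dir2 p' q' D = z'"
      using a y' z' b pq_arr by (simp_all add: D_def)
    have "sharp_at E ?\<beta> a d = tri_dir p' q' a y' (sharp_at E \<psi>' (tri_at p' q' a y') z'')"
      unfolding z''_def
      by (rule tri_arr_sharp) (use assms t a in \<open>simp_all add: pq y'_def y''_def\<close>)
    then have \<beta>: "sharp_at E ?\<beta> a d = D"
      by (simp add: D_def z'_def b)
    have "sharp_at E ?\<alpha> t D = tri_dir p q t y (sharp_at E \<psi> (tri_at p q t y) (tri_dir2 p' q' D))"
      by (rule tri_arr_sharp) (use assms t D in \<open>simp_all add: pq y_def x_def a_def\<close>)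
    then have "sharp_at E ?\<alpha> t D = tri_dir p q t y (sharp_at E \<psi> b z')"
      by (simp add: D b_def)
    moreover have "sharp_at E (Comp (Poly E) ?\<beta> ?\<alpha>) t d = sharp_at E ?\<alpha> t (sharp_at E ?\<beta> a d)"
      unfolding a_def by (rule Comp_Poly(5)) (use assms t in \<open>simp_all add: pq\<close>)
    ultimately have "sharp_at E (Comp (Poly E) ?\<beta> ?\<alpha>) t d = tri_dir p q t y (sharp_at E \<psi> b z')"
      by (simp add: \<beta>)
    moreover have "sharp_at E (Comp (Poly E) \<phi>' \<phi>) x y'' = y"
      using assms x y'' by (simp add: y_def y'_def pq)
    moreover have "sharp_at E (Comp (Poly E) \<psi>' \<psi>) b z'' = sharp_at E \<psi> b z'"
      using assms b z'' by (simp add: z'_def pq)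
    moreover have "sharp_at E ?\<gamma> t d =
        tri_dir p q t (sharp_at E (Comp (Poly E) \<phi>' \<phi>) x y'')
          (sharp_at E (Comp (Poly E) \<psi>' \<psi>)
            (tri_at p q t (sharp_at E (Comp (Poly E) \<phi>' \<phi>) x y'')) z'')"
      unfolding x_def y''_def z''_def
      by (rule tri_arr_sharp) (use assms t pos in \<open>simp_all add: pq\<close>)
    ultimately show ?case
      by (simp add: b_def)
  qed (use assms pos in simp_all)
qed

lemma coc_arr_Id:
  assumes "p \<in> Arr E" "q \<in> Arr E"
  shows "coc_arr E (Id (Poly E) q) (Id (Poly E) p) = Id (Poly E) (coc E q p)"
proof (rule Poly_eqI, goal_cases)
  case (6 i k)
  show ?case
    by (rule coc_ext[of p q]) (use assms 6 comp_reassoc[OF 6(6)] in simp_all)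
qed (use assms in simp_all)

text \<open>By \<open>coc_ext\<close> it is enough to compare the position of \<open>q''\<close> and
  the evaluation at \<open>z\<close>. On both sides the evaluation is \<open>\<phi>\<^sup>\<sharp>
  \<circ> \<phi>'\<^sup>\<sharp> \<circ> g \<circ> \<psi>\<^sup>\<sharp> \<circ>
  \<psi>'\<^sup>\<sharp>\<close>, each factor taken at the position it requires.\<close>

lemma coc_arr_Comp:
  assumes "\<phi> \<in> Arr (Poly E)" "\<phi>' \<in> Arr (Poly E)" "\<psi> \<in> Arr (Poly E)" "\<psi>' \<in> Arr (Poly E)"
    and "src \<phi>' = tgt \<phi>" "src \<psi>' = tgt \<psi>"
  shows "coc_arr E (Comp (Poly E) \<psi>' \<psi>) (Comp (Poly E) \<phi>' \<phi>) =
    Comp (Poly E) (coc_arr E \<psi> \<phi>') (coc_arr E \<psi>' \<phi>)"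
proof (rule Poly_eqI, goal_cases)
  case (6 i k)
  show ?case
    by (rule coc_ext[of "src \<phi>" "tgt \<psi>'"]) (use assms 6 comp_reassoc[OF 6(6)] in simp_all)
qed (use assms in simp_all)

section \<open>The adjunction\<close>

text \<open>The adjunct \<open>p \<rightarrow> r \<triangleleft> q\<close> of \<open>u\<close>, from \<open>coc q p\<close> to \<open>r\<close>, sends a position \<open>i\<close> to
  \<open>(u\<^sub>1 i, j)\<close> and a direction \<open>(y, z)\<close> there to \<open>g y z\<close>, where \<open>u\<^sup>\<sharp>(i, y) = (j y, g y)\<close>.\<close>

definition adjunct :: "'a \<Rightarrow> 'a \<Rightarrow> 'a \<Rightarrow> 'a poly_arr \<Rightarrow> 'a poly_arr" where
  "adjunct q p r u =
    (let m = tri_pos_elem E r q (pos u) (coc_j E q p \<cdot> sharp u);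
       i = pb1 E m (tri E r q); d = pb2 E m (tri E r q)
     in \<lparr>src = p, tgt = tri E r q, pos = m,
          sharp = coc_ev E q p (sharp_at E u i (tri_dir1 r q d)) (tri_dir2 r q d)\<rparr>)"

text \<open>The inverse construction. At \<open>(i, y)\<close> the direction of the coclosure is
  \<open>(j, g)\<close>, where \<open>j\<close> is the value at \<open>y\<close> of the position
  \<open>v\<^sub>1 i\<close> and \<open>g z = v\<^sup>\<sharp>(i, (y, z))\<close>;
  \<open>coc_elem\<close> performs the abstraction over \<open>z\<close>.\<close>

definition coadjunct :: "'a \<Rightarrow> 'a \<Rightarrow> 'a \<Rightarrow> 'a poly_arr \<Rightarrow> 'a poly_arr" where
  "coadjunct q p r v =
    (let m = tri_pos E r q \<cdot> pos v;
       i = pb1 E m r; y = pb2 E m r; j = tri_at r q (pos v \<cdot> i) y;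
       s = pb1 E j q; z = pb2 E j q
     in \<lparr>src = coc E q p, tgt = r, pos = m,
          sharp = coc_elem E q p i j
            (sharp_at E v (i \<cdot> s) (tri_dir r q (pos v \<cdot> i \<cdot> s) (y \<cdot> s) z))\<rparr>)"

lemma adjunct_props:
  assumes pq: "p \<in> Arr E" "q \<in> Arr E" and u: "u \<in> Arr (Poly E)" "src u = coc E q p" "tgt u = r"
  shows adjunct_arr: "adjunct q p r u \<in> Arr (Poly E)"
    and adjunct_ends: "src (adjunct q p r u) = p" "tgt (adjunct q p r u) = tri E r q"
    and adjunct_pos: "tri_pos E r q \<cdot> pos (adjunct q p r u) = pos u"
      "\<lbrakk>i \<in> Arr E; Cod E i = Cod E p\<rbrakk> \<Longrightarrow> tri_pos E r q \<cdot> pos (adjunct q p r u) \<cdot> i = pos u \<cdot> i"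
    and adjunct_at: "\<lbrakk>i \<in> Arr E; y \<in> Arr E; Dom E y = Dom E i; Cod E i = Cod E p; Cod E y = Dom E r;
      r \<cdot> y = pos u \<cdot> i\<rbrakk> \<Longrightarrow>
      tri_at r q (pos (adjunct q p r u) \<cdot> i) y = coc_j E q p \<cdot> sharp_at E u i y"
    and adjunct_sharp: "\<lbrakk>i \<in> Arr E; d \<in> Arr E; Dom E d = Dom E i; Cod E i = Cod E p;
      Cod E d = Dom E (tri E r q); tri E r q \<cdot> d = pos (adjunct q p r u) \<cdot> i\<rbrakk> \<Longrightarrow>
      sharp_at E (adjunct q p r u) i d =
      coc_ev E q p (sharp_at E u i (tri_dir1 r q d)) (tri_dir2 r q d)"
proof -
  have r: "r \<in> Arr E" "pos u \<in> Arr E" "Dom E (pos u) = Cod E p" "Cod E (pos u) = Cod E r"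
    using Poly_arr[OF u(1)] u pq by simp_all
  define m where "m = tri_pos_elem E r q (pos u) (coc_j E q p \<cdot> sharp u)"
  define S where "S i d = coc_ev E q p (sharp_at E u i (tri_dir1 r q d)) (tri_dir2 r q d)" for i d
  have eq: "adjunct q p r u = \<lparr>src = p, tgt = tri E r q, pos = m,
      sharp = S (pb1 E m (tri E r q)) (pb2 E m (tri E r q))\<rparr>"
    by (simp add: adjunct_def Let_def m_def S_def)
  note su = sharp_arr[OF u(1), unfolded u(2,3)]
  have m: "m \<in> Arr E" "Dom E m = Cod E p" "Cod E m = Dom E (tri_pos E r q)"
    "tri_pos E r q \<cdot> m = pos u"
    "i \<in> Arr E \<Longrightarrow> Cod E i = Cod E p \<Longrightarrow> tri_pos E r q \<cdot> m \<cdot> i = pos u \<cdot> i"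
    "\<lbrakk>i \<in> Arr E; y \<in> Arr E; Dom E y = Dom E i; Cod E i = Cod E p; Cod E y = Dom E r;
      r \<cdot> y = pos u \<cdot> i\<rbrakk> \<Longrightarrow> tri_at r q (m \<cdot> i) y = coc_j E q p \<cdot> sharp_at E u i y" for i y
    using pq r su u(3) unfolding m_def by (simp_all add: sharp_at_def)
  have S: "S i d \<in> Arr E" "Dom E (S i d) = Dom E i" "Cod E (S i d) = Dom E p" "p \<cdot> S i d = i"
    and S_nat: "s \<in> Arr E \<Longrightarrow> Cod E s = Dom E i \<Longrightarrow> S i d \<cdot> s = S (i \<cdot> s) (d \<cdot> s)"
    if id: "i \<in> Arr E" "d \<in> Arr E" "Dom E d = Dom E i" "Cod E i = Cod E p"
      "Cod E d = Dom E (tri E r q)" "tri E r q \<cdot> d = m \<cdot> i" for i d s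
  proof -
    have y: "tri_dir1 r q d \<in> Arr E" "Dom E (tri_dir1 r q d) = Dom E i"
      "Cod E (tri_dir1 r q d) = Dom E r" "r \<cdot> tri_dir1 r q d = pos u \<cdot> i"
      using pq r id m by simp_all
    \<comment> \<open>The second component of a direction lies over \<open>tri_at\<close>, which for
      the position \<open>m \<cdot> i\<close> is the \<open>Q\<close>-component of the direction
      given by \<open>u\<close>. This is the condition under which \<open>coc_ev\<close> may be
      applied.\<close>
    have z: "tri_dir2 r q d \<in> Arr E" "Dom E (tri_dir2 r q d) = Dom E i"
      "Cod E (tri_dir2 r q d) = Dom E q"
      "q \<cdot> tri_dir2 r q d = coc_j E q p \<cdot> sharp_at E u i (tri_dir1 r q d)"
      using pq r id m y by simp_all
    have k: "sharp_at E u i (tri_dir1 r q d) \<in> Arr E"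
      "Dom E (sharp_at E u i (tri_dir1 r q d)) = Dom E i"
      "Cod E (sharp_at E u i (tri_dir1 r q d)) = Dom E (coc E q p)"
      "coc E q p \<cdot> sharp_at E u i (tri_dir1 r q d) = i"
      using pq r id u y by simp_all
    show "S i d \<in> Arr E" "Dom E (S i d) = Dom E i" "Cod E (S i d) = Dom E p" "p \<cdot> S i d = i"
      using pq z k by (simp_all add: S_def)
    show "S i d \<cdot> s = S (i \<cdot> s) (d \<cdot> s)" if s: "s \<in> Arr E" "Cod E s = Dom E i"
    proof -
      have "sharp_at E u i (tri_dir1 r q d) \<cdot> s = sharp_at E u (i \<cdot> s) (tri_dir1 r q (d \<cdot> s))"
        "tri_dir2 r q d \<cdot> s = tri_dir2 r q (d \<cdot> s)"
        using pq r id u y s by simp_all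
      then show ?thesis
        using pq z k s by (simp add: S_def)
    qed
  qed
  have sq: "tri E r q \<cdot> pb2 E m (tri E r q) = m \<cdot> pb1 E m (tri E r q)"
    using pq r m by simp
  show "adjunct q p r u \<in> Arr (Poly E)"
    unfolding eq Poly_arr_iff
    using pq r m sq S[of "pb1 E m (tri E r q)" "pb2 E m (tri E r q)"] by simp
  show "src (adjunct q p r u) = p" "tgt (adjunct q p r u) = tri E r q"
    "tri_pos E r q \<cdot> pos (adjunct q p r u) = pos u"
    "\<lbrakk>i \<in> Arr E; Cod E i = Cod E p\<rbrakk> \<Longrightarrow> tri_pos E r q \<cdot> pos (adjunct q p r u) \<cdot> i = pos u \<cdot> i"
    "\<lbrakk>i \<in> Arr E; y \<in> Arr E; Dom E y = Dom E i; Cod E i = Cod E p; Cod E y = Dom E r;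
      r \<cdot> y = pos u \<cdot> i\<rbrakk> \<Longrightarrow>
      tri_at r q (pos (adjunct q p r u) \<cdot> i) y = coc_j E q p \<cdot> sharp_at E u i y"
    using m by (simp_all add: eq)
  show "sharp_at E (adjunct q p r u) i d =
      coc_ev E q p (sharp_at E u i (tri_dir1 r q d)) (tri_dir2 r q d)"
    if "i \<in> Arr E" "d \<in> Arr E" "Dom E d = Dom E i" "Cod E i = Cod E p"
      "Cod E d = Dom E (tri E r q)" "tri E r q \<cdot> d = pos (adjunct q p r u) \<cdot> i"
  proof -
    have "sharp_at E (adjunct q p r u) i d = S i d"
      using that pq r m sq
        S_nat[of "pb1 E m (tri E r q)" "pb2 E m (tri E r q)" "pb_pair E m (tri E r q) i d"]
      by (simp add: sharp_at_def eq)
    then show ?thesis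
      by (simp add: S_def)
  qed
qed

lemma coadjunct_props:
  assumes pqr: "p \<in> Arr E" "q \<in> Arr E" "r \<in> Arr E"
    and v: "v \<in> Arr (Poly E)" "src v = p" "tgt v = tri E r q"
  shows coadjunct_arr: "coadjunct q p r v \<in> Arr (Poly E)"
    and coadjunct_ends: "src (coadjunct q p r v) = coc E q p" "tgt (coadjunct q p r v) = r"
      "pos (coadjunct q p r v) = tri_pos E r q \<cdot> pos v"
    and coadjunct_j: "\<lbrakk>i \<in> Arr E; y \<in> Arr E; Dom E y = Dom E i; Cod E i = Cod E p; Cod E y = Dom E r;
      r \<cdot> y = tri_pos E r q \<cdot> pos v \<cdot> i\<rbrakk> \<Longrightarrow>
      coc_j E q p \<cdot> sharp_at E (coadjunct q p r v) i y = tri_at r q (pos v \<cdot> i) y"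
    and coadjunct_ev: "\<lbrakk>i \<in> Arr E; y \<in> Arr E; Dom E y = Dom E i; Cod E i = Cod E p; Cod E y = Dom E r;
      r \<cdot> y = tri_pos E r q \<cdot> pos v \<cdot> i; z \<in> Arr E; Dom E z = Dom E i; Cod E z = Dom E q;
      q \<cdot> z = tri_at r q (pos v \<cdot> i) y\<rbrakk> \<Longrightarrow>
      coc_ev E q p (sharp_at E (coadjunct q p r v) i y) z =
      sharp_at E v i (tri_dir r q (pos v \<cdot> i) y z)"
proof -
  have pv: "pos v \<in> Arr E" "Dom E (pos v) = Cod E p" "Cod E (pos v) = Dom E (tri_pos E r q)"
    using Poly_arr[OF v(1)] v pqr by simp_all
  define m where "m = tri_pos E r q \<cdot> pos v"
  define i0 y0 where "i0 = pb1 E m r" and "y0 = pb2 E m r"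
  define j0 where "j0 = tri_at r q (pos v \<cdot> i0) y0"
  define s0 z0 where "s0 = pb1 E j0 q" and "z0 = pb2 E j0 q"
  define g where "g = sharp_at E v (i0 \<cdot> s0) (tri_dir r q (pos v \<cdot> i0 \<cdot> s0) (y0 \<cdot> s0) z0)"
  define S where "S = coc_elem E q p i0 j0 g"
  have eq: "coadjunct q p r v = \<lparr>src = coc E q p, tgt = r, pos = m, sharp = S\<rparr>"
    by (simp add: coadjunct_def Let_def i0_def y0_def m_def j0_def s0_def z0_def g_def S_def)
  have m: "m \<in> Arr E" "Dom E m = Cod E p" "Cod E m = Cod E r"
    using pqr pv by (simp_all add: m_def)
  have iy: "i0 \<in> Arr E" "y0 \<in> Arr E" "Dom E y0 = Dom E i0" "Cod E i0 = Cod E p"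
    "Cod E y0 = Dom E r" "r \<cdot> y0 = tri_pos E r q \<cdot> pos v \<cdot> i0"
    and iys: "s \<in> Arr E \<Longrightarrow> Cod E s = Dom E i0 \<Longrightarrow> r \<cdot> y0 \<cdot> s = tri_pos E r q \<cdot> pos v \<cdot> i0 \<cdot> s" for s
    using pqr m pv by (simp_all add: i0_def y0_def) (simp_all add: m_def)
  have j: "j0 \<in> Arr E" "Dom E j0 = Dom E i0" "Cod E j0 = Cod E q"
    "s \<in> Arr E \<Longrightarrow> Cod E s = Dom E i0 \<Longrightarrow> j0 \<cdot> s = tri_at r q (pos v \<cdot> i0 \<cdot> s) (y0 \<cdot> s)" for s
    using pqr pv iy iys by (simp_all add: j0_def)
  have sz: "s0 \<in> Arr E" "z0 \<in> Arr E" "Dom E z0 = Dom E s0" "Cod E s0 = Dom E i0"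
    "Cod E z0 = Dom E q" "q \<cdot> z0 = j0 \<cdot> s0" "Dom E s0 = Dom E (pb1 E j0 q)"
    using pqr j(1-3) iy by (simp_all add: s0_def z0_def)
  \<comment> \<open>Since \<open>z\<close> lies over \<open>j0 \<cdot> s\<close>, the pair of
    \<open>y0 \<cdot> s\<close> and \<open>z\<close> is a direction of
    \<open>r \<triangleleft> q\<close> at the image under \<open>v\<close>, so the direction map of
    \<open>v\<close> accepts it.\<close>
  have D: "tri_dir r q (pos v \<cdot> i0 \<cdot> s) (y0 \<cdot> s) z \<in> Arr E"
    "Dom E (tri_dir r q (pos v \<cdot> i0 \<cdot> s) (y0 \<cdot> s) z) = Dom E s"
    "Cod E (tri_dir r q (pos v \<cdot> i0 \<cdot> s) (y0 \<cdot> s) z) = Dom E (tri E r q)"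
    "tri E r q \<cdot> tri_dir r q (pos v \<cdot> i0 \<cdot> s) (y0 \<cdot> s) z = pos v \<cdot> i0 \<cdot> s"
    "h \<in> Arr E \<Longrightarrow> Cod E h = Dom E s \<Longrightarrow> tri_dir r q (pos v \<cdot> i0 \<cdot> s) (y0 \<cdot> s) z \<cdot> h =
      tri_dir r q (pos v \<cdot> i0 \<cdot> s \<cdot> h) (y0 \<cdot> s \<cdot> h) (z \<cdot> h)"
    if "s \<in> Arr E" "z \<in> Arr E" "Dom E z = Dom E s" "Cod E s = Dom E i0" "Cod E z = Dom E q"
      "q \<cdot> z = j0 \<cdot> s" for s z h
  proof -
    have t: "pos v \<cdot> i0 \<cdot> s \<in> Arr E" "y0 \<cdot> s \<in> Arr E" "Dom E (y0 \<cdot> s) = Dom E (pos v \<cdot> i0 \<cdot> s)"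
      "Dom E (pos v \<cdot> i0 \<cdot> s) = Dom E s" "Cod E (pos v \<cdot> i0 \<cdot> s) = Dom E (tri_pos E r q)"
      "Cod E (y0 \<cdot> s) = Dom E r" "r \<cdot> y0 \<cdot> s = tri_pos E r q \<cdot> pos v \<cdot> i0 \<cdot> s"
      using that(1,4) pv iy(1-5) iys by simp_all
    have "q \<cdot> z = tri_at r q (pos v \<cdot> i0 \<cdot> s) (y0 \<cdot> s)" "Dom E z = Dom E (pos v \<cdot> i0 \<cdot> s)"
      using that j(4) t(4) by simp_all
    note * = tri_dir[OF pqr(3,2) t(1,2) that(2) t(3) this(2) t(5,6) that(5) t(7) this(1)]
    show "tri_dir r q (pos v \<cdot> i0 \<cdot> s) (y0 \<cdot> s) z \<in> Arr E"
      "Dom E (tri_dir r q (pos v \<cdot> i0 \<cdot> s) (y0 \<cdot> s) z) = Dom E s"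
      "Cod E (tri_dir r q (pos v \<cdot> i0 \<cdot> s) (y0 \<cdot> s) z) = Dom E (tri E r q)"
      "tri E r q \<cdot> tri_dir r q (pos v \<cdot> i0 \<cdot> s) (y0 \<cdot> s) z = pos v \<cdot> i0 \<cdot> s"
      using *(1-4) t(4) by simp_all
    show "h \<in> Arr E \<Longrightarrow> Cod E h = Dom E s \<Longrightarrow> tri_dir r q (pos v \<cdot> i0 \<cdot> s) (y0 \<cdot> s) z \<cdot> h =
        tri_dir r q (pos v \<cdot> i0 \<cdot> s \<cdot> h) (y0 \<cdot> s \<cdot> h) (z \<cdot> h)"
      using *(7)[of h] that(1,4) t(4) pv iy(1-5) by simp
  qed
  \<comment> \<open>Folding the universal direction lets the rules for \<open>sharp_at\<close> see
    only its typing facts.\<close>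
  define d0 where "d0 = tri_dir r q (pos v \<cdot> i0 \<cdot> s0) (y0 \<cdot> s0) z0"
  note D0 = D[OF sz(1-6), folded d0_def]
  have vd0: "tgt v \<cdot> d0 = pos v \<cdot> i0 \<cdot> s0"
    by (simp add: D0 v)
  have g: "g \<in> Arr E" "Dom E g = Dom E s0" "Cod E g = Dom E p" "p \<cdot> g = i0 \<cdot> s0"
    "h \<in> Arr E \<Longrightarrow> Cod E h = Dom E s0 \<Longrightarrow> g \<cdot> h =
      sharp_at E v (i0 \<cdot> s0 \<cdot> h) (tri_dir r q (pos v \<cdot> i0 \<cdot> s0 \<cdot> h) (y0 \<cdot> s0 \<cdot> h) (z0 \<cdot> h))" for h
    using pqr v iy(1-5) sz(1-4) D0 vd0
    unfolding g_def d0_def[symmetric] by simp_all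
  have gs: "g \<cdot> pb_pair E j0 q s z =
      sharp_at E v (i0 \<cdot> s) (tri_dir r q (pos v \<cdot> i0 \<cdot> s) (y0 \<cdot> s) z)"
    if "s \<in> Arr E" "z \<in> Arr E" "Dom E z = Dom E s" "Cod E s = Dom E i0" "Cod E z = Dom E q"
      "q \<cdot> z = j0 \<cdot> s" for s z
  proof -
    have "s0 \<cdot> pb_pair E j0 q s z = s" "z0 \<cdot> pb_pair E j0 q s z = z"
      "pb_pair E j0 q s z \<in> Arr E" "Cod E (pb_pair E j0 q s z) = Dom E s0"
      unfolding s0_def z0_def using that pqr j(1-3) by simp_all
    then show ?thesis
      using g(5) by simp
  qed
  have S: "S \<in> Arr E" "Dom E S = Dom E i0" "Cod E S = Dom E (coc E q p)" "coc E q p \<cdot> S = i0"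
    "s \<in> Arr E \<Longrightarrow> Cod E s = Dom E i0 \<Longrightarrow> coc_j E q p \<cdot> S \<cdot> s = j0 \<cdot> s"
    "\<lbrakk>s \<in> Arr E; z \<in> Arr E; Dom E z = Dom E s; Cod E s = Dom E i0; Cod E z = Dom E q;
      q \<cdot> z = j0 \<cdot> s\<rbrakk> \<Longrightarrow> coc_ev E q p (S \<cdot> s) z =
      sharp_at E v (i0 \<cdot> s) (tri_dir r q (pos v \<cdot> i0 \<cdot> s) (y0 \<cdot> s) z)" for s z
    using pqr iy j(1-3) sz(7) g(1-4) gs unfolding S_def s0_def by simp_all
  show "coadjunct q p r v \<in> Arr (Poly E)"
    unfolding eq Poly_arr_iff using pqr m S(1-4) iy by (simp add: i0_def)
  show "src (coadjunct q p r v) = coc E q p" "tgt (coadjunct q p r v) = r"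
      "pos (coadjunct q p r v) = tri_pos E r q \<cdot> pos v"
    by (simp_all add: eq m_def)
  have at: "sharp_at E (coadjunct q p r v) i y = S \<cdot> pb_pair E m r i y" for i y
    by (simp add: sharp_at_def eq)
  have w: "pb_pair E m r i y \<in> Arr E" "Dom E (pb_pair E m r i y) = Dom E i"
    "Cod E (pb_pair E m r i y) = Dom E i0"
    "i0 \<cdot> pb_pair E m r i y = i" "y0 \<cdot> pb_pair E m r i y = y"
    if "i \<in> Arr E" "y \<in> Arr E" "Dom E y = Dom E i" "Cod E i = Cod E p" "Cod E y = Dom E r"
      "r \<cdot> y = tri_pos E r q \<cdot> pos v \<cdot> i" for i y
    using that pqr pv m unfolding i0_def y0_def by (simp_all add: m_def)
  show "\<lbrakk>i \<in> Arr E; y \<in> Arr E; Dom E y = Dom E i; Cod E i = Cod E p; Cod E y = Dom E r;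
      r \<cdot> y = tri_pos E r q \<cdot> pos v \<cdot> i\<rbrakk> \<Longrightarrow>
      coc_j E q p \<cdot> sharp_at E (coadjunct q p r v) i y = tri_at r q (pos v \<cdot> i) y"
    using S(5) w j(4) by (simp add: at)
  show "\<lbrakk>i \<in> Arr E; y \<in> Arr E; Dom E y = Dom E i; Cod E i = Cod E p; Cod E y = Dom E r;
      r \<cdot> y = tri_pos E r q \<cdot> pos v \<cdot> i; z \<in> Arr E; Dom E z = Dom E i; Cod E z = Dom E q;
      q \<cdot> z = tri_at r q (pos v \<cdot> i) y\<rbrakk> \<Longrightarrow>
      coc_ev E q p (sharp_at E (coadjunct q p r v) i y) z =
      sharp_at E v i (tri_dir r q (pos v \<cdot> i) y z)"
    using S(6)[of "pb_pair E m r i y" z] w j(4) by (simp add: at)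
qed

lemmas adjunct_simps [simp] = adjunct_props
lemmas coadjunct_simps [simp] = coadjunct_props

text \<open>Directions here are elements of the coclosure, so \<open>coc_ext\<close> applies; the
  rules for \<open>coadjunct\<close> and \<open>adjunct\<close> then compute the position of
  \<open>q\<close> and the evaluation back to those of \<open>u\<close>.\<close>

lemma coadjunct_adjunct:
  assumes "p \<in> Arr E" "q \<in> Arr E" "r \<in> Arr E" and u: "u \<in> Arr (Poly E)" "src u = coc E q p" "tgt u = r"
  shows "coadjunct q p r (adjunct q p r u) = u"
proof (rule Poly_eqI, goal_cases)
  case (6 i y)
  then have iy: "i \<in> Arr E" "y \<in> Arr E" "Dom E y = Dom E i" "Cod E i = Cod E p" "Cod E y = Dom E r"
    "r \<cdot> y = pos u \<cdot> i"
    using assms by simp_all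
  show ?case
    by (rule coc_ext[of p q]) (use assms iy comp_reassoc[OF iy(6)] in simp_all)
qed (use assms in simp_all)

text \<open>Positions agree by \<open>tri_pos_ext\<close>, as \<open>tri_at\<close> is carried
  unchanged through \<open>coc_j\<close>. Directions agree because \<open>d\<close> is recovered
  from its two components.\<close>

lemma adjunct_coadjunct:
  assumes pqr: "p \<in> Arr E" "q \<in> Arr E" "r \<in> Arr E"
    and v: "v \<in> Arr (Poly E)" "src v = p" "tgt v = tri E r q"
  shows "adjunct q p r (coadjunct q p r v) = v"
proof -
  let ?w = "coadjunct q p r v"
  have pv: "pos v \<in> Arr E" "Dom E (pos v) = Cod E p" "Cod E (pos v) = Dom E (tri_pos E r q)"
    using Poly_arr[OF v(1)] v pqr by simp_all
  have w: "?w \<in> Arr (Poly E)" "src ?w = coc E q p" "tgt ?w = r" "pos ?w = tri_pos E r q \<cdot> pos v"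
    using pqr v by (simp_all only: coadjunct_props)
  have aw: "pos (adjunct q p r ?w) \<in> Arr E" "Dom E (pos (adjunct q p r ?w)) = Cod E p"
    "Cod E (pos (adjunct q p r ?w)) = Dom E (tri_pos E r q)"
    "tri_pos E r q \<cdot> pos (adjunct q p r ?w) = tri_pos E r q \<cdot> pos v"
    using Poly_arr[OF adjunct_arr[OF pqr(1,2) w(1-3)]] pqr adjunct_ends[OF pqr(1,2) w(1-3)]
      adjunct_pos(1)[OF pqr(1,2) w(1-3)] w(4) by simp_all
  have pos: "pos (adjunct q p r ?w) = pos v"
  proof (rule tri_pos_ext[of r q], goal_cases)
    case (9 s y)
    then have s: "s \<in> Arr E" "y \<in> Arr E" "Dom E y = Dom E s" "Cod E s = Cod E p" "Cod E y = Dom E r"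
      "r \<cdot> y = tri_pos E r q \<cdot> pos v \<cdot> s"
      using aw by simp_all
    then have "r \<cdot> y = pos ?w \<cdot> s"
      using pqr pv w(4) by simp
    with s show ?case
      using adjunct_at[OF pqr(1,2) w(1-3)] coadjunct_j[OF pqr v] by simp
  qed (use pqr pv aw in simp_all)
  show ?thesis
  proof (rule Poly_eqI, goal_cases)
    case (6 i d)
    then have id: "i \<in> Arr E" "d \<in> Arr E" "Dom E d = Dom E i" "Cod E i = Cod E p"
      "Cod E d = Dom E (tri E r q)" "tri E r q \<cdot> d = pos v \<cdot> i"
      using pqr v pos by simp_all
    note d = tri_dir12[OF pqr(3,2) id(2,5,6)]
    have "sharp_at E (adjunct q p r ?w) i d =
        coc_ev E q p (sharp_at E ?w i (tri_dir1 r q d)) (tri_dir2 r q d)"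
      by (rule adjunct_sharp) (use pqr v id pos in simp_all)
    also have "\<dots> = sharp_at E v i (tri_dir r q (pos v \<cdot> i) (tri_dir1 r q d) (tri_dir2 r q d))"
      by (rule coadjunct_ev) (use pqr v id(1-5) d(1-8) pv in simp_all)
    finally show ?case
      by (simp add: d(9))
  qed (use pqr v pos in simp_all)
qed

text \<open>On directions both sides send \<open>(y, z)\<close> at \<open>i\<close> to
  \<open>h\<^sup>\<sharp>(i, g (\<psi>\<^sup>\<sharp>(j, z)))\<close>, where \<open>(j, g)\<close>
  is the direction that \<open>u\<close> assigns to \<open>y\<close> pulled back along
  \<open>k\<close>. Setting \<psi> to an identity gives the naturality of the adjunction; setting
  \<open>h\<close> and \<open>k\<close> to identities gives naturality in \<open>q\<close>.\<close>

lemma adjunct_natural: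
  assumes \<psi>: "\<psi> \<in> Arr (Poly E)" "src \<psi> = q" "tgt \<psi> = q'"
    and h: "h \<in> Arr (Poly E)" "src h = p'" "tgt h = p"
    and k: "k \<in> Arr (Poly E)" "src k = r" "tgt k = r'"
    and u: "u \<in> Arr (Poly E)" "src u = coc E q p" "tgt u = r"
  shows "adjunct q' p' r' (Comp (Poly E) k (Comp (Poly E) u (coc_arr E \<psi> h))) =
    Comp (Poly E) (tri_arr E k \<psi>) (Comp (Poly E) (adjunct q p r u) h)"
proof -
  let ?c = "coc_arr E \<psi> h" and ?a = "adjunct q p r u" and ?t = "tri_arr E k \<psi>"
  let ?w = "Comp (Poly E) k (Comp (Poly E) u ?c)"
  have obj: "q \<in> Arr E" "q' \<in> Arr E" "p \<in> Arr E" "p' \<in> Arr E" "r \<in> Arr E" "r' \<in> Arr E"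
    using Poly_arr(1,2)[OF \<psi>(1)] Poly_arr(1,2)[OF h(1)] Poly_arr(1,2)[OF k(1)] \<psi> h k by simp_all
  have hp: "pos h \<in> Arr E" "Dom E (pos h) = Cod E p'" "Cod E (pos h) = Cod E p"
    using Poly_arr[OF h(1)] h by simp_all
  have up: "pos u \<in> Arr E" "Dom E (pos u) = Cod E p" "Cod E (pos u) = Cod E r"
    using Poly_arr[OF u(1)] u obj by simp_all
  have c: "?c \<in> Arr (Poly E)" "src ?c = coc E q' p'" "tgt ?c = coc E q p" "pos ?c = pos h"
    using \<psi> h by simp_all
  have a: "?a \<in> Arr (Poly E)" "src ?a = p" "tgt ?a = tri E r q"
    using obj u by simp_all
  have ap: "pos ?a \<in> Arr E" "Dom E (pos ?a) = Cod E p" "Cod E (pos ?a) = Dom E (tri_pos E r q)"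
    "tri_pos E r q \<cdot> pos ?a = pos u"
    using Poly_arr[OF a(1)] a obj adjunct_pos(1)[OF obj(3,1) u] by simp_all
  have t: "?t \<in> Arr (Poly E)" "src ?t = tri E r q" "tgt ?t = tri E r' q'"
    using \<psi> k by simp_all
  have tp: "pos ?t \<in> Arr E" "Dom E (pos ?t) = Dom E (tri_pos E r q)"
    "Cod E (pos ?t) = Dom E (tri_pos E r' q')"
    using Poly_arr[OF t(1)] t obj by simp_all
  have w: "?w \<in> Arr (Poly E)" "src ?w = coc E q' p'" "tgt ?w = r'" "pos ?w = pos k \<cdot> pos u \<cdot> pos h"
    using c k u by simp_all
  have aw: "adjunct q' p' r' ?w \<in> Arr (Poly E)" "src (adjunct q' p' r' ?w) = p'"
    "tgt (adjunct q' p' r' ?w) = tri E r' q'"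
    using adjunct_arr[OF obj(4,2) w(1-3)] adjunct_ends[OF obj(4,2) w(1-3)] .
  have awp: "pos (adjunct q' p' r' ?w) \<in> Arr E" "Dom E (pos (adjunct q' p' r' ?w)) = Cod E p'"
    "Cod E (pos (adjunct q' p' r' ?w)) = Dom E (tri_pos E r' q')"
    "tri_pos E r' q' \<cdot> pos (adjunct q' p' r' ?w) = pos k \<cdot> pos u \<cdot> pos h"
    using Poly_arr[OF aw(1)] aw obj adjunct_pos(1)[OF obj(4,2) w(1-3)] w(4) by simp_all
  have rhs: "Comp (Poly E) ?t (Comp (Poly E) ?a h) \<in> Arr (Poly E)"
    "src (Comp (Poly E) ?t (Comp (Poly E) ?a h)) = p'"
    "tgt (Comp (Poly E) ?t (Comp (Poly E) ?a h)) = tri E r' q'"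
    "pos (Comp (Poly E) ?t (Comp (Poly E) ?a h)) = pos ?t \<cdot> pos ?a \<cdot> pos h"
    using t a h by simp_all
  have kp: "pos k \<in> Arr E" "Dom E (pos k) = Cod E r" "Cod E (pos k) = Cod E r'"
    using Poly_arr[OF k(1)] k by simp_all
  have ap_comp: "tri_pos E r q \<cdot> pos ?a \<cdot> x = pos u \<cdot> x" if "x \<in> Arr E" "Cod E x = Cod E p" for x
    using adjunct_pos(2)[OF obj(3,1) u] that .
  have w_sharp: "sharp_at E ?w i y =
      sharp_at E ?c i (sharp_at E u (pos h \<cdot> i) (sharp_at E k (pos u \<cdot> pos h \<cdot> i) y))"
    if "i \<in> Arr E" "y \<in> Arr E" "Dom E y = Dom E i" "Cod E i = Cod E p'" "Cod E y = Dom E r'"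
      "r' \<cdot> y = pos k \<cdot> pos u \<cdot> pos h \<cdot> i" for i y
    using that obj c u k hp up by simp
  have Y: "sharp_at E k (pos u \<cdot> x) y \<in> Arr E" "Dom E (sharp_at E k (pos u \<cdot> x) y) = Dom E x"
    "Cod E (sharp_at E k (pos u \<cdot> x) y) = Dom E r" "r \<cdot> sharp_at E k (pos u \<cdot> x) y = pos u \<cdot> x"
    if "x \<in> Arr E" "y \<in> Arr E" "Dom E y = Dom E x" "Cod E x = Cod E p" "Cod E y = Dom E r'"
      "r' \<cdot> y = pos k \<cdot> pos u \<cdot> x" for x y
    using that k up by simp_all
  have K: "sharp_at E u x y \<in> Arr E" "Dom E (sharp_at E u x y) = Dom E x"
    "Cod E (sharp_at E u x y) = Dom E (coc E q p)" "coc E q p \<cdot> sharp_at E u x y = x"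
    if "x \<in> Arr E" "y \<in> Arr E" "Dom E y = Dom E x" "Cod E x = Cod E p" "Cod E y = Dom E r"
      "r \<cdot> y = pos u \<cdot> x" for x y
    using that obj u by simp_all
  \<comment> \<open>The first equation identifies the positions. The second gives their common
    value, needed later to know over which position of \<open>q'\<close> the component
    \<open>z\<close> lies.\<close>
  have at: "tri_at r' q' (pos (adjunct q' p' r' ?w) \<cdot> i) y =
      tri_at r' q' (pos ?t \<cdot> pos ?a \<cdot> pos h \<cdot> i) y"
    "tri_at r' q' (pos (adjunct q' p' r' ?w) \<cdot> i) y =
      pos \<psi> \<cdot> coc_j E q p \<cdot> sharp_at E u (pos h \<cdot> i) (sharp_at E k (pos u \<cdot> pos h \<cdot> i) y)"
    if i: "i \<in> Arr E" "y \<in> Arr E" "Dom E y = Dom E i" "Cod E i = Cod E p'" "Cod E y = Dom E r'"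
      "r' \<cdot> y = pos k \<cdot> pos u \<cdot> pos h \<cdot> i" for i y
  proof -
    have x: "pos h \<cdot> i \<in> Arr E" "Dom E y = Dom E (pos h \<cdot> i)" "Cod E (pos h \<cdot> i) = Cod E p"
      using i hp by simp_all
    note Y = Y[OF x(1) i(2) x(2,3) i(5,6)]
    note K = K[OF x(1) Y(1,2) x(3) Y(3,4)]
    have "r' \<cdot> y = pos ?w \<cdot> i"
      using i w(4) hp up kp by simp
    then have "tri_at r' q' (pos (adjunct q' p' r' ?w) \<cdot> i) y = coc_j E q' p' \<cdot> sharp_at E ?w i y"
      using i by (intro adjunct_at[OF obj(4,2) w(1-3)])
    also have "\<dots> = pos \<psi> \<cdot> coc_j E q p \<cdot> sharp_at E u (pos h \<cdot> i) (sharp_at E k (pos u \<cdot> pos h \<cdot> i) y)"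
      unfolding w_sharp[OF i]
      by (rule coc_arr_j[OF \<psi>(1) h(1) h(2,3) \<psi>(2,3)]) (use i x K hp in simp_all)
    finally show 1: "tri_at r' q' (pos (adjunct q' p' r' ?w) \<cdot> i) y =
      pos \<psi> \<cdot> coc_j E q p \<cdot> sharp_at E u (pos h \<cdot> i) (sharp_at E k (pos u \<cdot> pos h \<cdot> i) y)" .
    have "tri_at r' q' (pos ?t \<cdot> pos ?a \<cdot> pos h \<cdot> i) y =
        pos \<psi> \<cdot> tri_at r q (pos ?a \<cdot> pos h \<cdot> i) (sharp_at E k (tri_pos E r q \<cdot> pos ?a \<cdot> pos h \<cdot> i) y)"
      by (rule tri_arr_at[OF k(1) \<psi>(1) k(2,3) \<psi>(2,3)])
        (use i x ap in \<open>simp_all add: ap_comp hp\<close>)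
    also have "\<dots> = pos \<psi> \<cdot> coc_j E q p \<cdot>
        sharp_at E u (pos h \<cdot> i) (sharp_at E k (pos u \<cdot> pos h \<cdot> i) y)"
      using adjunct_at[OF obj(3,1) u x(1) Y(1,2) x(3) Y(3,4)] x by (simp add: ap_comp)
    finally show "tri_at r' q' (pos (adjunct q' p' r' ?w) \<cdot> i) y =
        tri_at r' q' (pos ?t \<cdot> pos ?a \<cdot> pos h \<cdot> i) y"
      using 1 by simp
  qed
  have pos: "pos (adjunct q' p' r' ?w) = pos ?t \<cdot> pos ?a \<cdot> pos h"
  proof (rule tri_pos_ext[of r' q'], goal_cases)
    case (8)
    show ?case
      using awp tri_arr_pos[OF k(1) \<psi>(1) k(2,3) \<psi>(2,3), of "pos ?a \<cdot> pos h"] hp ap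
      by (simp add: ap_comp)
  next
    case (9 s y)
    have "r' \<cdot> y = pos k \<cdot> pos u \<cdot> pos h \<cdot> s"
      using 9 awp comp_reassoc[OF awp(4), of s] obj kp up hp by simp
    then show ?case
      using 9 awp at(1)[of s y] tp ap hp by simp
  qed (use obj awp tp ap hp in simp_all)
  show ?thesis
  proof (rule Poly_eqI, goal_cases)
    case (6 i d)
    have i: "i \<in> Arr E" "d \<in> Arr E" "Dom E d = Dom E i" "Cod E i = Cod E p'"
      "Cod E d = Dom E (tri E r' q')" "tri E r' q' \<cdot> d = pos ?t \<cdot> pos ?a \<cdot> pos h \<cdot> i"
      using 6 aw pos tp ap hp by simp_all
    define x where "x = pos h \<cdot> i"
    have x: "x \<in> Arr E" "Dom E x = Dom E i" "Cod E x = Cod E p"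
      using i hp by (simp_all add: x_def)
    define y z where "y = tri_dir1 r' q' d" and "z = tri_dir2 r' q' d"
    note yz = tri_dir12[OF obj(6,2) i(2,5,6), folded y_def z_def]
    have tpos: "tri_pos E r' q' \<cdot> pos ?t \<cdot> pos ?a \<cdot> x = pos k \<cdot> pos u \<cdot> x"
      using tri_arr_pos[OF k(1) \<psi>(1) k(2,3) \<psi>(2,3), of "pos ?a \<cdot> x"] x ap by (simp add: ap_comp)
    have y: "y \<in> Arr E" "Dom E y = Dom E i" "Dom E y = Dom E x" "Cod E y = Dom E r'"
      "r' \<cdot> y = pos k \<cdot> pos u \<cdot> x"
      using yz i(3) x tpos by (simp_all add: x_def)
    \<comment> \<open>The direction is followed backwards: \<open>y\<close> through \<open>k\<close>
      to \<open>Y'\<close>, then through \<open>u\<close> to the coclosure direction \<kappa>, and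
      \<open>z\<close> through \<psi> at the position of \<open>q\<close> carried by
      \<kappa>.\<close>
    define Y' where "Y' = sharp_at E k (pos u \<cdot> x) y"
    note Y' = Y[OF x(1) y(1,3) x(3) y(4,5), folded Y'_def]
    define \<kappa> where "\<kappa> = sharp_at E u x Y'"
    note \<kappa> = K[OF x(1) Y'(1,2) x(3) Y'(3,4), folded \<kappa>_def]
    have z: "z \<in> Arr E" "Dom E z = Dom E i" "Cod E z = Dom E q'" "q' \<cdot> z = pos \<psi> \<cdot> coc_j E q p \<cdot> \<kappa>"
      using yz i(3) at[OF i(1) y(1,2) i(4) y(4) y(5)[unfolded x_def]]
      by (simp_all add: x_def \<kappa>_def Y'_def)
    define z' where "z' = sharp_at E \<psi> (coc_j E q p \<cdot> \<kappa>) z"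
    have z': "z' \<in> Arr E" "Dom E z' = Dom E i" "Cod E z' = Dom E q" "q \<cdot> z' = coc_j E q p \<cdot> \<kappa>"
      using z \<kappa> x \<psi> obj by (simp_all add: z'_def)
    have "sharp_at E (adjunct q' p' r' ?w) i d = coc_ev E q' p' (sharp_at E ?w i y) z"
      unfolding y_def z_def
      by (rule adjunct_sharp[OF obj(4,2) w(1-3)]) (use i pos tp ap hp in simp_all)
    also have "\<dots> = coc_ev E q' p' (sharp_at E ?c i \<kappa>) z"
      using w_sharp[OF i(1) y(1,2) i(4) y(4) y(5)[unfolded x_def]] by (simp add: \<kappa>_def Y'_def x_def)
    also have "\<dots> = sharp_at E h i (coc_ev E q p \<kappa> z')"
      unfolding z'_def
      by (rule coc_arr_ev[OF \<psi>(1) h(1) h(2,3) \<psi>(2,3)]) (use i x z \<kappa> in \<open>simp_all add: x_def\<close>)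
    finally have lhs: "sharp_at E (adjunct q' p' r' ?w) i d = sharp_at E h i (coc_ev E q p \<kappa> z')" .
    have at': "tri_at r q (pos ?a \<cdot> x) Y' = coc_j E q p \<cdot> \<kappa>"
      using adjunct_at[OF obj(3,1) u x(1) Y'(1,2) x(3) Y'(3,4)] by (simp add: \<kappa>_def)
    \<comment> \<open>The direction of \<open>r \<triangleleft> q\<close> between the two halves of
      the right-hand composite; evaluating the adjunct of \<open>u\<close> at it gives
      \<open>coc_ev E q p \<kappa> z'\<close>.\<close>
    define D where "D = tri_dir r q (pos ?a \<cdot> x) Y' z'"
    have "sharp_at E ?t (pos ?a \<cdot> x) d = tri_dir r q (pos ?a \<cdot> x) Y'
        (sharp_at E \<psi> (tri_at r q (pos ?a \<cdot> x) Y') (tri_dir2 r' q' d))"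
      by (rule tri_arr_sharp[OF k(1) \<psi>(1) k(2,3) \<psi>(2,3)])
        (use i x ap in \<open>simp_all add: x_def[symmetric] ap_comp Y'_def y_def\<close>)
    then have tD: "sharp_at E ?t (pos ?a \<cdot> x) d = D"
      by (simp add: D_def z'_def at' z_def)
    have px: "pos ?a \<cdot> x \<in> Arr E" "Dom E (pos ?a \<cdot> x) = Dom E x"
      "Cod E (pos ?a \<cdot> x) = Dom E (tri_pos E r q)" "tri_pos E r q \<cdot> pos ?a \<cdot> x = pos u \<cdot> x"
      using x ap by (simp_all add: ap_comp)
    have D: "D \<in> Arr E" "Dom E D = Dom E x" "Cod E D = Dom E (tri E r q)" "tri E r q \<cdot> D = pos ?a \<cdot> x"
      "tri_dir1 r q D = Y'" "tri_dir2 r q D = z'"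
      using tri_dir[OF obj(5,1) px(1) Y'(1) z'(1) _ _ px(3) Y'(3) z'(3)] px Y' z' at' x
      by (simp_all add: D_def)
    have aD: "sharp_at E ?a x D = coc_ev E q p \<kappa> z'"
      using adjunct_sharp[OF obj(3,1) u x(1) D(1,2) x(3) D(3,4)] by (simp add: D \<kappa>_def)
    have ha: "Comp (Poly E) ?a h \<in> Arr (Poly E)" "src (Comp (Poly E) ?a h) = p'"
      "tgt (Comp (Poly E) ?a h) = tri E r q" "pos (Comp (Poly E) ?a h) = pos ?a \<cdot> pos h"
      using a h by simp_all
    have "sharp_at E (Comp (Poly E) ?t (Comp (Poly E) ?a h)) i d =
        sharp_at E (Comp (Poly E) ?a h) i (sharp_at E ?t (pos ?a \<cdot> pos h \<cdot> i) d)"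
      using Comp_Poly(5)[OF ha(1) t(1), of i d] i ha t ap hp by simp
    also have "\<dots> = sharp_at E (Comp (Poly E) ?a h) i D"
      using tD by (simp add: x_def)
    also have "\<dots> = sharp_at E h i (sharp_at E ?a (pos h \<cdot> i) D)"
      by (rule Comp_Poly(5)) (use a h D i x in \<open>simp_all add: x_def\<close>)
    also have "\<dots> = sharp_at E h i (coc_ev E q p \<kappa> z')"
      using aD by (simp add: x_def)
    finally show ?case
      using lhs by simp
  qed (use aw rhs pos in simp_all)
qed

section \<open>Assembling the functors, the adjunction and its naturality\<close>

lemma tensor_functor:
  "is_functor (prod_cat (Poly E) (Poly E)) (Poly E) (tensor (Poly_tri E))"
proof -
  interpret P: is_category "prod_cat (Poly E) (Poly E)"
    by (intro prod_category Poly_category)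
  show ?thesis
    by unfold_locales (auto simp: Poly_tri_def tri_arr_Id tri_arr_Comp simp del: mem_hom_Poly, auto simp: tri_arr_Comp)
qed

lemma coclosure_functor:
  "is_functor (prod_cat (op_cat (Poly E)) (Poly E)) (Poly E) (coc_functor E)"
proof -
  interpret P: is_category "prod_cat (op_cat (Poly E)) (Poly E)"
    by (intro prod_category op_category Poly_category)
  show ?thesis
    by unfold_locales (auto simp: coc_functor_def coc_arr_Id simp del: mem_hom_Poly, auto simp: coc_arr_Comp)
qed

lemma coclosure_adjunction:
  assumes q: "q \<in> Arr E"
  shows "adjunction (Poly E) (Poly E) (fix_fst (Poly E) (coc_functor E) q)
    (fix_snd (Poly E) (tensor (Poly_tri E)) q) (adjunct q)"
proof -
  \<comment> \<open>\<open>fix_fst\<close> consults its category only for identities, which the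
    opposite category shares.\<close>
  have fix_op: "fix_fst (op_cat (Poly E)) = fix_fst (Poly E)"
    by (simp add: fix_fst_def fun_eq_iff)
  interpret F: is_functor "Poly E" "Poly E" "fix_fst (Poly E) (coc_functor E) q"
    unfolding fix_op[symmetric]
    by (rule fix_fst_functor[OF coclosure_functor]) (use q in \<open>auto intro: op_category Poly_category\<close>)
  interpret G: is_functor "Poly E" "Poly E" "fix_snd (Poly E) (tensor (Poly_tri E)) q"
    by (rule fix_snd_functor[OF tensor_functor]) (use q in \<open>auto intro: Poly_category\<close>)
  show ?thesis
  proof unfold_locales
    fix p r
    assume "p \<in> Obj (Poly E)" "r \<in> Obj (Poly E)"
    then have pr: "p \<in> Arr E" "r \<in> Arr E"
      by simp_all
    have "bij_betw (adjunct q p r) (hom (Poly E) (coc E q p) r) (hom (Poly E) p (tri E r q))"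
      by (rule bij_betw_byWitness[where f' = "coadjunct q p r"])
        (use pr q in \<open>auto simp: coadjunct_adjunct adjunct_coadjunct\<close>)
    then show "bij_betw (adjunct q p r)
        (hom (Poly E) (on_obj (fix_fst (Poly E) (coc_functor E) q) p) r)
        (hom (Poly E) p (on_obj (fix_snd (Poly E) (tensor (Poly_tri E)) q) r))"
      by (simp add: fix_fst_def fix_snd_def coc_functor_def Poly_tri_def del: mem_hom_Poly)
  next
    fix h p' p k r r' u
    assume "h \<in> hom (Poly E) p' p" "k \<in> hom (Poly E) r r'"
      "u \<in> hom (Poly E) (on_obj (fix_fst (Poly E) (coc_functor E) q) p) r"
    \<comment> \<open>The general naturality square with the identity on \<open>q\<close>, which is
      the arrow that \<open>fix_fst\<close> and \<open>fix_snd\<close> insert.\<close>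
    then show "adjunct q p' r' (Comp (Poly E) k (Comp (Poly E) u
        (on_arr (fix_fst (Poly E) (coc_functor E) q) h))) =
      Comp (Poly E) (on_arr (fix_snd (Poly E) (tensor (Poly_tri E)) q) k)
        (Comp (Poly E) (adjunct q p r u) h)"
      using adjunct_natural[of "Id (Poly E) q" q q h p' p k r r' u] q
      by (simp add: fix_fst_def fix_snd_def coc_functor_def Poly_tri_def)
  qed
qed

lemma Poly_right_coclosure: "right_coclosure (Poly_tri E) (coc_functor E)"
  unfolding right_coclosure_def Let_def
proof (intro conjI exI[of _ adjunct] ballI allI impI)
  show "unit_obj (Poly_tri E) \<in> Obj (carrier_cat (Poly_tri E))"
    by (simp add: Poly_tri_def one_obj)
  show "is_functor (prod_cat (carrier_cat (Poly_tri E)) (carrier_cat (Poly_tri E)))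
      (carrier_cat (Poly_tri E)) (tensor (Poly_tri E))"
    using tensor_functor by (simp add: Poly_tri_def)
  show "is_functor (prod_cat (op_cat (carrier_cat (Poly_tri E))) (carrier_cat (Poly_tri E)))
      (carrier_cat (Poly_tri E)) (coc_functor E)"
    using coclosure_functor by (simp add: Poly_tri_def)
  show "adjunction (carrier_cat (Poly_tri E)) (carrier_cat (Poly_tri E))
      (fix_fst (carrier_cat (Poly_tri E)) (coc_functor E) q)
      (fix_snd (carrier_cat (Poly_tri E)) (tensor (Poly_tri E)) q) (adjunct q)"
    if "q \<in> Obj (carrier_cat (Poly_tri E))" for q
    using coclosure_adjunction[of q] that by (simp add: Poly_tri_def)
next
  fix q q' p r \<psi> u
  assume A: "\<psi> \<in> hom (carrier_cat (Poly_tri E)) q q'" "p \<in> Obj (carrier_cat (Poly_tri E))"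
    "r \<in> Obj (carrier_cat (Poly_tri E))"
    "u \<in> hom (carrier_cat (Poly_tri E)) (on_obj (coc_functor E) (q, p)) r"
  then have u: "\<psi> \<in> Arr (Poly E)" "src \<psi> = q" "tgt \<psi> = q'" "p \<in> Arr E" "r \<in> Arr E"
    "u \<in> Arr (Poly E)" "src u = coc E q p" "tgt u = r"
    by (simp_all add: Poly_tri_def coc_functor_def)
  have q: "q \<in> Arr E" "q' \<in> Arr E"
    using u Poly_arr(1,2)[OF u(1)] by simp_all
  let ?c = "Comp (Poly E) u (coc_arr E \<psi> (Id (Poly E) p))"
  have "?c \<in> hom (Poly E) (coc E q' p) r" "adjunct q p r u \<in> hom (Poly E) p (tri E r q)"
    using u q by simp_all
  \<comment> \<open>Specialising the general square to identities on \<open>p\<close> and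
    \<open>r\<close> leaves one identity composite on each side; these equations remove
    them.\<close>
  then have "Comp (Poly E) (Id (Poly E) r) ?c = ?c"
    "Comp (Poly E) (adjunct q p r u) (Id (Poly E) p) = adjunct q p r u"
    using Poly.Id_Comp Poly.Comp_Id by blast+
  then show "adjunct q' p r (Comp (carrier_cat (Poly_tri E)) u
      (on_arr (coc_functor E) (\<psi>, Id (carrier_cat (Poly_tri E)) p))) =
    Comp (carrier_cat (Poly_tri E)) (on_arr (tensor (Poly_tri E)) (Id (carrier_cat (Poly_tri E)) r, \<psi>))
      (adjunct q p r u)"
    using adjunct_natural[of \<psi> q q' "Id (Poly E) p" p p "Id (Poly E) r" r r u] u
    by (simp add: Poly_tri_def coc_functor_def)
qed

end

theorem corollary4p17:
  fixes E :: "('o, 'a) category"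
  assumes "is_category E"
    and "has_finite_limits E"
    and "locally_cartesian_closed E"
  shows "right_coclosure (Poly_tri E) (coc_functor E)"
proof -
  interpret lcc_category E
    using assms by (simp add: lcc_category_def lcc_category_axioms_def finite_limit_category_def
        finite_limit_category_axioms_def)
  show ?thesis
    by (rule Poly_right_coclosure)
qed

end
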